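(* A finitely generated, cancellative, abelian semigroup with no invertible elements is a complete intersection if and only if it is completely glued.
   Context: $\mathbb{N}$ is the set of nonnegative integers. A finitely generated, cancellative, abelian semigroup $S$ with no invertible elements is regarded as a subsemigroup $S=\mathbb{N}A$ (the set of $\mathbb{N}$-combinations) generated by a finite family $A=\{\mathbf a_1,\dots,\mathbf a_m\}$ in a group $\mathbb{Z}^n\oplus T$, $T$ a finite abelian group, with $S\cap(-S)=\{\mathbf 0\}$. Let $L\subset\mathbb{Z}^m$ be the kernel of the homomorphism $\mathbb{Z}^m\to\mathbb{Z}^n\oplus T$, $\mathbf e_i\mapsto\mathbf a_i$ ($\mathbf e_i$ the canonical basis). For $\alpha\in\mathbb{Z}^m$ write $\alpha=\alpha^+-\alpha^-$ with $\alpha^{\pm}\in\mathbb{N}^m$ the positive and negative parts. The lattice ideal of $L$ is $I_L=(\mathbf{x}^{\alpha^+}-\mathbf{x}^{\alpha^-}:\alpha\in L)$. The semigroup $S$ is a complete intersection if $I_L\subset\mathbb{Q}[x_1,\dots,x_m]$ is a complete intersection, i.e. the minimal number of generators of $I_L$ equals its height. For $E\subset\{1,\dots,m\}$, $A^E=\{\mathbf a_i:i\in E\}$, and $\mathbb{N}A^E$, $\mathbb{Z}A^E$ are the semigroup and group generated by $A^E$. Let $E_1,E_2$ be nonempty disjoint subsets of $\{1,\dots,m\}$ with union $\{1,\dots,m\}$. $\mathbb{N}A$ is the gluing of $\mathbb{N}A^{E_1}$ and $\mathbb{N}A^{E_2}$ if there is a nonzero $\mathbf a\in\mathbb{N}A^{E_1}\cap\mathbb{N}A^{E_2}$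 such that $\mathbb{Z}\mathbf a=\mathbb{Z}A^{E_1}\cap\mathbb{Z}A^{E_2}$. Elements $\mathbf a_1,\dots,\mathbf a_s$ of $\mathbb{Z}^n\oplus T$ are linearly independent if $\sum n_i\mathbf a_i=0$ with $n_i\in\mathbb{Z}$ implies all $n_i=0$. A semigroup is completely glued if it belongs to the smallest class of finitely generated, cancellative, abelian semigroups with no invertible elements that includes all semigroups generated by linearly independent elements and is closed under gluing. *)

theory Defs
  imports
    "HOL-Algebra.Ideal"
    "HOL-Library.Poly_Mapping"
    "HOL-Library.Product_Plus"
    "HOL-Library.Extended_Nat"
begin

section \<open>Abelian groups as modules over the integers\<close>

definition zscale :: "int \<Rightarrow> 'g::ab_group_add \<Rightarrow> 'g"
  where "zscale k x = (\<Sum>_<nat k. x) - (\<Sum>_<nat (- k). x)"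

lemma zscale_diff_nat:
  "zscale (int p - int q) x = (\<Sum>_<p. x) - (\<Sum>_<q. x)"
proof -
  have split: "(\<Sum>_<i + j. x) = (\<Sum>_<i. x) + (\<Sum>_<j. x)" for i j :: nat
    by (induction j) (simp_all add: algebra_simps)
  show ?thesis
  proof (cases "q \<le> p")
    case True
    then obtain d where "p = q + d" using le_Suc_ex by blast
    then show ?thesis by (simp add: zscale_def split)
  next
    case False
    then obtain d where "q = p + d" using le_Suc_ex by (meson nat_le_linear)
    then show ?thesis by (simp add: zscale_def split)
  qed
qed

lemma module_zscale: "module (zscale :: int \<Rightarrow> 'g::ab_group_add \<Rightarrow> 'g)"
proof
  fix k l :: int and x y :: 'g
  show add_right: "zscale k (x + y) = zscale k x + zscale k y" for k and x y :: 'g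
    by (simp add: zscale_def sum.distrib)
  show add_left: "zscale (k + l) x = zscale k x + zscale l x" for k l and x :: 'g
  proof -
    obtain p q where k: "k = int p - int q" using int_diff_cases by blast
    obtain r s where l: "l = int r - int s" using int_diff_cases by blast
    have split: "(\<Sum>_<i + j. x) = (\<Sum>_<i. x) + (\<Sum>_<j. x)" for i j :: nat
      by (induction j) (simp_all add: algebra_simps)
    have kl: "k + l = int (p + r) - int (q + s)" using k l by simp
    show ?thesis unfolding kl unfolding k l zscale_diff_nat split by simp
  qed
  have neg: "zscale (- k) x = - zscale k x" for k and x :: 'g
    by (simp add: zscale_def)
  have nat_case: "zscale k (zscale (int p) x) = zscale (k * int p) x" for k p and x :: 'g
  proof (induction p)
    case 0
    show ?case by (simp add: zscale_def)
  next
    case (Suc p)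
    have "zscale (int (Suc p)) x = zscale (int p) x + x"
      using zscale_diff_nat[of "Suc p" 0 x] zscale_diff_nat[of p 0 x] by (simp add: algebra_simps)
    then have "zscale k (zscale (int (Suc p)) x) = zscale (k * int p) x + zscale k x"
      by (simp only: add_right Suc.IH)
    also have "\<dots> = zscale (k * int (Suc p)) x"
      by (simp add: add_left[symmetric] algebra_simps)
    finally show ?case .
  qed
  have neg_right: "zscale k (- x) = - zscale k x" for k and x :: 'g
    by (simp add: zscale_def sum_negf)
  show "zscale k (zscale l x) = zscale (k * l) x"
  proof (cases l)
    case (nonneg n)
    then show ?thesis using nat_case by simp
  next
    case (neg n)
    then have "l = - int (Suc n)" by simp
    then show ?thesis using nat_case[of k "Suc n" x] \<open>\<And>x k. zscale (- k) x = - zscale k x\<close>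
      by (simp del: of_nat_Suc add: neg_right)
  qed
  show "zscale 1 x = x" by (simp add: zscale_def)
qed

text \<open>The subgroup generated by a set of group elements and linear independence over the
  integers are the notions of \<^theory>\<open>HOL.Modules\<close> for this module structure.\<close>

abbreviation zspan :: "'g::ab_group_add set \<Rightarrow> 'g set"
  where "zspan \<equiv> module.span zscale"

abbreviation zindependent :: "'g::ab_group_add set \<Rightarrow> bool"
  where "zindependent B \<equiv> \<not> module.dependent zscale B"

definition nspan :: "'g::ab_group_add set \<Rightarrow> 'g set"
  where "nspan B = {(\<Sum>b\<in>F. zscale (int (c b)) b) | F c. finite F \<and> F \<subseteq> B}"

definition no_invertibles :: "'g::ab_group_add set \<Rightarrow> bool"
  where "no_invertibles S \<longleftrightarrow> S \<inter> uminus ` S = {0}"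

section \<open>Polynomial rings, height and number of generators\<close>

text \<open>Polynomials in the variables with indices below \<open>m\<close>: an exponent vector is a finitely
  supported function, and a polynomial a finitely supported function on exponent vectors.
  Addition and multiplication are those of \<^theory>\<open>HOL-Library.Poly_Mapping\<close>, where
  multiplication is convolution.\<close>

definition poly_ring :: "nat \<Rightarrow> ((nat \<Rightarrow>\<^sub>0 nat) \<Rightarrow>\<^sub>0 rat) ring"
  where "poly_ring m =
    \<lparr>carrier = {p. \<forall>u\<in>Poly_Mapping.keys p. Poly_Mapping.keys u \<subseteq> {..<m}},
     mult = (*), one = 1, zero = 0, add = (+)\<rparr>"

lemma cring_poly_ring: "cring (poly_ring m)"
proof -
  let ?R = "poly_ring m"
  have ops: "mult ?R = (*)" "one ?R = 1" "zero ?R = 0" "add ?R = (+)"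
    by (simp_all add: poly_ring_def)
  have mem: "p \<in> carrier ?R \<longleftrightarrow> (\<forall>u\<in>Poly_Mapping.keys p. Poly_Mapping.keys u \<subseteq> {..<m})" for p
    by (simp add: poly_ring_def)
  have zero: "0 \<in> carrier ?R" and one: "1 \<in> carrier ?R"
    by (simp_all add: mem)
  have add: "p + q \<in> carrier ?R" if "p \<in> carrier ?R" "q \<in> carrier ?R" for p q
    using that Poly_Mapping.keys_add[of p q] unfolding mem by blast
  have uminus: "- p \<in> carrier ?R" if "p \<in> carrier ?R" for p
    using that by (simp add: mem)
  have mult: "p * q \<in> carrier ?R" if "p \<in> carrier ?R" "q \<in> carrier ?R" for p q
    unfolding mem
  proof
    fix u assume "u \<in> Poly_Mapping.keys (p * q)"
    then obtain s t where st: "s \<in> Poly_Mapping.keys p" "t \<in> Poly_Mapping.keys q" "u = s + t"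
      using Poly_Mapping.keys_mult[of p q] by blast
    then have "Poly_Mapping.keys s \<union> Poly_Mapping.keys t \<subseteq> {..<m}"
      using that unfolding mem by blast
    then show "Poly_Mapping.keys u \<subseteq> {..<m}"
      using Poly_Mapping.keys_add[of s t] st(3) by blast
  qed
  show ?thesis
  proof (rule cringI)
    show "abelian_group ?R"
      by (rule abelian_groupI)
        (auto simp: ops zero add add.assoc add.commute intro: bexI[OF _ uminus])
    show "Group.comm_monoid ?R"
      by (rule comm_monoidI) (auto simp: ops one mult mult.assoc mult.commute)
  qed (simp add: ops distrib_right)
qed

definition prime_height :: "('a, 'b) ring_scheme \<Rightarrow> 'a set \<Rightarrow> enat"
  where "prime_height R P = Sup {enat n | n.
    \<exists>C :: nat \<Rightarrow> 'a set. (\<forall>i\<le>n. primeideal (C i) R) \<and> (\<forall>i<n. C i \<subset> C (Suc i)) \<and> C n = P}"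

definition ideal_height :: "('a, 'b) ring_scheme \<Rightarrow> 'a set \<Rightarrow> enat"
  where "ideal_height R I = Inf {prime_height R P | P. primeideal P R \<and> I \<subseteq> P}"

definition min_generators :: "('a, 'b) ring_scheme \<Rightarrow> 'a set \<Rightarrow> enat"
  where "min_generators R I =
    Inf {enat (card B) | B. finite B \<and> B \<subseteq> carrier R \<and> genideal R B = I}"

section \<open>Lattice ideals and complete intersections\<close>

definition relation_lattice :: "nat \<Rightarrow> (nat \<Rightarrow> 'g::ab_group_add) \<Rightarrow> (nat \<Rightarrow>\<^sub>0 int) set"
  where "relation_lattice m a =
    {\<alpha>. Poly_Mapping.keys \<alpha> \<subseteq> {..<m} \<and> (\<Sum>i<m. zscale (Poly_Mapping.lookup \<alpha> i) (a i)) = 0}"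

definition pos_part :: "(nat \<Rightarrow>\<^sub>0 int) \<Rightarrow> (nat \<Rightarrow>\<^sub>0 nat)"
  where "pos_part \<alpha> = Poly_Mapping.map nat \<alpha>"

definition neg_part :: "(nat \<Rightarrow>\<^sub>0 int) \<Rightarrow> (nat \<Rightarrow>\<^sub>0 nat)"
  where "neg_part \<alpha> = pos_part (- \<alpha>)"

definition lattice_ideal :: "nat \<Rightarrow> (nat \<Rightarrow>\<^sub>0 int) set \<Rightarrow> ((nat \<Rightarrow>\<^sub>0 nat) \<Rightarrow>\<^sub>0 rat) set"
  where "lattice_ideal m L = genideal (poly_ring m)
    {Poly_Mapping.single (pos_part \<alpha>) 1 - Poly_Mapping.single (neg_part \<alpha>) 1 | \<alpha>. \<alpha> \<in> L}"

definition complete_intersection :: "nat \<Rightarrow> (nat \<Rightarrow> 'g::ab_group_add) \<Rightarrow> bool"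
  where "complete_intersection m a \<longleftrightarrow>
    (let I = lattice_ideal m (relation_lattice m a)
     in min_generators (poly_ring m) I = ideal_height (poly_ring m) I)"

section \<open>Gluing\<close>

definition gluing :: "nat \<Rightarrow> (nat \<Rightarrow> 'g::ab_group_add) \<Rightarrow> nat set \<Rightarrow> nat set \<Rightarrow> bool"
  where "gluing m a E1 E2 \<longleftrightarrow>
    E1 \<noteq> {} \<and> E2 \<noteq> {} \<and> E1 \<inter> E2 = {} \<and> E1 \<union> E2 = {..<m} \<and>
    (\<exists>b \<in> nspan (a ` E1) \<inter> nspan (a ` E2).
      b \<noteq> 0 \<and> zspan {b} = zspan (a ` E1) \<inter> zspan (a ` E2))"

text \<open>A property of the semigroup, not of a generating family; in particular the zero semigroup,
  generated by the empty (linearly independent) set, is completely glued.\<close>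

inductive completely_glued :: "'g::ab_group_add set \<Rightarrow> bool"
  where
    independent: "\<lbrakk>finite B; zindependent B\<rbrakk> \<Longrightarrow> completely_glued (nspan B)"
  | glue: "\<lbrakk>no_invertibles (nspan (a ` {..<m})); gluing m a E1 E2;
      completely_glued (nspan (a ` E1)); completely_glued (nspan (a ` E2))\<rbrakk>
      \<Longrightarrow> completely_glued (nspan (a ` {..<m}))"

end

(* Let r be the rank of the relation lattice L. Two facts about the lattice ideal I are elementary: its
   height is r, and it needs at least r generators (take derivatives at the point (1,...,1)).

   Suppose that I has r generators. Comparing the generators with the connected components of the fibres
   of the degree map shows that r pairs of exponent vectors generate the kernel congruence. Such pairs form
   a basis of L, and on every nonempty set C of columns fewer than |C| of these basis vectors have entries of
   both signs. A combinatorial induction then finds one basis vector whose positive and negative supports are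
   separated by a partition of the columns that every other basis vector respects. This is a gluing, and both
   parts inherit the hypothesis, so the semigroup is completely glued by induction on r.

   Conversely, the existence of a presentation by linearly independent relations does not depend on the
   choice of nonzero generators, holds for independent generators and passes to gluings, where the relation
   that expresses the common element b in both parts is added. Such a presentation has at most r relations,
   and the corresponding binomials generate I. *)
theory Submission
  imports Defs
begin

text \<open>Complete intersection is a property of the family of generators, complete gluing one of
  the semigroup, and the family may contain zeros and repetitions. The generators of I are tested
  instead at its zero with coordinate 1 at the zero generators and 0 elsewhere, where every zero
  generator accounts for an ideal generator of its own; it adds at most one to the rank, so it does
  not disturb the count. The group may have torsion; then L need not be saturated and I need not be
  prime, so the height is bounded from above through one suitable prime over I and from below for
  every prime over I. Torsion is harmless in gluings because a semigroup without invertible elements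
  has no nonzero torsion elements. Only the signs of a basis of L enter the search for a gluing.
  This is why the combinatorial part speaks of sets of columns instead of matrices: rows can be
  shortened and merged there although the results are no longer relations.\<close>

abbreviation lookup :: "('a \<Rightarrow>\<^sub>0 'b::zero) \<Rightarrow> 'a \<Rightarrow> 'b" where "lookup \<equiv> Poly_Mapping.lookup"
abbreviation keys :: "('a \<Rightarrow>\<^sub>0 'b::zero) \<Rightarrow> 'a set" where "keys \<equiv> Poly_Mapping.keys"
abbreviation single :: "'a \<Rightarrow> 'b \<Rightarrow> ('a \<Rightarrow>\<^sub>0 'b::zero)" where "single \<equiv> Poly_Mapping.single"

section \<open>Mixed dominating sign patterns\<close>

definition mixed_rows :: "'k set \<Rightarrow> ('k \<Rightarrow> 'i set) \<Rightarrow> ('k \<Rightarrow> 'i set) \<Rightarrow> 'i set \<Rightarrow> 'k set"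
  where "mixed_rows K P N C = {k \<in> K. P k \<inter> C \<noteq> {} \<and> N k \<inter> C \<noteq> {}}"

text \<open>Row \<open>k\<close> of a matrix is encoded by the columns \<open>P k\<close> of its
  positive and \<open>N k\<close> of its negative entries. The last clause forbids square
  submatrices all of whose rows have both signs. For singletons \<open>C\<close> it makes
  \<open>P k\<close> and \<open>N k\<close> disjoint.\<close>

definition mixed_dominating :: "'i set \<Rightarrow> 'k set \<Rightarrow> ('k \<Rightarrow> 'i set) \<Rightarrow> ('k \<Rightarrow> 'i set) \<Rightarrow> bool"
  where "mixed_dominating J K P N \<longleftrightarrow> finite J \<and> finite K \<and>
    (\<forall>k\<in>K. P k \<noteq> {} \<and> N k \<noteq> {} \<and> P k \<union> N k \<subseteq> J) \<and>
    (\<forall>C\<subseteq>J. C \<noteq> {} \<longrightarrow> card (mixed_rows K P N C) < card C)"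

definition splits :: "'k set \<Rightarrow> ('k \<Rightarrow> 'i set) \<Rightarrow> ('k \<Rightarrow> 'i set) \<Rightarrow> 'k \<Rightarrow> 'i set \<Rightarrow> bool"
  where "splits K P N k E \<longleftrightarrow>
    (P k \<subseteq> E \<and> N k \<inter> E = {} \<or> N k \<subseteq> E \<and> P k \<inter> E = {}) \<and>
    (\<forall>l\<in>K - {k}. P l \<union> N l \<subseteq> E \<or> (P l \<union> N l) \<inter> E = {})"

definition support_size :: "'k set \<Rightarrow> ('k \<Rightarrow> 'i set) \<Rightarrow> ('k \<Rightarrow> 'i set) \<Rightarrow> nat"
  where "support_size K P N = (\<Sum>k\<in>K. card (P k) + card (N k))"

text \<open>The induction hypothesis as a predicate, so that the reduction steps can be stated as
  separate lemmas. They apply it to other systems over the same types, which the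
  \<open>itself\<close> arguments record.\<close>

definition split_below :: "nat \<Rightarrow> 'k itself \<Rightarrow> 'i itself \<Rightarrow> bool"
  where "split_below n _ _ \<longleftrightarrow> (\<forall>J (K::'k set) (P::'k \<Rightarrow> 'i set) N.
    mixed_dominating J K P N \<and> K \<noteq> {} \<and> support_size K P N < n \<longrightarrow> (\<exists>k\<in>K. \<exists>E. splits K P N k E))"

lemma split_belowD:
  fixes P N :: "'k \<Rightarrow> 'i set"
  assumes "split_below n TYPE('k) TYPE('i)" "mixed_dominating J K P N" "K \<noteq> {}" "support_size K P N < n"
  obtains k E where "k \<in> K" "splits K P N k E"
  using assms unfolding split_below_def by meson

section \<open>Extending a split of a smaller system to all columns\<close>

lemma enlarge_side:
  assumes "X \<inter> Y = {}" "E' = E \<inter> X \<or> E' = E \<inter> X \<union> Y" "S \<subseteq> X"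
  shows "S \<subseteq> E' \<longleftrightarrow> S \<subseteq> E" "S \<inter> E' = {} \<longleftrightarrow> S \<inter> E = {}"
  using assms by blast+

lemma mixed_rows_fin: "finite K \<Longrightarrow> finite (mixed_rows K P N C)"
  by (simp add: mixed_rows_def)

text \<open>A row mixed on \<open>C\<close> in the smaller system is mixed on \<open>C\<close> in
  the larger one. So dominance survives the deletion of entries, rows and columns as long as every
  remaining row keeps both signs.\<close>

lemma mixed_dominating_mono:
  assumes "mixed_dominating J K P N" "K' \<subseteq> K" "J' \<subseteq> J"
    and "\<And>k. k \<in> K' \<Longrightarrow> P' k \<subseteq> P k \<and> N' k \<subseteq> N k \<and> P' k \<noteq> {} \<and> N' k \<noteq> {} \<and> P' k \<union> N' k \<subseteq> J'"
  shows "mixed_dominating J' K' P' N'"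
  unfolding mixed_dominating_def
proof (intro conjI ballI allI impI)
  show "finite J'" "finite K'" using assms by (auto simp: mixed_dominating_def intro: finite_subset)
  fix C assume C: "C \<subseteq> J'" "C \<noteq> {}"
  have "mixed_rows K' P' N' C \<subseteq> mixed_rows K P N C"
  proof
    fix k assume "k \<in> mixed_rows K' P' N' C"
    then have "k \<in> K'" "P' k \<inter> C \<noteq> {}" "N' k \<inter> C \<noteq> {}" by (auto simp: mixed_rows_def)
    then show "k \<in> mixed_rows K P N C" using assms(2) assms(4)[of k] unfolding mixed_rows_def by blast
  qed
  moreover have "finite (mixed_rows K P N C)" using assms(1) by (auto simp: mixed_rows_def mixed_dominating_def)
  ultimately have "card (mixed_rows K' P' N' C) \<le> card (mixed_rows K P N C)" by (meson card_mono)
  also have "\<dots> < card C" using assms(1,3) C by (auto simp: mixed_dominating_def)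
  finally show "card (mixed_rows K' P' N' C) < card C" .
next
  fix k assume "k \<in> K'"
  then show "P' k \<noteq> {}" "N' k \<noteq> {}" "P' k \<union> N' k \<subseteq> J'" using assms(4)[of k] by blast+
qed

text \<open>All of \<open>Y\<close> is put on the side of \<open>E\<close> on which the block
  \<open>v\<close> lies. Rows inside \<open>X\<close> do not notice this, and rows reaching from
  \<open>v\<close> into \<open>Y\<close> are not cut because \<open>E\<close> does not cut
  \<open>v\<close>.\<close>

lemma splits_extend_inside:
  assumes dXY: "X \<inter> Y = {}" and j: "P j \<union> N j \<subseteq> X" "P j \<subseteq> E \<and> N j \<inter> E = {} \<or> N j \<subseteq> E \<and> P j \<inter> E = {}"
    and v: "v \<subseteq> X" "v \<subseteq> E \<or> v \<inter> E = {}"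
    and rows: "\<And>i. i \<in> K - {j} \<Longrightarrow>
      P i \<union> N i \<subseteq> X \<and> (P i \<union> N i \<subseteq> E \<or> (P i \<union> N i) \<inter> E = {}) \<or> P i \<union> N i \<subseteq> v \<union> Y"
  shows "\<exists>E. splits K P N j E"
proof -
  define E' where "E' = (if v \<inter> E = {} then E \<inter> X else E \<inter> X \<union> Y)"
  have E': "E' = E \<inter> X \<or> E' = E \<inter> X \<union> Y" by (simp add: E'_def)
  note side = enlarge_side[OF dXY E']
  have vY: "v \<union> Y \<subseteq> E' \<or> (v \<union> Y) \<inter> E' = {}"
    using v dXY by (auto simp: E'_def)
  have "splits K P N j E'"
    unfolding splits_def
  proof (intro conjI ballI)
    have "P j \<subseteq> X" "N j \<subseteq> X" using j(1) by auto
    then show "P j \<subseteq> E' \<and> N j \<inter> E' = {} \<or> N j \<subseteq> E' \<and> P j \<inter> E' = {}" using j(2) by (simp only: side)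
    fix i assume "i \<in> K - {j}"
    from rows[OF this] show "P i \<union> N i \<subseteq> E' \<or> (P i \<union> N i) \<inter> E' = {}"
    proof
      assume "P i \<union> N i \<subseteq> X \<and> (P i \<union> N i \<subseteq> E \<or> (P i \<union> N i) \<inter> E = {})"
      then show ?thesis using side[of "P i \<union> N i"] by metis
    next
      assume "P i \<union> N i \<subseteq> v \<union> Y"
      then show ?thesis using vY by (elim disjE conjE) blast+
    qed
  qed
  then show ?thesis ..
qed

text \<open>Again \<open>Y\<close> follows \<open>v\<close>, but now the split row itself reaches
  into \<open>Y\<close>: its sides are \<open>w\<close> and a subset of \<open>v \<union> Y\<close>,
  and these are separated because \<open>E\<close> separates \<open>v\<close> from
  \<open>w\<close>.\<close>

lemma splits_extend_crossing:
  assumes dXY: "X \<inter> Y = {}" and vw: "v \<subseteq> X" "w \<subseteq> X" "v \<noteq> {}" "v \<subseteq> E \<and> w \<inter> E = {} \<or> w \<subseteq> E \<and> v \<inter> E = {}"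
    and j: "P j \<subseteq> v \<union> Y \<and> N j = w \<or> N j \<subseteq> v \<union> Y \<and> P j = w"
    and rows: "\<And>i. i \<in> K - {j} \<Longrightarrow>
      P i \<union> N i \<subseteq> X \<and> (P i \<union> N i \<subseteq> E \<or> (P i \<union> N i) \<inter> E = {}) \<or> P i \<union> N i \<subseteq> v \<union> Y"
  shows "\<exists>E. splits K P N j E"
proof -
  define E' where "E' = (if v \<inter> E = {} then E \<inter> X else E \<inter> X \<union> Y)"
  have E': "E' = E \<inter> X \<or> E' = E \<inter> X \<union> Y" by (simp add: E'_def)
  note side = enlarge_side[OF dXY E']
  have vY: "v \<union> Y \<subseteq> E' \<and> w \<inter> E' = {} \<or> w \<subseteq> E' \<and> (v \<union> Y) \<inter> E' = {}"
  proof (cases "v \<inter> E = {}")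
    case True
    then have "w \<subseteq> E" using vw(3,4) by blast
    then show ?thesis using True vw(1,2) dXY by (auto simp: E'_def)
  next
    case False
    then have "v \<subseteq> E" "w \<inter> E = {}" using vw(4) by blast+
    then show ?thesis using False vw(1,2) dXY by (auto simp: E'_def)
  qed
  have "splits K P N j E'"
    unfolding splits_def
  proof (intro conjI ballI)
    show "P j \<subseteq> E' \<and> N j \<inter> E' = {} \<or> N j \<subseteq> E' \<and> P j \<inter> E' = {}"
      using j vY by (elim disjE conjE) blast+
    fix i assume "i \<in> K - {j}"
    from rows[OF this] show "P i \<union> N i \<subseteq> E' \<or> (P i \<union> N i) \<inter> E' = {}"
    proof
      assume "P i \<union> N i \<subseteq> X \<and> (P i \<union> N i \<subseteq> E \<or> (P i \<union> N i) \<inter> E = {})"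
      then show ?thesis using side[of "P i \<union> N i"] by metis
    next
      assume "P i \<union> N i \<subseteq> v \<union> Y"
      then show ?thesis using vY by (elim disjE conjE) blast+
    qed
  qed
  then show ?thesis ..
qed

text \<open>Rows \<open>k\<close> and \<open>l\<close> both cross between \<open>X\<close> and \<open>Y\<close>. They are merged into one row, either on \<open>X\<close> or on \<open>Y\<close>.
  If neither merged system were dominating, with violating column sets \<open>C\<close> and \<open>D\<close>, then \<open>k\<close> and \<open>l\<close> would both be
  mixed on \<open>C \<union> D\<close>, and \<open>C \<union> D\<close> would violate the dominance of the original system.\<close>

lemma split_cross:
  fixes P N :: "'k \<Rightarrow> 'i set"
  assumes IH: "split_below (support_size K P N) TYPE('k) TYPE('i)"
    and dom: "mixed_dominating J K P N"
    and kl: "k \<in> K" "l \<in> K" "k \<noteq> l"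
    and XY: "J = X \<union> Y" "X \<inter> Y = {}"
    and l: "P l \<subseteq> X \<and> N l \<subseteq> Y \<or> P l \<subseteq> Y \<and> N l \<subseteq> X"
    and k: "N k \<subseteq> X" "P k \<inter> Y \<noteq> {}"
    and rest: "\<And>j. j \<in> K - {k,l} \<Longrightarrow> P j \<union> N j \<subseteq> X \<or> P j \<union> N j \<subseteq> Y"
  shows "\<exists>k\<in>K. \<exists>E. splits K P N k E"
proof -
  define A where "A = (P l \<union> N l) \<inter> X"
  define B where "B = (P l \<union> N l) \<inter> Y"
  define RX where "RX = {j \<in> K - {k,l}. P j \<union> N j \<subseteq> X}"
  define RY where "RY = {j \<in> K - {k,l}. P j \<union> N j \<subseteq> Y}"
  have fin: "finite J" "finite K" "finite RX" "finite RY" "finite X" "finite Y"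
    using dom XY by (auto simp: mixed_dominating_def RX_def RY_def)
  have ne: "P j \<noteq> {}" "N j \<noteq> {}" "P j \<union> N j \<subseteq> J" if "j \<in> K" for j
    using dom that by (auto simp: mixed_dominating_def)
  have disjR: "RX \<inter> RY = {}" using ne XY by (fastforce simp: RX_def RY_def)
  have KR: "K = RX \<union> RY \<union> {k,l}" using rest kl by (auto simp: RX_def RY_def)
  have AB: "A \<subseteq> X" "B \<subseteq> Y" "A \<noteq> {}" "B \<noteq> {}" "P l \<union> N l = A \<union> B"
    using l ne[OF kl(2)] XY(1) by (auto simp: A_def B_def)
  have domC: "card (mixed_rows K P N C) < card C" if "C \<subseteq> J" "C \<noteq> {}" for C
    using dom that by (auto simp: mixed_dominating_def)
  have domRX: "card (mixed_rows RX P N C) < card C" if "C \<subseteq> X" "C \<noteq> {}" for C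
  proof -
    have "mixed_rows RX P N C \<subseteq> mixed_rows K P N C" by (auto simp: mixed_rows_def RX_def)
    then show ?thesis using domC[of C] that XY fin by (meson card_mono mixed_rows_fin le_less_trans le_supI1)
  qed
  have domRY: "card (mixed_rows RY P N C) < card C" if "C \<subseteq> Y" "C \<noteq> {}" for C
  proof -
    have "mixed_rows RY P N C \<subseteq> mixed_rows K P N C" by (auto simp: mixed_rows_def RY_def)
    then show ?thesis using domC[of C] that XY fin by (meson card_mono mixed_rows_fin le_less_trans le_supI2)
  qed
  \<comment> \<open>Row \<open>l\<close> opposes \<open>A\<close> on \<open>X\<close> to
    \<open>B\<close> on \<open>Y\<close>. So on \<open>X\<close> the part of \<open>P k\<close> in
    \<open>Y\<close> is traded for \<open>A\<close>, and on \<open>Y\<close>, where \<open>k\<close>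
    has only positive entries, \<open>P k \<inter> Y\<close> is opposed to \<open>B\<close>. The
    merged row is called \<open>k\<close> on \<open>X\<close> and \<open>l\<close> on
    \<open>Y\<close>.\<close>
  define PX where "PX = P(k := P k \<inter> X \<union> A)"
  define PY where "PY = P(l := P k \<inter> Y)"
  define NY where "NY = N(l := B)"
  have either: "mixed_dominating X (insert k RX) PX N \<or> mixed_dominating Y (insert l RY) PY NY"
  proof (rule ccontr)
    assume neg: "\<not> ?thesis"
    have rowsX: "\<forall>j\<in>insert k RX. PX j \<noteq> {} \<and> N j \<noteq> {} \<and> PX j \<union> N j \<subseteq> X"
      using AB ne kl k by (auto simp: PX_def RX_def)
    have rowsY: "\<forall>j\<in>insert l RY. PY j \<noteq> {} \<and> NY j \<noteq> {} \<and> PY j \<union> NY j \<subseteq> Y"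
      using AB ne kl k by (auto simp: PY_def NY_def RY_def)
    from neg rowsX fin obtain C where C: "C \<subseteq> X" "C \<noteq> {}" "\<not> card (mixed_rows (insert k RX) PX N C) < card C"
      by (auto simp: mixed_dominating_def)
    from neg rowsY fin obtain D where D: "D \<subseteq> Y" "D \<noteq> {}" "\<not> card (mixed_rows (insert l RY) PY NY D) < card D"
      by (auto simp: mixed_dominating_def)
    have eqX: "mixed_rows (insert k RX) PX N C = mixed_rows RX P N C \<union>
        (if (P k \<inter> X \<union> A) \<inter> C \<noteq> {} \<and> N k \<inter> C \<noteq> {} then {k} else {})"
      using kl by (auto simp: mixed_rows_def PX_def RX_def)
    have eqY: "mixed_rows (insert l RY) PY NY D = mixed_rows RY P N D \<union>
        (if (P k \<inter> Y) \<inter> D \<noteq> {} \<and> B \<inter> D \<noteq> {} then {l} else {})"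
      using kl by (auto simp: mixed_rows_def PY_def NY_def RY_def)
    have kC: "(P k \<inter> X \<union> A) \<inter> C \<noteq> {} \<and> N k \<inter> C \<noteq> {}"
      using C eqX domRX[of C] by (auto split: if_splits)
    have lD: "(P k \<inter> Y) \<inter> D \<noteq> {} \<and> B \<inter> D \<noteq> {}"
      using D eqY domRY[of D] by (auto split: if_splits)
    have kn: "k \<notin> mixed_rows RX P N C" "l \<notin> mixed_rows RY P N D" by (auto simp: mixed_rows_def RX_def RY_def)
    have cX: "card (mixed_rows RX P N C) + 1 \<ge> card C"
      using C(3) eqX kC kn fin mixed_rows_fin[of RX P N C] by simp
    have cY: "card (mixed_rows RY P N D) + 1 \<ge> card D"
      using D(3) eqY lD kn fin mixed_rows_fin[of RY P N D] by simp
    \<comment> \<open>If \<open>A\<close> missed \<open>C\<close>, row \<open>k\<close> would be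
      mixed on \<open>C\<close> already with its original signs, and \<open>C\<close> would violate
      dominance by itself.\<close>
    have AC: "A \<inter> C \<noteq> {}"
    proof
      assume "A \<inter> C = {}"
      then have "insert k (mixed_rows RX P N C) \<subseteq> mixed_rows K P N C"
        using kC kl by (auto simp: mixed_rows_def RX_def)
      then have "card (insert k (mixed_rows RX P N C)) \<le> card (mixed_rows K P N C)"
        using fin by (intro card_mono mixed_rows_fin) auto
      then show False using cX kn fin mixed_rows_fin[of RX P N C] domC[of C] C XY by fastforce
    qed
    have sub: "insert k (insert l (mixed_rows RX P N C \<union> mixed_rows RY P N D)) \<subseteq> mixed_rows K P N (C \<union> D)"
    proof -
      have "k \<in> mixed_rows K P N (C \<union> D)" using kC lD kl(1) by (auto simp: mixed_rows_def)
      moreover have "P l \<inter> (C \<union> D) \<noteq> {} \<and> N l \<inter> (C \<union> D) \<noteq> {}"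
      proof (cases "P l \<subseteq> X \<and> N l \<subseteq> Y")
        case True
        then have "A \<subseteq> P l" "B \<subseteq> N l" using XY(2) by (auto simp: A_def B_def)
        then show ?thesis using AC lD by blast
      next
        case False
        then have "A \<subseteq> N l" "B \<subseteq> P l" using XY(2) l by (auto simp: A_def B_def)
        then show ?thesis using AC lD by blast
      qed
      moreover have "mixed_rows RX P N C \<subseteq> mixed_rows K P N (C \<union> D)"
        "mixed_rows RY P N D \<subseteq> mixed_rows K P N (C \<union> D)"
        by (auto simp: mixed_rows_def RX_def RY_def)
      ultimately show ?thesis using kl(2) by (auto simp: mixed_rows_def)
    qed
    have "card (insert k (insert l (mixed_rows RX P N C \<union> mixed_rows RY P N D)))
        = card (mixed_rows RX P N C) + card (mixed_rows RY P N D) + 2"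
    proof -
      have "mixed_rows RX P N C \<inter> mixed_rows RY P N D = {}" using disjR by (auto simp: mixed_rows_def)
      moreover have "l \<notin> mixed_rows RX P N C \<union> mixed_rows RY P N D"
        "k \<notin> mixed_rows RX P N C \<union> mixed_rows RY P N D" by (auto simp: mixed_rows_def RX_def RY_def)
      ultimately show ?thesis using fin kl by (simp add: mixed_rows_fin card_Un_disjoint)
    qed
    then have "card C + card D \<le> card (mixed_rows K P N (C \<union> D))"
      using card_mono[OF mixed_rows_fin sub, OF fin(2)] cX cY by simp
    moreover have "card (C \<union> D) = card C + card D"
      using C D XY fin by (intro card_Un_disjoint) (auto intro: finite_subset)
    moreover have "card (mixed_rows K P N (C \<union> D)) < card (C \<union> D)" using C D XY by (intro domC) auto
    ultimately show False by simp
  qed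
  have finrow: "finite (P j)" "finite (N j)" if "j \<in> K" for j
    using ne[OF that] fin by (auto intro: finite_subset)
  have kP: "P k \<subseteq> X \<union> Y" using ne(3)[OF kl(1)] XY by auto
  have szl: "card (P l) + card (N l) = card A + card B"
  proof -
    have "P l \<inter> N l = {}" using l XY by auto
    then have "card (P l) + card (N l) = card (P l \<union> N l)" using finrow kl by (simp add: card_Un_disjoint)
    also have "\<dots> = card A + card B" using AB XY fin by (auto intro!: card_Un_disjoint intro: finite_subset)
    finally show ?thesis .
  qed
  \<comment> \<open>The merged system on \<open>X\<close> saves at least \<open>B\<close>, the one
    on \<open>Y\<close> at least \<open>A\<close>; hence both have smaller support.\<close>
  have szAB: "card A > 0" "card B > 0" using AB fin by (auto simp: card_gt_0_iff intro: finite_subset)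
  have sumK: "support_size K P N = support_size RX P N + support_size RY P N
      + (card (P k) + card (N k)) + (card (P l) + card (N l))"
  proof -
    have "k \<notin> RX \<union> RY" "l \<notin> RX \<union> RY" by (auto simp: RX_def RY_def)
    then show ?thesis unfolding support_size_def KR using fin disjR kl by (simp add: sum.union_disjoint)
  qed
  from either show ?thesis
  proof
    assume d: "mixed_dominating X (insert k RX) PX N"
    have "support_size (insert k RX) PX N = support_size RX PX N + (card (P k \<inter> X \<union> A) + card (N k))"
      using fin by (simp add: support_size_def RX_def PX_def)
    also have "support_size RX PX N = support_size RX P N"
      unfolding support_size_def by (rule sum.cong) (auto simp: PX_def RX_def)
    also have "card (P k \<inter> X \<union> A) \<le> card (P k) + card A"
      by (rule order.trans[OF card_Un_le]) (use finrow kl in \<open>auto intro!: card_mono\<close>)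
    finally have "support_size (insert k RX) PX N < support_size K P N" using sumK szl szAB by simp
    with IH d obtain j E where j: "j \<in> insert k RX" and E: "splits (insert k RX) PX N j E"
      by (metis split_belowD insert_not_empty)
    have RXE: "P i \<union> N i \<subseteq> E \<or> (P i \<union> N i) \<inter> E = {}" if "i \<in> RX - {j}" for i
    proof -
      have "PX i = P i" "i \<in> insert k RX - {j}" using that by (auto simp: PX_def RX_def)
      then show ?thesis using E unfolding splits_def by metis
    qed
    have RXX: "P i \<union> N i \<subseteq> X" if "i \<in> RX" for i using that by (auto simp: RX_def)
    have RYY: "P i \<union> N i \<subseteq> Y" if "i \<in> RY" for i using that by (auto simp: RY_def)
    have dXY: "X \<inter> Y = {}" using XY by simp
    have kPN: "P k \<union> N k \<subseteq> (P k \<inter> X \<union> A \<union> N k) \<union> Y" using kP by blast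
    have inside: "P i \<union> N i \<subseteq> X \<and> (P i \<union> N i \<subseteq> E \<or> (P i \<union> N i) \<inter> E = {}) \<or> P i \<union> N i \<subseteq> (P k \<inter> X \<union> A) \<union> Y"
      if i: "i \<in> K - {j, k}" for i
    proof -
      consider "i \<in> RX" | "i \<in> RY" | "i = l" using i KR by auto
      then show ?thesis
      proof cases
        case 1 then show ?thesis using RXE[of i] RXX[of i] i by simp
      next
        case 2 then show ?thesis using RYY[of i] by (simp add: le_supI2)
      next
        case 3 then show ?thesis using AB(2,5) by auto
      qed
    qed
    show ?thesis
    proof (cases "j = k")
      case True
      then have kE: "P k \<inter> X \<union> A \<subseteq> E \<and> N k \<inter> E = {} \<or> N k \<subseteq> E \<and> (P k \<inter> X \<union> A) \<inter> E = {}"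
        using E unfolding splits_def by (simp add: PX_def)
      have "\<exists>E. splits K P N k E"
      proof (rule splits_extend_crossing[where P = P and N = N and K = K and j = k, OF dXY _ k(1) _ kE])
        show "P k \<inter> X \<union> A \<subseteq> X" "P k \<inter> X \<union> A \<noteq> {}" using AB by auto
        show "P k \<subseteq> (P k \<inter> X \<union> A) \<union> Y \<and> N k = N k \<or> N k \<subseteq> (P k \<inter> X \<union> A) \<union> Y \<and> P k = N k" using kP by blast
      qed (use inside True in simp)
      then show ?thesis using kl by blast
    next
      case False
      with j have jR: "j \<in> RX" by auto
      have "k \<in> insert k RX - {j}" "PX k = P k \<inter> X \<union> A" using False by (auto simp: PX_def)
      then have vE: "P k \<inter> X \<union> A \<union> N k \<subseteq> E \<or> (P k \<inter> X \<union> A \<union> N k) \<inter> E = {}"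
        using E unfolding splits_def by metis
      have jE: "P j \<subseteq> E \<and> N j \<inter> E = {} \<or> N j \<subseteq> E \<and> P j \<inter> E = {}"
        using E False unfolding splits_def by (simp add: PX_def)
      have "\<exists>E. splits K P N j E"
      proof (rule splits_extend_inside[where P = P and N = N and K = K and j = j, OF dXY RXX[OF jR] jE _ vE])
        show "P k \<inter> X \<union> A \<union> N k \<subseteq> X" using AB(1) k(1) by blast
        fix i assume i: "i \<in> K - {j}"
        show "P i \<union> N i \<subseteq> X \<and> (P i \<union> N i \<subseteq> E \<or> (P i \<union> N i) \<inter> E = {}) \<or> P i \<union> N i \<subseteq> (P k \<inter> X \<union> A \<union> N k) \<union> Y"
        proof (cases "i = k")
          case False
          with i have "i \<in> K - {j, k}" by simp
          from inside[OF this] show ?thesis by (meson Un_mono order_refl order_trans sup_ge1)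
        qed (use kPN in simp)
      qed
      then show ?thesis using jR KR by blast
    qed
  next
    assume d: "mixed_dominating Y (insert l RY) PY NY"
    have "support_size (insert l RY) PY NY = support_size RY PY NY + (card (P k \<inter> Y) + card B)"
      using fin by (simp add: support_size_def RY_def PY_def NY_def)
    also have "support_size RY PY NY = support_size RY P N"
      unfolding support_size_def by (rule sum.cong) (auto simp: PY_def NY_def RY_def)
    also have "card (P k \<inter> Y) \<le> card (P k)"
      using finrow kl by (auto intro!: card_mono)
    finally have "support_size (insert l RY) PY NY < support_size K P N" using sumK szl szAB by simp
    with IH d obtain j E where j: "j \<in> insert l RY" and E: "splits (insert l RY) PY NY j E"
      by (metis split_belowD insert_not_empty)
    have RYE: "P i \<union> N i \<subseteq> E \<or> (P i \<union> N i) \<inter> E = {}" if "i \<in> RY - {j}" for i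
    proof -
      have "PY i = P i" "NY i = N i" "i \<in> insert l RY - {j}" using that by (auto simp: PY_def NY_def RY_def)
      then show ?thesis using E unfolding splits_def by metis
    qed
    have RXX: "P i \<union> N i \<subseteq> X" if "i \<in> RX" for i using that by (auto simp: RX_def)
    have RYY: "P i \<union> N i \<subseteq> Y" if "i \<in> RY" for i using that by (auto simp: RY_def)
    have dXY: "Y \<inter> X = {}" using XY by auto
    have kPN: "P k \<union> N k \<subseteq> (P k \<inter> Y) \<union> X" using kP k(1) by blast
    have inside: "P i \<union> N i \<subseteq> Y \<and> (P i \<union> N i \<subseteq> E \<or> (P i \<union> N i) \<inter> E = {}) \<or> P i \<union> N i \<subseteq> (P k \<inter> Y) \<union> X"
      if i: "i \<in> K - {j, l}" for i
    proof -
      consider "i \<in> RY" | "i \<in> RX" | "i = k" using i KR by auto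
      then show ?thesis
      proof cases
        case 1 then show ?thesis using RYE[of i] RYY[of i] i by simp
      next
        case 2 then show ?thesis using RXX[of i] by (simp add: le_supI2)
      next
        case 3 then show ?thesis using kPN by simp
      qed
    qed
    show ?thesis
    proof (cases "j = l")
      case True
      then have lE: "P k \<inter> Y \<subseteq> E \<and> B \<inter> E = {} \<or> B \<subseteq> E \<and> (P k \<inter> Y) \<inter> E = {}"
        using E unfolding splits_def by (simp add: PY_def NY_def)
      have "\<exists>E. splits K P N l E"
      proof (rule splits_extend_crossing[where P = P and N = N and K = K and j = l, OF dXY _ AB(2) k(2) lE])
        show "P k \<inter> Y \<subseteq> Y" by blast
        show "P l \<subseteq> (P k \<inter> Y) \<union> X \<and> N l = B \<or> N l \<subseteq> (P k \<inter> Y) \<union> X \<and> P l = B"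
          using l XY by (auto simp: B_def)
      qed (use inside True in simp)
      then show ?thesis using kl by blast
    next
      case False
      with j have jR: "j \<in> RY" by auto
      have "l \<in> insert l RY - {j}" "PY l = P k \<inter> Y" "NY l = B" using False by (auto simp: PY_def NY_def)
      then have vE: "P k \<inter> Y \<union> B \<subseteq> E \<or> (P k \<inter> Y \<union> B) \<inter> E = {}"
        using E unfolding splits_def by metis
      have jE: "P j \<subseteq> E \<and> N j \<inter> E = {} \<or> N j \<subseteq> E \<and> P j \<inter> E = {}"
        using E False unfolding splits_def by (simp add: PY_def NY_def)
      have "\<exists>E. splits K P N j E"
      proof (rule splits_extend_inside[where P = P and N = N and K = K and j = j, OF dXY RYY[OF jR] jE _ vE])
        show "P k \<inter> Y \<union> B \<subseteq> Y" using AB(2) by blast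
        fix i assume i: "i \<in> K - {j}"
        show "P i \<union> N i \<subseteq> Y \<and> (P i \<union> N i \<subseteq> E \<or> (P i \<union> N i) \<inter> E = {}) \<or> P i \<union> N i \<subseteq> (P k \<inter> Y \<union> B) \<union> X"
        proof (cases "i = l")
          case True
          then show ?thesis using AB(1,5) by auto
        next
          case False
          with i have "i \<in> K - {j, l}" by simp
          from inside[OF this] show ?thesis by (meson Un_mono order_refl order_trans sup_ge1)
        qed
      qed
      then show ?thesis using jR KR by blast
    qed
  qed
qed

text \<open>A row may be negated without affecting any of the notions, so the reduction step can be
  stated for a positive entry.\<close>

lemma splits_swap:
  "splits K (P(k := N k)) (N(k := P k)) j E \<longleftrightarrow> splits K P N j E"
  unfolding splits_def by (cases "j = k") (auto simp: Un_commute)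

lemma mixed_rows_swap: "mixed_rows K (P(k := N k)) (N(k := P k)) C = mixed_rows K P N C"
  by (auto simp: mixed_rows_def)

lemma mixed_dominating_swap:
  "mixed_dominating J K P N \<Longrightarrow> mixed_dominating J K (P(k := N k)) (N(k := P k))"
  unfolding mixed_dominating_def mixed_rows_swap by auto

lemma support_size_swap: "support_size K (P(k := N k)) (N(k := P k)) = support_size K P N"
  unfolding support_size_def by (rule sum.cong) auto

text \<open>The element \<open>q\<close> is removed from row \<open>k\<close>; a split of the smaller system can only fail to be a split
  of the original one because of where \<open>q\<close> lies.\<close>

lemma split_step:
  fixes P N :: "'k \<Rightarrow> 'i set"
  assumes IH: "split_below (support_size K P N) TYPE('k) TYPE('i)"
    and dom: "mixed_dominating J K P N"
    and k: "k \<in> K" and q: "q \<in> P k" and sg: "P k = {q} \<Longrightarrow> \<exists>n. N k = {n}"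
  shows "\<exists>k\<in>K. \<exists>E. splits K P N k E"
proof -
  have fin: "finite J" "finite K" using dom by (auto simp: mixed_dominating_def)
  have ne: "P j \<noteq> {}" "N j \<noteq> {}" "P j \<union> N j \<subseteq> J" if "j \<in> K" for j
    using dom that by (auto simp: mixed_dominating_def)
  have finrow: "finite (P j)" "finite (N j)" if "j \<in> K" for j
    using ne[OF that] fin by (auto intro: finite_subset)
  have disj: "P k \<inter> N k = {}"
  proof (rule ccontr)
    assume "P k \<inter> N k \<noteq> {}"
    then obtain c where c: "c \<in> P k" "c \<in> N k" by blast
    then have "k \<in> mixed_rows K P N {c}" "c \<in> J" using k ne[OF k] by (auto simp: mixed_rows_def)
    then have "card (mixed_rows K P N {c}) \<noteq> 0" using mixed_rows_fin[OF fin(2), of P N "{c}"] by auto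
    then show False using dom \<open>c \<in> J\<close> unfolding mixed_dominating_def
      by (metis card.empty card_insert_disjoint empty_iff empty_subsetI finite.emptyI insert_subset less_one insert_not_empty One_nat_def)
  qed
  define P' where "P' = P(k := P k - {q})"
  \<comment> \<open>If \<open>q\<close> is the last positive entry, the whole row is dropped. By
    \<open>sg\<close> its negative side is then a single column, which lies on one side of any
    split.\<close>
  define K' where "K' = (if P k = {q} then K - {k} else K)"
  show ?thesis
  proof (cases "K' = {}")
    case True
    then have "K = {k}" using k by (auto simp: K'_def split: if_splits)
    then have "splits K P N k (P k)" using disj by (auto simp: splits_def)
    then show ?thesis using k by blast
  next
    case False
    have K'K: "K' \<subseteq> K" by (auto simp: K'_def)
    have dom': "mixed_dominating J K' P' N"
    proof (rule mixed_dominating_mono[OF dom K'K order_refl])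
      fix j assume j: "j \<in> K'"
      then have "j \<in> K" using K'K by auto
      moreover have "P' j \<noteq> {}" using j q ne(1)[OF \<open>j \<in> K\<close>] by (auto simp: P'_def K'_def split: if_splits)
      ultimately show "P' j \<subseteq> P j \<and> N j \<subseteq> N j \<and> P' j \<noteq> {} \<and> N j \<noteq> {} \<and> P' j \<union> N j \<subseteq> J"
        using ne[of j] by (auto simp: P'_def split: if_splits)
    qed
    have "support_size K' P' N \<le> support_size K P' N"
      unfolding support_size_def using K'K fin by (intro sum_mono2) auto
    also have "support_size K P' N < support_size K P N"
      unfolding support_size_def
    proof (rule sum_strict_mono_ex1[OF fin(2)])
      have "card (P' i) \<le> card (P i)" if "i \<in> K" for i
        using finrow[OF that] by (auto simp: P'_def intro: card_mono)
      then show "\<forall>i\<in>K. card (P' i) + card (N i) \<le> card (P i) + card (N i)" by simp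
      have "card (P' k) < card (P k)" using q finrow[OF k] by (simp add: P'_def card_Diff1_less del: card_Diff_insert)
      then show "\<exists>i\<in>K. card (P' i) + card (N i) < card (P i) + card (N i)" using k by (intro bexI[of _ k]) auto
    qed
    finally obtain l E where l: "l \<in> K'" and E: "splits K' P' N l E"
      using split_belowD[OF IH dom' False] by metis
    have lK: "l \<in> K" using l K'K by blast
    have others: "P i \<union> N i \<subseteq> E \<or> (P i \<union> N i) \<inter> E = {}" if "i \<in> K - {k,l}" for i
    proof -
      have "i \<in> K' - {l}" "P' i = P i" using that by (auto simp: K'_def P'_def)
      then show ?thesis using E unfolding splits_def by metis
    qed
    show ?thesis
    proof (cases "l = k")
      case True
      then have K': "K' = K" "P k \<noteq> {q}" using l by (auto simp: K'_def split: if_splits)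
      have kE: "P k - {q} \<subseteq> E \<and> N k \<inter> E = {} \<or> N k \<subseteq> E \<and> (P k - {q}) \<inter> E = {}"
        using E True unfolding splits_def by (simp add: P'_def)
      define X where "X = (if P k - {q} \<subseteq> E \<and> N k \<inter> E = {} then J \<inter> E else J - E)"
      define Y where "Y = J - X"
      have kX: "P k - {q} \<subseteq> X" "N k \<subseteq> Y" using kE ne(3)[OF k] by (auto simp: X_def Y_def)
      have XY: "X \<inter> Y = {}" "J = X \<union> Y" by (auto simp: X_def Y_def)
      have rest: "P i \<union> N i \<subseteq> X \<or> P i \<union> N i \<subseteq> Y" if "i \<in> K - {k}" for i
      proof -
        have "P i \<union> N i \<subseteq> J" using ne(3)[of i] that by blast
        then show ?thesis using others[of i] True that unfolding X_def Y_def by auto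
      qed
      show ?thesis
      proof (cases "q \<in> X")
        case True
        have "splits K P N k X"
          unfolding splits_def
        proof (intro conjI ballI)
          show "P k \<subseteq> X \<and> N k \<inter> X = {} \<or> N k \<subseteq> X \<and> P k \<inter> X = {}" using kX XY True by blast
          fix i assume "i \<in> K - {k}"
          from rest[OF this] show "P i \<union> N i \<subseteq> X \<or> (P i \<union> N i) \<inter> X = {}" using XY by blast
        qed
        then show ?thesis using k by blast
      next
        case False
        then have qY: "q \<in> Y" using XY ne(3)[OF k] q by blast
        \<comment> \<open>Here \<open>q\<close> lies on the side of \<open>N k\<close>, and
          \<open>k\<close> is the only row that crosses. On \<open>Y\<close> the row is kept with
          \<open>q\<close> as its whole positive side; a split of this smaller system extends to
          \<open>X\<close>, the rest of \<open>P k\<close> following \<open>q\<close>.\<close>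
        define RY where "RY = {i \<in> K - {k}. P i \<union> N i \<subseteq> Y}"
        define Q where "Q = P(k := {q})"
        have RYK: "insert k RY \<subseteq> K" using k by (auto simp: RY_def)
        have domY: "mixed_dominating Y (insert k RY) Q N"
        proof (rule mixed_dominating_mono[OF dom RYK])
          show "Y \<subseteq> J" using XY by blast
          fix j assume "j \<in> insert k RY"
          then show "Q j \<subseteq> P j \<and> N j \<subseteq> N j \<and> Q j \<noteq> {} \<and> N j \<noteq> {} \<and> Q j \<union> N j \<subseteq> Y"
            using q qY kX(2) ne[of j] k by (auto simp: Q_def RY_def)
        qed
        have "support_size (insert k RY) Q N \<le> support_size K Q N"
          unfolding support_size_def using RYK fin by (intro sum_mono2) auto
        also have "support_size K Q N < support_size K P N"
          unfolding support_size_def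
        proof (rule sum_strict_mono_ex1[OF fin(2)])
          have "card (Q i) \<le> card (P i)" if "i \<in> K" for i
            using finrow[OF that] q by (auto simp: Q_def card_gt_0_iff Suc_le_eq)
          then show "\<forall>i\<in>K. card (Q i) + card (N i) \<le> card (P i) + card (N i)" by simp
          have "{q} \<subset> P k" using q K' by blast
          then have "card (Q k) < card (P k)" using finrow[OF k] by (simp add: Q_def psubset_card_mono flip: card_1_singleton_iff) (metis One_nat_def card.empty card_insert_disjoint empty_iff finite.emptyI psubset_card_mono)
          then show "\<exists>i\<in>K. card (Q i) + card (N i) < card (P i) + card (N i)" using k by (intro bexI[of _ k]) auto
        qed
        finally obtain j F where j: "j \<in> insert k RY" and F: "splits (insert k RY) Q N j F"
          using split_belowD[OF IH domY] by (metis insert_not_empty)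
        have RYF: "P i \<union> N i \<subseteq> F \<or> (P i \<union> N i) \<inter> F = {}" if "i \<in> RY - {j}" for i
        proof -
          have "i \<in> insert k RY - {j}" "Q i = P i" using that by (auto simp: Q_def RY_def)
          then show ?thesis using F unfolding splits_def by metis
        qed
        have dYX: "Y \<inter> X = {}" using XY by blast
        have rows: "P i \<union> N i \<subseteq> Y \<and> (P i \<union> N i \<subseteq> F \<or> (P i \<union> N i) \<inter> F = {}) \<or> P i \<union> N i \<subseteq> {q} \<union> X"
          if i: "i \<in> K - {k, j}" for i
        proof (cases "i \<in> RY")
          case True
          then show ?thesis using RYF[of i] i by (simp add: RY_def)
        next
          case False
          then show ?thesis using rest[of i] i by (auto simp: RY_def)
        qed
        have Pk: "P k \<subseteq> {q} \<union> X" using kX(1) by blast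
        have "\<exists>E. splits K P N j E"
        proof (cases "j = k")
          case True
          have "{q} \<subseteq> F \<and> N k \<inter> F = {} \<or> N k \<subseteq> F \<and> {q} \<inter> F = {}"
            using F True unfolding splits_def by (simp add: Q_def)
          from splits_extend_crossing[where P = P and N = N and K = K and j = k, OF dYX _ kX(2) _ this] show ?thesis
            using qY Pk rows True by simp
        next
          case False
          then have jR: "j \<in> RY" using j by blast
          have jF: "P j \<subseteq> F \<and> N j \<inter> F = {} \<or> N j \<subseteq> F \<and> P j \<inter> F = {}"
            using F False unfolding splits_def by (simp add: Q_def)
          have "k \<in> insert k RY - {j}" "Q k = {q}" using False by (auto simp: Q_def)
          then have kF: "{q} \<union> N k \<subseteq> F \<or> ({q} \<union> N k) \<inter> F = {}" using F unfolding splits_def by metis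
          show ?thesis
          proof (rule splits_extend_inside[where P = P and N = N and K = K and j = j, OF dYX _ jF _ kF])
            show "P j \<union> N j \<subseteq> Y" using jR by (simp add: RY_def)
            show "{q} \<union> N k \<subseteq> Y" using qY kX(2) by blast
            fix i assume i: "i \<in> K - {j}"
            show "P i \<union> N i \<subseteq> Y \<and> (P i \<union> N i \<subseteq> F \<or> (P i \<union> N i) \<inter> F = {}) \<or> P i \<union> N i \<subseteq> ({q} \<union> N k) \<union> X"
            proof (cases "i = k")
              case True
              then show ?thesis using Pk by blast
            next
              case False
              with i have "i \<in> K - {k, j}" by simp
              from rows[OF this] show ?thesis by (meson Un_mono order_refl order_trans sup_ge1)
            qed
          qed
        qed
        then show ?thesis using j RYK by blast
      qed
    next
      case False
      have lE: "P l \<subseteq> E \<and> N l \<inter> E = {} \<or> N l \<subseteq> E \<and> P l \<inter> E = {}"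
        using E False unfolding splits_def by (simp add: P'_def)
      have kE: "(P k - {q}) \<union> N k \<subseteq> E \<or> ((P k - {q}) \<union> N k) \<inter> E = {}"
      proof (cases "P k = {q}")
        case True
        then show ?thesis using sg by auto
      next
        case F: False
        then have "k \<in> K' - {l}" "P' k = P k - {q}" using False k by (auto simp: K'_def P'_def)
        then show ?thesis using E unfolding splits_def by metis
      qed
      define X where "X = (if (P k - {q}) \<union> N k \<subseteq> E then J \<inter> E else J - E)"
      define Y where "Y = J - X"
      have kX: "(P k - {q}) \<union> N k \<subseteq> X" using kE ne(3)[OF k] by (auto simp: X_def)
      have XY: "X \<inter> Y = {}" "J = X \<union> Y" by (auto simp: X_def Y_def)
      have lX: "P l \<subseteq> X \<and> N l \<subseteq> Y \<or> P l \<subseteq> Y \<and> N l \<subseteq> X"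
        using lE ne(3)[OF lK] unfolding X_def Y_def by auto
      have rest: "P i \<union> N i \<subseteq> X \<or> P i \<union> N i \<subseteq> Y" if "i \<in> K - {k,l}" for i
      proof -
        have "P i \<union> N i \<subseteq> J" using ne(3)[of i] that by blast
        then show ?thesis using others[of i] that unfolding X_def Y_def by auto
      qed
      show ?thesis
      proof (cases "q \<in> X")
        case True
        have "splits K P N l X"
          unfolding splits_def
        proof (intro conjI ballI)
          show "P l \<subseteq> X \<and> N l \<inter> X = {} \<or> N l \<subseteq> X \<and> P l \<inter> X = {}" using lX XY by blast
          fix i assume i: "i \<in> K - {l}"
          show "P i \<union> N i \<subseteq> X \<or> (P i \<union> N i) \<inter> X = {}"
          proof (cases "i = k")
            case True
            then show ?thesis using kX \<open>q \<in> X\<close> by blast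
          next
            case False
            then show ?thesis using rest[of i] i XY by blast
          qed
        qed
        then show ?thesis using lK by blast
      next
        \<comment> \<open>Now exactly the rows \<open>k\<close> and \<open>l\<close> cross between
          \<open>X\<close> and \<open>Y\<close>.\<close>
        case F: False
        then have "q \<in> Y" using XY ne(3)[OF k] q by blast
        then have "P k \<inter> Y \<noteq> {}" "N k \<subseteq> X" using q kX by auto
        with split_cross[OF IH dom k lK _ XY(2,1) lX _ _ rest] False show ?thesis by blast
      qed
    qed
  qed
qed

text \<open>Induction on the number of nonzero entries. An entry is taken from a sign set with at
  least two columns, after swapping signs if need be; when both sign sets are singletons the row
  disappears, which the singleton condition of \<open>split_step\<close> permits.\<close>

theorem mixed_dominating_splits:
  fixes P N :: "'k \<Rightarrow> 'i set"
  assumes "mixed_dominating J K P N" "K \<noteq> {}"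
  shows "\<exists>k\<in>K. \<exists>E. splits K P N k E"
  using assms
proof (induction "support_size K P N" arbitrary: J K P N rule: less_induct)
  case less
  have IH: "split_below (support_size K P N) TYPE('k) TYPE('i)"
    unfolding split_below_def by (intro allI impI, elim conjE) (rule less.hyps)
  have ne: "P j \<noteq> {}" "N j \<noteq> {}" if "j \<in> K" for j
    using less.prems(1) that by (auto simp: mixed_dominating_def)
  obtain k where k: "k \<in> K" using less.prems by blast
  show ?case
  proof (cases "\<exists>q. P k = {q}")
    case False
    then obtain q where "q \<in> P k" "P k \<noteq> {q}" using ne[OF k] by blast
    then show ?thesis using split_step[OF IH less.prems(1) k] by blast
  next
    case True
    then obtain p where p: "P k = {p}" by blast
    show ?thesis
    proof (cases "\<exists>n. N k = {n}")
      case True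
      then show ?thesis using split_step[OF IH less.prems(1) k, where q = p] p by blast
    next
      case False
      then obtain q where q: "q \<in> N k" "N k \<noteq> {q}" using ne[OF k] by blast
      have "\<exists>j\<in>K. \<exists>E. splits K (P(k := N k)) (N(k := P k)) j E"
        by (rule split_step[OF _ mixed_dominating_swap[OF less.prems(1)] k, where q = q])
          (use IH q in \<open>simp_all add: support_size_swap\<close>)
      then show ?thesis by (simp add: splits_swap)
    qed
  qed
qed

section \<open>Gluing along a split\<close>

interpretation zmod: module "zscale :: int \<Rightarrow> 'g::ab_group_add \<Rightarrow> 'g"
  by (rule module_zscale)

section \<open>Values of integer combinations of a family\<close>

definition zdeg :: "'i set \<Rightarrow> ('i \<Rightarrow> 'g::ab_group_add) \<Rightarrow> ('i \<Rightarrow> int) \<Rightarrow> 'g"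
  where "zdeg E a f = (\<Sum>i\<in>E. zscale (f i) (a i))"

lemma zdeg_0 [simp]: "zdeg E a (\<lambda>_. 0) = 0"
  by (simp add: zdeg_def)

lemma zdeg_add: "zdeg E a (\<lambda>i. f i + g i) = zdeg E a f + zdeg E a g"
  by (simp add: zdeg_def zmod.scale_left_distrib sum.distrib)

lemma zdeg_diff: "zdeg E a (\<lambda>i. f i - g i) = zdeg E a f - zdeg E a g"
  by (simp add: zdeg_def zmod.scale_left_diff_distrib sum_subtractf)

lemma zdeg_uminus: "zdeg E a (\<lambda>i. - f i) = - zdeg E a f"
  by (simp add: zdeg_def sum_negf)

lemma zdeg_scale: "zdeg E a (\<lambda>i. c * f i) = zscale c (zdeg E a f)"
  by (simp add: zdeg_def zmod.scale_sum_right)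

lemma zdeg_sum: "zdeg E a (\<lambda>i. \<Sum>k\<in>K. f k i) = (\<Sum>k\<in>K. zdeg E a (f k))"
proof -
  have "zscale (\<Sum>k\<in>K. f k i) (a i) = (\<Sum>k\<in>K. zscale (f k i) (a i))" for i
    by (rule zmod.scale_sum_left)
  then show ?thesis by (simp add: zdeg_def sum.swap[of _ K])
qed

lemma zdeg_combination:
  "zdeg E a (\<lambda>i. \<Sum>k\<in>K. c k * f k i) = (\<Sum>k\<in>K. zscale (c k) (zdeg E a (f k)))"
  unfolding zdeg_sum zdeg_scale ..

lemma zdeg_cong: "(\<And>i. i \<in> E \<Longrightarrow> f i = g i) \<Longrightarrow> zdeg E a f = zdeg E a g"
  by (simp add: zdeg_def cong: sum.cong)

lemma zdeg_family_cong: "(\<And>i. i \<in> E \<Longrightarrow> a i = a' i) \<Longrightarrow> zdeg E a f = zdeg E a' f"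
  by (simp add: zdeg_def cong: sum.cong)

lemma zdeg_restrict:
  assumes "finite F" "E \<subseteq> F" "\<And>i. i \<in> F - E \<Longrightarrow> f i = 0"
  shows "zdeg F a f = zdeg E a f"
  unfolding zdeg_def by (rule sum.mono_neutral_right) (use assms in auto)

lemma zdeg_union:
  "finite E \<Longrightarrow> finite F \<Longrightarrow> E \<inter> F = {} \<Longrightarrow> zdeg (E \<union> F) a f = zdeg E a f + zdeg F a f"
  by (simp add: zdeg_def sum.union_disjoint)

lemma zdeg_unit: "finite E \<Longrightarrow> j \<in> E \<Longrightarrow> zdeg E a (\<lambda>i. if i = j then c else 0) = zscale c (a j)"
  by (simp add: zdeg_def if_distrib[of "\<lambda>x. zscale x _"] cong: if_cong)

text \<open>\<open>nspan\<close> speaks of a set of elements, the rest of the proof of an indexed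
  family that may repeat elements. One direction chooses an index for each element, the other adds
  up the coefficients at all indices of the same element.\<close>

lemma nspan_image_iff:
  assumes "finite E"
  shows "x \<in> nspan (a ` E) \<longleftrightarrow> (\<exists>f. (\<forall>i. 0 \<le> f i) \<and> x = zdeg E a f)"
proof
  assume "x \<in> nspan (a ` E)"
  then obtain F c where F: "finite F" "F \<subseteq> a ` E" "x = (\<Sum>b\<in>F. zscale (int (c b)) b)"
    unfolding nspan_def by blast
  define g where "g b = (SOME i. i \<in> E \<and> a i = b)" for b
  have g: "g b \<in> E \<and> a (g b) = b" if "b \<in> F" for b
    unfolding g_def by (rule someI_ex) (use that F(2) in blast)
  define f where "f i = (if i \<in> g ` F then int (c (a i)) else 0)" for i
  have "inj_on g F" using g by (metis inj_onI)
  have "zdeg E a f = (\<Sum>i\<in>g ` F. zscale (f i) (a i))"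
    unfolding zdeg_def using g assms by (intro sum.mono_neutral_right) (auto simp: f_def)
  also have "\<dots> = (\<Sum>b\<in>F. zscale (int (c b)) b)"
    unfolding sum.reindex[OF \<open>inj_on g F\<close>] by (rule sum.cong) (auto simp: f_def g)
  finally show "\<exists>f. (\<forall>i. 0 \<le> f i) \<and> x = zdeg E a f" using F(3) by (intro exI[of _ f]) (auto simp: f_def)
next
  assume "\<exists>f. (\<forall>i. 0 \<le> f i) \<and> x = zdeg E a f"
  then obtain f where f: "\<And>i. 0 \<le> f i" "x = zdeg E a f" by blast
  define c where "c b = nat (\<Sum>i\<in>{i\<in>E. a i = b}. f i)" for b
  have "x = (\<Sum>b\<in>a ` E. \<Sum>i\<in>{i\<in>E. a i = b}. zscale (f i) (a i))"
    unfolding f(2) zdeg_def by (rule sum.image_gen[OF assms])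
  also have "\<dots> = (\<Sum>b\<in>a ` E. zscale (int (c b)) b)"
  proof (rule sum.cong[OF refl])
    fix b
    have "(\<Sum>i\<in>{i\<in>E. a i = b}. zscale (f i) (a i)) = (\<Sum>i\<in>{i\<in>E. a i = b}. zscale (f i) b)"
      by (rule sum.cong) auto
    also have "\<dots> = zscale (\<Sum>i\<in>{i\<in>E. a i = b}. f i) b" by (rule zmod.scale_sum_left[symmetric])
    also have "(\<Sum>i\<in>{i\<in>E. a i = b}. f i) = int (c b)" using f(1) by (simp add: c_def sum_nonneg)
    finally show "(\<Sum>i\<in>{i\<in>E. a i = b}. zscale (f i) (a i)) = zscale (int (c b)) b" .
  qed
  finally show "x \<in> nspan (a ` E)" unfolding nspan_def using assms by blast
qed

lemma zspan_image_iff: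
  assumes "finite E"
  shows "x \<in> zspan (a ` E) \<longleftrightarrow> (\<exists>f. x = zdeg E a f)"
proof
  assume "x \<in> zspan (a ` E)"
  then show "\<exists>f. x = zdeg E a f"
  proof (induction rule: zmod.span_induct_alt)
    case base
    then show ?case by (intro exI[of _ "\<lambda>_. 0"]) simp
  next
    case (step c x y)
    then obtain j f where "j \<in> E" "x = a j" "y = zdeg E a f" by blast
    then have "zscale c x + y = zdeg E a (\<lambda>i. (if i = j then c else 0) + f i)"
      by (simp only: zdeg_add zdeg_unit[OF assms])
    then show ?case by blast
  qed
next
  assume "\<exists>f. x = zdeg E a f"
  then show "x \<in> zspan (a ` E)"
    unfolding zdeg_def by (metis (no_types, lifting) image_eqI zmod.span_base zmod.span_scale zmod.span_sum)
qed

lemma nspan_mono: "A \<subseteq> B \<Longrightarrow> nspan A \<subseteq> nspan B"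
  unfolding nspan_def by blast

lemma no_invertibles_mono:
  assumes "no_invertibles (nspan B)" "A \<subseteq> B"
  shows "no_invertibles (nspan A)"
proof -
  have "0 \<in> nspan A" unfolding nspan_def by force
  moreover have "0 \<in> uminus ` nspan A" using calculation by (metis image_eqI neg_equal_zero minus_zero)
  moreover have "nspan A \<inter> uminus ` nspan A \<subseteq> {0}"
    using assms nspan_mono[OF assms(2)] unfolding no_invertibles_def by blast
  ultimately show ?thesis unfolding no_invertibles_def by blast
qed

text \<open>If \<open>f i > 0\<close>, lowering this coefficient by one gives a nonnegative
  combination equal to \<open>- a i\<close>. Then \<open>a i\<close> is invertible, hence
  zero.\<close>

lemma zdeg_nonneg_eq_0D:
  assumes fin: "finite J" and inv: "no_invertibles (nspan (a ` J))" and nz: "\<And>j. j \<in> J \<Longrightarrow> a j \<noteq> 0"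
    and f: "\<And>i. i \<in> J \<Longrightarrow> 0 \<le> f i" "zdeg J a f = 0" and i: "i \<in> J"
  shows "f i = 0"
proof (rule ccontr)
  assume "f i \<noteq> 0"
  then have pos: "f i > 0" using f(1)[OF i] by simp
  let ?e = "\<lambda>j. if j = i then 1 else (0::int)"
  have ai: "zdeg J a ?e = a i" using zdeg_unit[OF fin i, of a 1] by simp
  then have "a i \<in> nspan (a ` J)" unfolding nspan_image_iff[OF fin] by (intro exI[of _ ?e]) auto
  moreover have "- a i \<in> nspan (a ` J)"
    unfolding nspan_image_iff[OF fin]
  proof (intro exI conjI allI)
    let ?g = "\<lambda>j. if j \<in> J then f j - ?e j else 0"
    show "0 \<le> ?g j" for j using f(1)[of j] pos by auto
    have "zdeg J a ?g = zdeg J a (\<lambda>j. f j - ?e j)" by (rule zdeg_cong) auto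
    then show "- a i = zdeg J a ?g" by (simp only: zdeg_diff ai f(2)) simp
  qed
  ultimately have "a i \<in> nspan (a ` J) \<inter> uminus ` nspan (a ` J)" by force
  then show False using inv nz[OF i] by (auto simp: no_invertibles_def)
qed

text \<open>A positive multiple of a nonnegative combination is a nonnegative combination, and it
  vanishes only if the coefficients at the nonzero generators do. The ambient group may have
  torsion; this is what gives the gluing element infinite order.\<close>

lemma nspan_torsion_free:
  assumes fin: "finite J" and inv: "no_invertibles (nspan (a ` J))"
    and x: "x \<in> nspan (a ` J)" "zscale c x = 0" "c \<noteq> 0"
  shows "x = 0"
proof -
  define J' where "J' = {j\<in>J. a j \<noteq> 0}"
  have J': "finite J'" "a ` J' \<subseteq> a ` J" using fin by (auto simp: J'_def)
  have inv': "no_invertibles (nspan (a ` J'))" by (rule no_invertibles_mono[OF inv J'(2)])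
  from x obtain f where f: "\<And>i. 0 \<le> f i" "x = zdeg J a f" by (auto simp: nspan_image_iff[OF fin])
  have x': "x = zdeg J' a f"
    unfolding f(2) zdeg_def J'_def by (rule sum.mono_neutral_right) (use fin in auto)
  have "zscale \<bar>c\<bar> x = 0" using x(2) by (cases "c \<ge> 0") auto
  then have "zdeg J' a (\<lambda>i. \<bar>c\<bar> * f i) = 0" unfolding x' zdeg_scale .
  then have "\<bar>c\<bar> * f i = 0" if "i \<in> J'" for i
    by (rule zdeg_nonneg_eq_0D[OF J'(1) inv' _ _ _ that, rotated 2]) (use f in \<open>auto simp: J'_def\<close>)
  then have "f i = 0" if "i \<in> J'" for i using x(3) that by auto
  then show ?thesis unfolding x' zdeg_def by simp
qed

text \<open>The rule \<open>glue\<close> wants the index set to be an initial segment; the induction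
  produces arbitrary finite sets, which are renumbered by \<open>h\<close>.\<close>

lemma completely_glued_glueI:
  fixes a :: "nat \<Rightarrow> 'g::ab_group_add"
  assumes fin: "finite E1" "finite E2" and E: "E1 \<noteq> {}" "E2 \<noteq> {}" "E1 \<inter> E2 = {}"
    and inv: "no_invertibles (nspan (a ` (E1 \<union> E2)))"
    and b: "b \<in> nspan (a ` E1)" "b \<in> nspan (a ` E2)" "b \<noteq> 0"
      "zspan {b} = zspan (a ` E1) \<inter> zspan (a ` E2)"
    and cg: "completely_glued (nspan (a ` E1))" "completely_glued (nspan (a ` E2))"
  shows "completely_glued (nspan (a ` (E1 \<union> E2)))"
proof -
  define m where "m = card (E1 \<union> E2)"
  obtain h where h: "bij_betw h {..<m} (E1 \<union> E2)"
    using ex_bij_betw_nat_finite[of "E1 \<union> E2"] fin by (auto simp: m_def lessThan_atLeast0)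
  define F where "F E = {i \<in> {..<m}. h i \<in> E}" for E
  have im: "(a \<circ> h) ` F E = a ` E" if "E \<subseteq> E1 \<union> E2" for E
  proof -
    have "h ` F E = E" using h that unfolding bij_betw_def F_def by force
    then show ?thesis by (metis image_comp)
  qed
  have whole: "(a \<circ> h) ` {..<m} = a ` (E1 \<union> E2)"
    using h by (metis bij_betw_def image_comp)
  have gl: "gluing m (a \<circ> h) (F E1) (F E2)"
    unfolding gluing_def
  proof (intro conjI)
    show "F E1 \<noteq> {}" "F E2 \<noteq> {}" using im[of E1] im[of E2] E by fastforce+
    show "F E1 \<inter> F E2 = {}" using E(3) by (auto simp: F_def)
    show "F E1 \<union> F E2 = {..<m}" using h by (auto simp: F_def bij_betw_def)
    show "\<exists>b\<in>nspan ((a \<circ> h) ` F E1) \<inter> nspan ((a \<circ> h) ` F E2). b \<noteq> 0 \<and>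
        zspan {b} = zspan ((a \<circ> h) ` F E1) \<inter> zspan ((a \<circ> h) ` F E2)"
      using b by (intro bexI[of _ b]) (simp_all add: im del: image_comp o_apply)
  qed
  show ?thesis
    using completely_glued.glue[OF _ gl] inv cg by (simp only: whole im Un_upper1 Un_upper2)
qed

text \<open>The positive and the negative entries of the split row express one element
  \<open>b\<close> in the two parts. A relation of one part is a combination of all rows; comparing
  degrees over \<open>E1\<close> shows that the split row enters with coefficient 0, since
  \<open>b\<close> has infinite order. Hence the rows inside a part generate its relations and the
  induction proceeds.\<close>

theorem mixed_dominating_completely_glued:
  fixes a :: "nat \<Rightarrow> 'g::ab_group_add" and \<alpha> :: "nat \<Rightarrow> nat \<Rightarrow> int"
  assumes "no_invertibles (nspan (a ` J))" "\<And>j. j \<in> J \<Longrightarrow> a j \<noteq> 0"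
    and "\<And>k. k \<in> K \<Longrightarrow> zdeg J a (\<alpha> k) = 0"
    and "\<And>f. zdeg J a f = 0 \<Longrightarrow> \<exists>c. \<forall>i\<in>J. f i = (\<Sum>k\<in>K. c k * \<alpha> k i)"
    and "mixed_dominating J K (\<lambda>k. {i. \<alpha> k i > 0}) (\<lambda>k. {i. \<alpha> k i < 0})"
  shows "completely_glued (nspan (a ` J))"
  using assms
proof (induction "card K" arbitrary: J K rule: less_induct)
  case less
  note inv = less.prems(1) and nz = less.prems(2) and ker = less.prems(3)
    and gen = less.prems(4) and dom = less.prems(5)
  have fin: "finite J" "finite K" using dom by (auto simp: mixed_dominating_def)
  show ?case
  proof (cases "K = {}")
    \<comment> \<open>Without rows only the trivial relation is left, so the generators are pairwise
      distinct and independent.\<close>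
    case True
    then have z: "f i = 0" if "zdeg J a f = 0" "i \<in> J" for f i using gen[OF that(1)] that by auto
    have inj: "inj_on a J"
    proof (rule inj_onI, rule ccontr)
      fix i j assume ij: "i \<in> J" "j \<in> J" "a i = a j" "i \<noteq> j"
      have "zdeg J a (\<lambda>l. (if l = i then 1 else 0) - (if l = j then 1 else 0)) = 0"
        using ij fin by (simp only: zdeg_diff zdeg_unit) simp
      from z[OF this ij(1)] ij show False by simp
    qed
    have "zindependent (a ` J)"
    proof
      assume "module.dependent zscale (a ` J)"
      then obtain u v where u: "v \<in> a ` J" "u v \<noteq> 0" "(\<Sum>v\<in>a ` J. zscale (u v) v) = 0"
        using zmod.dependent_finite[of "a ` J"] fin by auto
      then have "zdeg J a (\<lambda>j. u (a j)) = 0" by (simp add: zdeg_def sum.reindex[OF inj])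
      from z[OF this] u show False by auto
    qed
    then show ?thesis using completely_glued.independent[of "a ` J"] fin by simp
  next
    case False
    define P where "P k = {i. \<alpha> k i > 0}" for k
    define N where "N k = {i. \<alpha> k i < 0}" for k
    have dom: "mixed_dominating J K P N" using dom unfolding P_def N_def .
    obtain k E where k: "k \<in> K" and E: "splits K P N k E"
      using mixed_dominating_splits[OF dom False] by blast
    have supp: "P l \<noteq> {}" "N l \<noteq> {}" "P l \<union> N l \<subseteq> J" if "l \<in> K" for l
      using dom that by (auto simp: mixed_dominating_def)
    \<comment> \<open>The sign is chosen so that \<open>\<beta>\<close> is nonnegative on
      \<open>E1\<close> and nonpositive on \<open>E2\<close>.\<close>
    define s :: int where "s = (if P k \<subseteq> E \<and> N k \<inter> E = {} then 1 else - 1)"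
    define \<beta> where "\<beta> i = s * \<alpha> k i" for i
    have s: "s \<noteq> 0" by (simp add: s_def)
    define E1 where "E1 = J \<inter> E"
    define E2 where "E2 = J - E"
    have EJ: "E1 \<union> E2 = J" "E1 \<inter> E2 = {}" "finite E1" "finite E2" using fin by (auto simp: E1_def E2_def)
    have kE: "P k \<subseteq> E \<and> N k \<inter> E = {} \<or> N k \<subseteq> E \<and> P k \<inter> E = {}" using E by (auto simp: splits_def)
    have \<beta>1: "\<beta> i \<ge> 0" if "i \<in> E1" for i
      using that kE unfolding \<beta>_def s_def E1_def P_def N_def by (auto simp: not_less intro: leI)
    have \<beta>2: "\<beta> i \<le> 0" if "i \<in> E2" for i
      using that kE unfolding \<beta>_def s_def E2_def P_def N_def by (auto simp: not_less intro: leI)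
    define K1 where "K1 = {l \<in> K - {k}. P l \<union> N l \<subseteq> E}"
    define K2 where "K2 = {l \<in> K - {k}. (P l \<union> N l) \<inter> E = {}}"
    have K: "K = insert k (K1 \<union> K2)" "k \<notin> K1 \<union> K2"
      using E k by (auto simp: splits_def K1_def K2_def)
    have K12: "K1 \<inter> K2 = {}"
    proof -
      have False if "l \<in> K1" "l \<in> K2" for l
        using that supp(1)[of l] by (auto simp: K1_def K2_def)
      then show ?thesis by blast
    qed
    have finK: "finite K1" "finite K2" using fin by (auto simp: K1_def K2_def)
    have z1: "\<alpha> l i = 0" if "l \<in> K1" "i \<notin> E1" for l i
    proof (rule ccontr)
      assume "\<alpha> l i \<noteq> 0"
      then have "i \<in> P l \<union> N l" by (auto simp: P_def N_def)
      moreover have "P l \<union> N l \<subseteq> E1" using that(1) supp(3)[of l] by (auto simp: K1_def E1_def)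
      ultimately show False using that(2) by blast
    qed
    have z2: "\<alpha> l i = 0" if "l \<in> K2" "i \<notin> E2" for l i
    proof (rule ccontr)
      assume "\<alpha> l i \<noteq> 0"
      then have "i \<in> P l \<union> N l" by (auto simp: P_def N_def)
      moreover have "P l \<union> N l \<subseteq> E2" using that(1) supp(3)[of l] by (auto simp: K2_def E2_def)
      ultimately show False using that(2) by blast
    qed
    have zdJ: "zdeg J a f = zdeg E1 a f + zdeg E2 a f" for f
      using zdeg_union[of E1 E2 a f] EJ by simp
    have d1: "zdeg E1 a (\<alpha> l) = 0 \<and> zdeg E2 a (\<alpha> l) = 0" if "l \<in> K1" for l
    proof -
      have "zdeg E2 a (\<alpha> l) = zdeg E2 a (\<lambda>_. 0)" by (rule zdeg_cong) (use z1[OF that] EJ in auto)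
      moreover have "l \<in> K" using that by (simp add: K1_def)
      ultimately show ?thesis using ker[of l] zdJ[of "\<alpha> l"] by simp
    qed
    have d2: "zdeg E1 a (\<alpha> l) = 0 \<and> zdeg E2 a (\<alpha> l) = 0" if "l \<in> K2" for l
    proof -
      have "zdeg E1 a (\<alpha> l) = zdeg E1 a (\<lambda>_. 0)" by (rule zdeg_cong) (use z2[OF that] EJ in auto)
      moreover have "l \<in> K" using that by (simp add: K2_def)
      ultimately show ?thesis using ker[of l] zdJ[of "\<alpha> l"] by simp
    qed
    define b where "b = zdeg E1 a \<beta>"
    have bk: "zdeg E1 a (\<alpha> k) = zscale s b"
    proof -
      have "\<alpha> k = (\<lambda>i. s * \<beta> i)" unfolding \<beta>_def s_def by auto
      then show ?thesis unfolding b_def using zdeg_scale[of E1 a s \<beta>] by simp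
    qed
    have b2: "b = zdeg E2 a (\<lambda>i. - \<beta> i)"
    proof -
      have "zdeg J a \<beta> = zscale s (zdeg J a (\<alpha> k))" unfolding \<beta>_def zdeg_scale ..
      then have "zdeg E1 a \<beta> + zdeg E2 a \<beta> = 0" using zdJ[of \<beta>] ker[OF k] by simp
      then show ?thesis unfolding b_def zdeg_uminus by (simp add: eq_neg_iff_add_eq_0)
    qed
    have bn1: "b \<in> nspan (a ` E1)"
      unfolding nspan_image_iff[OF EJ(3)]
      by (intro exI[of _ "\<lambda>i. if i \<in> E1 then \<beta> i else 0"]) (auto simp: b_def \<beta>1 intro: zdeg_cong)
    have bn2: "b \<in> nspan (a ` E2)"
      unfolding nspan_image_iff[OF EJ(4)]
      by (intro exI[of _ "\<lambda>i. if i \<in> E2 then - \<beta> i else 0"]) (auto simp: b2 \<beta>2 intro: zdeg_cong)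
    have ne: "\<exists>i\<in>E1. \<beta> i \<noteq> 0" "E2 \<noteq> {}"
    proof -
      obtain p n where pn: "p \<in> P k" "n \<in> N k" "p \<in> J" "n \<in> J" using supp[OF k] by blast
      then have "\<beta> p \<noteq> 0" "\<beta> n \<noteq> 0" using s by (auto simp: \<beta>_def P_def N_def)
      moreover have "p \<in> E1 \<and> n \<in> E2 \<or> n \<in> E1 \<and> p \<in> E2"
        using kE pn unfolding E1_def E2_def by blast
      ultimately show "\<exists>i\<in>E1. \<beta> i \<noteq> 0" "E2 \<noteq> {}" by blast+
    qed
    have inv1: "no_invertibles (nspan (a ` E1))" and inv2: "no_invertibles (nspan (a ` E2))"
      using no_invertibles_mono[OF inv] EJ by blast+
    have b0: "b \<noteq> 0"
    proof
      assume "b = 0"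
      then have "\<beta> i = 0" if "i \<in> E1" for i
        using zdeg_nonneg_eq_0D[OF EJ(3) inv1 _ \<beta>1 _ that] nz EJ by (auto simp: b_def)
      then show False using ne by blast
    qed
    have comb: "\<exists>c. (\<forall>i\<in>E1. f i = (\<Sum>l\<in>K1. c l * \<alpha> l i) + c k * \<alpha> k i) \<and>
        (\<forall>i\<in>E2. f i = (\<Sum>l\<in>K2. c l * \<alpha> l i) + c k * \<alpha> k i)" if hf: "zdeg J a f = 0" for f
    proof -
      obtain c where c: "\<forall>i\<in>J. f i = (\<Sum>l\<in>K. c l * \<alpha> l i)" using gen[OF hf] by blast
      have split: "(\<Sum>l\<in>K. c l * \<alpha> l i) = (\<Sum>l\<in>K1. c l * \<alpha> l i) + (\<Sum>l\<in>K2. c l * \<alpha> l i) + c k * \<alpha> k i" for i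
        unfolding K(1) using K(2) K12 finK by (simp add: sum.union_disjoint)
      have "(\<Sum>l\<in>K2. c l * \<alpha> l i) = 0" if "i \<in> E1" for i
        using z2 that EJ by (intro sum.neutral) auto
      moreover have "(\<Sum>l\<in>K1. c l * \<alpha> l i) = 0" if "i \<in> E2" for i
        using z1 that EJ by (intro sum.neutral) auto
      ultimately show ?thesis using c split EJ(1) by (intro exI[of _ c]) (auto 0 3)
    qed
    have deg1: "zdeg E1 a f = zscale (c k * s) b"
      if "\<forall>i\<in>E1. f i = (\<Sum>l\<in>K1. c l * \<alpha> l i) + c k * \<alpha> k i" for f c
    proof -
      have "zdeg E1 a f = zdeg E1 a (\<lambda>i. (\<Sum>l\<in>K1. c l * \<alpha> l i) + c k * \<alpha> k i)"
        by (rule zdeg_cong) (use that in auto)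
      also have "\<dots> = zscale (c k) (zscale s b)"
        unfolding zdeg_add zdeg_combination zdeg_scale bk by (simp add: d1)
      finally show ?thesis by simp
    qed
    \<comment> \<open>A common element of both subgroups gives a relation \<open>h\<close>, with the
      coefficients of one expression on \<open>E1\<close> and the negated ones of the other on
      \<open>E2\<close>. Of all rows only \<open>k\<close> can have nonzero degree over
      \<open>E1\<close>, so the element is a multiple of \<open>b\<close>.\<close>
    have sp: "zspan {b} = zspan (a ` E1) \<inter> zspan (a ` E2)"
    proof (intro equalityI subsetI)
      fix x assume "x \<in> zspan {b}"
      then obtain t where x: "x = zscale t b" by (auto simp: zmod.span_singleton)
      have "x = zdeg E1 a (\<lambda>i. t * \<beta> i)" unfolding zdeg_scale x b_def ..
      moreover have "x = zdeg E2 a (\<lambda>i. t * - \<beta> i)" unfolding x b2 by (rule zdeg_scale[symmetric])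
      ultimately show "x \<in> zspan (a ` E1) \<inter> zspan (a ` E2)"
        unfolding Int_iff zspan_image_iff[OF EJ(3)] zspan_image_iff[OF EJ(4)] by blast
    next
      fix x assume "x \<in> zspan (a ` E1) \<inter> zspan (a ` E2)"
      then obtain f g where f: "x = zdeg E1 a f" and g: "x = zdeg E2 a g"
        unfolding Int_iff zspan_image_iff[OF EJ(3)] zspan_image_iff[OF EJ(4)] by blast
      define h where "h i = (if i \<in> E1 then f i else - g i)" for i
      have "zdeg E1 a h = x" unfolding f by (rule zdeg_cong) (simp add: h_def)
      moreover have "zdeg E2 a h = zdeg E2 a (\<lambda>i. - g i)" by (rule zdeg_cong) (use EJ in \<open>auto simp: h_def\<close>)
      ultimately have "zdeg J a h = 0" unfolding zdJ zdeg_uminus using g by simp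
      from comb[OF this] obtain c where "\<forall>i\<in>E1. h i = (\<Sum>l\<in>K1. c l * \<alpha> l i) + c k * \<alpha> k i" by blast
      from deg1[OF this] \<open>zdeg E1 a h = x\<close> have "x = zscale (c k * s) b" by simp
      then show "x \<in> zspan {b}" by (auto simp: zmod.span_singleton)
    qed
    \<comment> \<open>Both parts are treated at once. For \<open>F = E1\<close> as well as for
      \<open>F\<close> disjoint from \<open>E1\<close>, a relation of \<open>F\<close> extended by 0
      has degree 0 over \<open>E1\<close>; this forces \<open>c k = 0\<close>.\<close>
    have part: "completely_glued (nspan (a ` F))"
      if L: "L \<subset> K" and F: "F \<subseteq> J" "F = E1 \<or> F \<inter> E1 = {}"
        and zL: "\<And>l. l \<in> L \<Longrightarrow> zdeg F a (\<alpha> l) = 0 \<and> P l \<union> N l \<subseteq> F"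
        and combL: "\<And>f. zdeg J a f = 0 \<Longrightarrow> \<exists>c. zdeg E1 a f = zscale (c k * s) b \<and>
          (\<forall>i\<in>F. f i = (\<Sum>l\<in>L. c l * \<alpha> l i) + c k * \<alpha> k i)" for L F
    proof (rule less.hyps[OF psubset_card_mono[OF fin(2) L]])
      show "no_invertibles (nspan (a ` F))" using no_invertibles_mono[OF inv] F(1) by blast
      show "a j \<noteq> 0" if "j \<in> F" for j using nz that F(1) by auto
      show "zdeg F a (\<alpha> l) = 0" if "l \<in> L" for l using zL[OF that] by simp
      show "\<exists>c. \<forall>i\<in>F. f i = (\<Sum>l\<in>L. c l * \<alpha> l i)" if f: "zdeg F a f = 0" for f
      proof -
        define h where "h i = (if i \<in> F then f i else 0)" for i
        have hF: "zdeg F a h = 0" unfolding f[symmetric] by (rule zdeg_cong) (simp add: h_def)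
        have "zdeg J a h = zdeg F a h" by (rule zdeg_restrict) (use fin F(1) in \<open>auto simp: h_def\<close>)
        then obtain c where c: "zdeg E1 a h = zscale (c k * s) b"
          "\<forall>i\<in>F. h i = (\<Sum>l\<in>L. c l * \<alpha> l i) + c k * \<alpha> k i" using combL[of h] hF by auto
        have "zdeg E1 a h = 0"
        proof (cases "F = E1")
          case False
          then have "zdeg E1 a h = zdeg E1 a (\<lambda>_. 0)"
            using F(2) by (intro zdeg_cong) (auto simp: h_def)
          then show ?thesis by simp
        qed (use hF in simp)
        then have "c k = 0" using c(1) nspan_torsion_free[OF EJ(3) inv1 bn1] b0 s by fastforce
        then show ?thesis using c(2) by (intro exI[of _ c]) (simp add: h_def)
      qed
      show "mixed_dominating F L (\<lambda>k. {i. \<alpha> k i > 0}) (\<lambda>k. {i. \<alpha> k i < 0})"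
      proof (rule mixed_dominating_mono[OF dom _ F(1)])
        show "L \<subseteq> K" using L by blast
        fix l assume l: "l \<in> L"
        then show "{i. \<alpha> l i > 0} \<subseteq> P l \<and> {i. \<alpha> l i < 0} \<subseteq> N l \<and> {i. \<alpha> l i > 0} \<noteq> {} \<and> {i. \<alpha> l i < 0} \<noteq> {} \<and>
            {i. \<alpha> l i > 0} \<union> {i. \<alpha> l i < 0} \<subseteq> F"
          using supp[of l] zL[OF l] L unfolding P_def N_def by auto
      qed
    qed
    have comb': "\<exists>c. zdeg E1 a f = zscale (c k * s) b \<and> (\<forall>i\<in>E1. f i = (\<Sum>l\<in>K1. c l * \<alpha> l i) + c k * \<alpha> k i) \<and>
        (\<forall>i\<in>E2. f i = (\<Sum>l\<in>K2. c l * \<alpha> l i) + c k * \<alpha> k i)" if f: "zdeg J a f = 0" for f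
    proof -
      from comb[OF f] obtain c where c: "\<forall>i\<in>E1. f i = (\<Sum>l\<in>K1. c l * \<alpha> l i) + c k * \<alpha> k i"
        "\<forall>i\<in>E2. f i = (\<Sum>l\<in>K2. c l * \<alpha> l i) + c k * \<alpha> k i" by blast
      with deg1[OF c(1)] show ?thesis by blast
    qed
    have KK: "K1 \<subset> K" "K2 \<subset> K" using K by blast+
    have cg1: "completely_glued (nspan (a ` E1))"
    proof (rule part[OF KK(1)])
      show "zdeg E1 a (\<alpha> l) = 0 \<and> P l \<union> N l \<subseteq> E1" if "l \<in> K1" for l
        using d1[OF that] supp(3)[of l] that by (auto simp: K1_def E1_def)
      show "\<exists>c. zdeg E1 a f = zscale (c k * s) b \<and> (\<forall>i\<in>E1. f i = (\<Sum>l\<in>K1. c l * \<alpha> l i) + c k * \<alpha> k i)"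
        if "zdeg J a f = 0" for f using comb'[OF that] by blast
    qed (use EJ in auto)
    have cg2: "completely_glued (nspan (a ` E2))"
    proof (rule part[OF KK(2)])
      show "zdeg E2 a (\<alpha> l) = 0 \<and> P l \<union> N l \<subseteq> E2" if "l \<in> K2" for l
        using d2[OF that] supp(3)[of l] that by (auto simp: K2_def E2_def)
      show "\<exists>c. zdeg E1 a f = zscale (c k * s) b \<and> (\<forall>i\<in>E2. f i = (\<Sum>l\<in>K2. c l * \<alpha> l i) + c k * \<alpha> k i)"
        if "zdeg J a f = 0" for f using comb'[OF that] by blast
    qed (use EJ in auto)
    have "E1 \<noteq> {}" using ne by blast
    from completely_glued_glueI[OF EJ(3,4) this ne(2) EJ(2) _ bn1 bn2 b0 sp cg1 cg2]
    show ?thesis using inv EJ by simp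
  qed
qed

section \<open>Presentations with independent relations\<close>

definition xdeg :: "'i set \<Rightarrow> ('i \<Rightarrow> 'g::ab_group_add) \<Rightarrow> ('i \<Rightarrow>\<^sub>0 nat) \<Rightarrow> 'g"
  where "xdeg J a u = zdeg J a (\<lambda>i. int (lookup u i))"

lemma xdeg_0 [simp]: "xdeg J a 0 = 0"
  by (simp add: xdeg_def)

lemma xdeg_add: "xdeg J a (u + v) = xdeg J a u + xdeg J a v"
  by (simp add: xdeg_def lookup_add zdeg_add)

lemma xdeg_single: "finite J \<Longrightarrow> j \<in> J \<Longrightarrow> xdeg J a (single j n) = zscale (int n) (a j)"
  unfolding xdeg_def by (subst zdeg_unit[symmetric]) (auto intro: zdeg_cong simp: lookup_single when_def)

definition nsmult :: "nat \<Rightarrow> ('i \<Rightarrow>\<^sub>0 nat) \<Rightarrow> ('i \<Rightarrow>\<^sub>0 nat)"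
  where "nsmult n u = Poly_Mapping.map ((*) n) u"

lemma lookup_nsmult [simp]: "lookup (nsmult n u) i = n * lookup u i"
  by (simp add: nsmult_def Poly_Mapping.map.rep_eq when_def)

lemma nsmult_0 [simp]: "nsmult 0 u = 0"
  by (rule poly_mapping_eqI) simp

lemma nsmult_Suc: "nsmult (Suc n) u = u + nsmult n u"
  by (rule poly_mapping_eqI) (simp add: lookup_add)

lemma keys_nsmult: "keys (nsmult n u) \<subseteq> keys u"
  by (auto simp: in_keys_iff)

lemma xdeg_nsmult: "xdeg J a (nsmult n u) = zscale (int n) (xdeg J a u)"
  by (simp add: xdeg_def zdeg_scale)

definition except :: "'i set \<Rightarrow> ('i \<Rightarrow>\<^sub>0 'b::zero) \<Rightarrow> ('i \<Rightarrow>\<^sub>0 'b)"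
  where "except C u = Poly_Mapping.mapp (\<lambda>i x. if i \<in> C then 0 else x) u"

lemma lookup_except [simp]: "lookup (except C u) i = (if i \<in> C then 0 else lookup u i)"
  by (auto simp: except_def lookup_mapp in_keys_iff when_def)

lemma keys_except: "keys (except C u) = keys u - C"
  by (auto simp: in_keys_iff split: if_splits)

lemma add_eq_single_one_iff:
  fixes z x :: "'i \<Rightarrow>\<^sub>0 nat"
  shows "z + x = single c 1 \<longleftrightarrow>
    z = 0 \<and> x = single c 1 \<or> z = single c 1 \<and> x = 0"
proof
  assume eq: "z + x = single c 1"
  have l: "lookup z i + lookup x i = (if i = c then 1 else 0)" for i
    using arg_cong[OF eq, of "\<lambda>u. lookup u i"] by (simp add: lookup_add lookup_single when_def)
  show "z = 0 \<and> x = single c 1 \<or> z = single c 1 \<and> x = 0"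
  proof (cases "lookup z c = 0")
    case True
    then have "lookup z i = 0" for i using l[of i] by (cases "i = c") auto
    then have "z = 0" by (intro poly_mapping_eqI) simp
    then show ?thesis using eq by simp
  next
    case False
    then have "lookup x i = 0" for i using l[of i] l[of c] by (cases "i = c") auto
    then have "x = 0" by (intro poly_mapping_eqI) simp
    then show ?thesis using eq by simp
  qed
qed auto

text \<open>The congruence generated by the pairs \<open>p k\<close>, \<open>q k\<close>.
  Compatibility with addition is built into the elementary steps by \<open>z\<close>, so a
  derivation is a path of such steps. \<open>z\<close> ranges over all exponent vectors, but
  relations leave the coordinates outside their supports unchanged.\<close>

inductive pcong :: "'k set \<Rightarrow> ('k \<Rightarrow> 'i \<Rightarrow>\<^sub>0 nat) \<Rightarrow> ('k \<Rightarrow> 'i \<Rightarrow>\<^sub>0 nat) \<Rightarrow> ('i \<Rightarrow>\<^sub>0 nat) \<Rightarrow> ('i \<Rightarrow>\<^sub>0 nat) \<Rightarrow> bool"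
  for K p q where
  base: "k \<in> K \<Longrightarrow> pcong K p q (z + p k) (z + q k)"
| refl: "pcong K p q u u"
| sym: "pcong K p q u v \<Longrightarrow> pcong K p q v u"
| trans: "pcong K p q u v \<Longrightarrow> pcong K p q v w \<Longrightarrow> pcong K p q u w"

lemma pcong_add: "pcong K p q u v \<Longrightarrow> pcong K p q (w + u) (w + v)"
proof (induction rule: pcong.induct)
  case (base k z)
  then show ?case using pcong.base[of k K p q "w + z"] by (simp add: add.assoc)
qed (blast intro: pcong.intros)+

lemma pcong_add2: "pcong K p q u v \<Longrightarrow> pcong K p q (u + w) (v + w)"
  using pcong_add[of K p q u v w] by (simp add: add.commute)

lemma pcong_nsmult: "pcong K p q u v \<Longrightarrow> pcong K p q (nsmult n u) (nsmult n v)"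
proof (induction n)
  case (Suc n)
  have "pcong K p q (u + nsmult n u) (v + nsmult n u)" by (rule pcong_add2[OF Suc.prems])
  moreover have "pcong K p q (v + nsmult n u) (v + nsmult n v)" by (rule pcong_add[OF Suc.IH[OF Suc.prems]])
  ultimately show ?case unfolding nsmult_Suc by (rule pcong.trans)
qed (simp add: pcong.refl)

lemma pcong_rel: "k \<in> K \<Longrightarrow> pcong K p q (p k) (q k)"
  using pcong.base[of k K p q 0] by simp

lemma pcong_mono:
  assumes "pcong K p q u v" "\<And>k. k \<in> K \<Longrightarrow> pcong K' p' q' (p k) (q k)"
  shows "pcong K' p' q' u v"
  using assms(1)
proof (induction rule: pcong.induct)
  case (base k z)
  then show ?case using assms(2) pcong_add by blast
qed (blast intro: pcong.intros)+

lemma pcong_xdeg: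
  assumes "pcong K p q u v" "\<And>k. k \<in> K \<Longrightarrow> xdeg J a (p k) = xdeg J a (q k)"
  shows "xdeg J a u = xdeg J a v"
  using assms(1) by (induction rule: pcong.induct) (simp_all add: xdeg_add assms(2))

text \<open>The pairs generate the kernel congruence of the degree map from the free commutative
  monoid on \<open>J\<close> to the semigroup.\<close>

definition presents :: "'i set \<Rightarrow> ('i \<Rightarrow> 'g::ab_group_add) \<Rightarrow> 'k set \<Rightarrow> ('k \<Rightarrow> 'i \<Rightarrow>\<^sub>0 nat) \<Rightarrow> ('k \<Rightarrow> 'i \<Rightarrow>\<^sub>0 nat) \<Rightarrow> bool"
  where "presents J a K p q \<longleftrightarrow> finite K \<and>
    (\<forall>k\<in>K. keys (p k) \<subseteq> J \<and> keys (q k) \<subseteq> J \<and> xdeg J a (p k) = xdeg J a (q k)) \<and>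
    (\<forall>u v. keys u \<subseteq> J \<and> keys v \<subseteq> J \<and> xdeg J a u = xdeg J a v \<longrightarrow> pcong K p q u v)"

lemma presentsD:
  assumes "presents J a K p q"
  shows "finite K" "k \<in> K \<Longrightarrow> keys (p k) \<subseteq> J" "k \<in> K \<Longrightarrow> keys (q k) \<subseteq> J"
    "k \<in> K \<Longrightarrow> xdeg J a (p k) = xdeg J a (q k)"
    "keys u \<subseteq> J \<Longrightarrow> keys v \<subseteq> J \<Longrightarrow> xdeg J a u = xdeg J a v \<Longrightarrow> pcong K p q u v"
  using assms by (auto simp: presents_def)

definition independent_relations :: "'k set \<Rightarrow> ('k \<Rightarrow> 'i \<Rightarrow>\<^sub>0 nat) \<Rightarrow> ('k \<Rightarrow> 'i \<Rightarrow>\<^sub>0 nat) \<Rightarrow> bool"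
  where "independent_relations K p q \<longleftrightarrow> (\<forall>c::'k \<Rightarrow> int.
    (\<forall>i. (\<Sum>k\<in>K. c k * (int (lookup (p k) i) - int (lookup (q k) i))) = 0)
    \<longrightarrow> (\<forall>k\<in>K. c k = 0))"

definition ci_presentation :: "'i set \<Rightarrow> ('i \<Rightarrow> 'g::ab_group_add) \<Rightarrow> bool"
  where "ci_presentation J a \<longleftrightarrow> (\<exists>(K::nat set) p q. presents J a K p q \<and> independent_relations K p q)"

text \<open>\<open>ci_presentation\<close> fixes natural numbers as indices, whereas the
  constructions below index relations by options and sums; a finite index set can be
  renumbered.\<close>

lemma ci_presentationI:
  assumes "presents J a K p q" "independent_relations K p q"
  shows "ci_presentation J a"
proof -
  have fin: "finite K" using assms by (simp add: presents_def)
  obtain h where h: "bij_betw h {..<card K} K"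
    using ex_bij_betw_nat_finite[OF fin] by (auto simp: lessThan_atLeast0)
  have hK: "h i \<in> K" if "i < card K" for i using h that by (auto simp: bij_betw_def)
  have pc: "pcong {..<card K} (p \<circ> h) (q \<circ> h) u v" if "pcong K p q u v" for u v
  proof (rule pcong_mono[OF that])
    fix k assume "k \<in> K"
    then obtain i where "i \<in> {..<card K}" "h i = k" using h unfolding bij_betw_def by (metis imageE)
    then show "pcong {..<card K} (p \<circ> h) (q \<circ> h) (p k) (q k)"
      using pcong_rel[of i "{..<card K}" "p \<circ> h" "q \<circ> h"] by simp
  qed
  have "presents J a {..<card K} (p \<circ> h) (q \<circ> h)"
    using assms(1) pc hK unfolding presents_def by auto
  moreover have "independent_relations {..<card K} (p \<circ> h) (q \<circ> h)"
    unfolding independent_relations_def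
  proof (intro allI impI ballI)
    fix c :: "nat \<Rightarrow> int" and j
    assume c: "\<forall>i. (\<Sum>k<card K. c k * (int (lookup ((p \<circ> h) k) i) - int (lookup ((q \<circ> h) k) i))) = 0"
      and j: "j \<in> {..<card K}"
    define g where "g = the_inv_into {..<card K} h"
    have gh: "g (h k) = k" if "k \<in> {..<card K}" for k
      unfolding g_def using h that by (auto simp: bij_betw_def the_inv_into_f_f)
    have "(\<Sum>k\<in>K. c (g k) * (int (lookup (p k) i) - int (lookup (q k) i))) = 0" for i
      unfolding sum.reindex_bij_betw[OF h, symmetric] using c gh by simp
    then have "\<forall>k\<in>K. c (g k) = 0"
      using assms(2) unfolding independent_relations_def by (elim allE[of _ "\<lambda>k. c (g k)"]) blast
    then show "c j = 0" using gh[OF j] hK j by force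
  qed
  ultimately show ?thesis unfolding ci_presentation_def by blast
qed

section \<open>Independence of the choice of generators, and gluings\<close>

lemma ci_presentation_cong:
  assumes "\<And>j. j \<in> J \<Longrightarrow> a j = a' j"
  shows "ci_presentation J a \<longleftrightarrow> ci_presentation J a'"
proof -
  have "xdeg J a = xdeg J a'" unfolding xdeg_def using zdeg_family_cong[of J a a'] assms by auto
  then show ?thesis by (simp add: ci_presentation_def presents_def)
qed

lemma nspan_image_xdeg:
  assumes "finite E"
  shows "x \<in> nspan (a ` E) \<longleftrightarrow> (\<exists>u. keys u \<subseteq> E \<and> x = xdeg E a u)"
proof
  assume "x \<in> nspan (a ` E)"
  then obtain f where f: "\<And>i. 0 \<le> f i" "x = zdeg E a f" by (auto simp: nspan_image_iff[OF assms])
  define u where "u = Abs_poly_mapping (\<lambda>i. if i \<in> E then nat (f i) else 0)"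
  have "finite {i. (if i \<in> E then nat (f i) else 0) \<noteq> 0}"
    by (rule finite_subset[OF _ assms]) auto
  then have u: "lookup u i = (if i \<in> E then nat (f i) else 0)" for i
    by (simp add: u_def)
  have "keys u \<subseteq> E" by (auto simp: in_keys_iff u split: if_splits)
  moreover have "x = xdeg E a u" unfolding xdeg_def f(2) by (rule zdeg_cong) (simp add: u f(1))
  ultimately show "\<exists>u. keys u \<subseteq> E \<and> x = xdeg E a u" by blast
next
  assume "\<exists>u. keys u \<subseteq> E \<and> x = xdeg E a u"
  then show "x \<in> nspan (a ` E)"
    unfolding nspan_image_iff[OF assms] xdeg_def by (metis of_nat_0_le_iff)
qed

lemma xdeg_eq_0D:
  assumes "finite J" "no_invertibles (nspan (a ` J))" "\<And>j. j \<in> J \<Longrightarrow> a j \<noteq> 0"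
    "keys u \<subseteq> J" "xdeg J a u = 0"
  shows "u = 0"
proof (rule poly_mapping_eqI)
  fix i
  show "lookup u i = lookup 0 i"
  proof (cases "i \<in> J")
    case True
    then show ?thesis using zdeg_nonneg_eq_0D[OF assms(1-3) _ _ True, of "\<lambda>i. int (lookup u i)"] assms(5)
      by (simp add: xdeg_def)
  next
    case False
    then show ?thesis using assms(4) by (auto simp: in_keys_iff)
  qed
qed

lemma xdeg_restrict:
  assumes "finite F" "E \<subseteq> F" "keys u \<subseteq> E"
  shows "xdeg F a u = xdeg E a u"
  unfolding xdeg_def by (rule zdeg_restrict[OF assms(1,2)]) (use assms(3) in \<open>auto simp: in_keys_iff\<close>)

text \<open>The redundant generator is defined by one new relation, which equates the variable
  \<open>c\<close> with \<open>w\<close>. Replacing \<open>c\<close> by \<open>w\<close> everywhere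
  (\<open>\<sigma>\<close>) reduces any relation to an old one. The new relation is independent of
  the others, being the only one in which \<open>c\<close> occurs.\<close>

lemma ci_presentation_insert:
  assumes fin: "finite J" and c: "c \<notin> J" and ac: "a c \<in> nspan (a ` J)" and ci: "ci_presentation J a"
  shows "ci_presentation (insert c J) a"
proof -
  let ?J = "insert c J"
  obtain w where w: "keys w \<subseteq> J" "a c = xdeg J a w"
    using ac by (auto simp: nspan_image_xdeg[OF fin])
  obtain K :: "nat set" and p q where pr: "presents J a K p q" and ind: "independent_relations K p q"
    using ci by (auto simp: ci_presentation_def)
  have finK: "finite K" using pr by (simp add: presents_def)
  define K' where "K' = insert None (Some ` K)"
  define p' where "p' = case_option (single c 1) p"
  define q' where "q' = case_option w q"
  have dJ: "xdeg ?J a u = xdeg J a u" if "keys u \<subseteq> J" for u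
    by (rule xdeg_restrict) (use fin that in auto)
  have dc: "xdeg ?J a (single c 1) = xdeg ?J a w"
    using xdeg_single[of ?J c a 1] fin w dJ[of w] by simp
  have step: "pcong K' p' q' (p k) (q k)" if "k \<in> K" for k
    using pcong_rel[of "Some k" K' p' q'] that by (simp add: K'_def p'_def q'_def)
  have stepc: "pcong K' p' q' (single c 1) w"
    using pcong_rel[of None K' p' q'] by (simp add: K'_def p'_def q'_def)
  define \<sigma> where "\<sigma> u = except {c} u + nsmult (lookup u c) w" for u
  have \<sigma>: "pcong K' p' q' u (\<sigma> u)" for u
  proof -
    have "u = except {c} u + nsmult (lookup u c) (single c 1)"
      by (rule poly_mapping_eqI) (simp add: lookup_add lookup_single when_def)
    then show ?thesis unfolding \<sigma>_def using pcong_add[OF pcong_nsmult[OF stepc]] by metis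
  qed
  have relK: "xdeg ?J a (p' k) = xdeg ?J a (q' k)" if "k \<in> K'" for k
    using that pr dc dJ by (auto simp: K'_def p'_def q'_def presents_def)
  have "presents ?J a K' p' q'"
    unfolding presents_def
  proof (intro conjI ballI allI impI)
    show "finite K'" using finK by (simp add: K'_def)
    fix k assume k: "k \<in> K'"
    then show "xdeg ?J a (p' k) = xdeg ?J a (q' k)" by (rule relK)
    from k consider "k = None" | j where "k = Some j" "j \<in> K" by (auto simp: K'_def)
    then have "keys (p' k) \<subseteq> ?J \<and> keys (q' k) \<subseteq> ?J"
    proof cases
      case 1
      then show ?thesis using w(1) by (auto simp: p'_def q'_def)
    next
      case 2
      then show ?thesis using presentsD(2,3)[OF pr 2(2)] by (auto simp: p'_def q'_def)
    qed
    then show "keys (p' k) \<subseteq> ?J" "keys (q' k) \<subseteq> ?J" by auto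
  next
    fix u v assume uv: "keys u \<subseteq> ?J \<and> keys v \<subseteq> ?J \<and> xdeg ?J a u = xdeg ?J a v"
    have k: "keys (\<sigma> x) \<subseteq> J" if "keys x \<subseteq> ?J" for x
    proof -
      have "keys (except {c} x) \<subseteq> J" using that by (auto simp: keys_except)
      moreover have "keys (nsmult (lookup x c) w) \<subseteq> J"
        using keys_nsmult w(1) by (rule order_trans)
      ultimately show ?thesis unfolding \<sigma>_def by (meson Un_least keys_add order_trans)
    qed
    have "xdeg J a (\<sigma> u) = xdeg ?J a u" "xdeg J a (\<sigma> v) = xdeg ?J a v"
      using pcong_xdeg[OF \<sigma>[of u] relK] pcong_xdeg[OF \<sigma>[of v] relK] dJ k uv by auto
    then have "pcong K p q (\<sigma> u) (\<sigma> v)" using pr k uv unfolding presents_def by auto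
    then have "pcong K' p' q' (\<sigma> u) (\<sigma> v)" by (rule pcong_mono) (rule step)
    then show "pcong K' p' q' u v" using \<sigma>[of u] \<sigma>[of v] by (meson pcong.sym pcong.trans)
  qed
  moreover have "independent_relations K' p' q'"
    unfolding independent_relations_def
  proof (rule allI, rule impI)
    fix d :: "nat option \<Rightarrow> int"
    assume d: "\<forall>i. (\<Sum>k\<in>K'. d k * (int (lookup (p' k) i) - int (lookup (q' k) i))) = 0"
    have sum: "(\<Sum>k\<in>K'. d k * (int (lookup (p' k) i) - int (lookup (q' k) i)))
        = d None * (int (lookup (single c 1) i) - int (lookup w i)) +
          (\<Sum>k\<in>K. d (Some k) * (int (lookup (p k) i) - int (lookup (q k) i)))" for i
      using finK by (simp add: K'_def p'_def q'_def sum.reindex)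
    have z: "lookup w c = 0" "k \<in> K \<Longrightarrow> lookup (p k) c = 0 \<and> lookup (q k) c = 0" for k
      using w(1) c presentsD(2,3)[OF pr, of k] by (metis in_keys_iff subsetD)+
    have "d None = 0" using d[rule_format, of c] unfolding sum by (simp add: z)
    then have "\<forall>i. (\<Sum>k\<in>K. d (Some k) * (int (lookup (p k) i) - int (lookup (q k) i))) = 0"
      using d unfolding sum by simp
    then have "\<forall>k\<in>K. d (Some k) = 0"
      using ind unfolding independent_relations_def by (elim allE[of _ "\<lambda>k. d (Some k)"]) blast
    with \<open>d None = 0\<close> show "\<forall>k\<in>K'. d k = 0" by (auto simp: K'_def)
  qed
  ultimately show ?thesis by (rule ci_presentationI)
qed

text \<open>Since the variable \<open>c\<close> is congruent to \<open>w\<close>, some relation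
  \<open>k0\<close> has the bare variable on exactly one side. Its other side \<open>v\<close> does
  not involve \<open>c\<close>, so \<open>k0\<close> can serve as the definition of \<open>c\<close>
  and be eliminated by substitution into the remaining relations.\<close>

lemma ci_presentation_remove:
  assumes fin: "finite J" and c: "c \<notin> J" and ac: "a c \<in> nspan (a ` J)"
    and inv: "no_invertibles (nspan (a ` insert c J))" and nz: "\<And>j. j \<in> insert c J \<Longrightarrow> a j \<noteq> 0"
    and ci: "ci_presentation (insert c J) a"
  shows "ci_presentation J a"
proof -
  let ?J = "insert c J"
  let ?e = "single c (1::nat)"
  have finJ: "finite ?J" using fin by simp
  obtain w where w: "keys w \<subseteq> J" "a c = xdeg J a w"
    using ac by (auto simp: nspan_image_xdeg[OF fin])
  obtain K :: "nat set" and p q where pr: "presents ?J a K p q" and ind: "independent_relations K p q"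
    using ci by (auto simp: ci_presentation_def)
  have finK: "finite K" using pr by (simp add: presents_def)
  have pq: "keys (p k) \<subseteq> ?J" "keys (q k) \<subseteq> ?J" "xdeg ?J a (p k) = xdeg ?J a (q k)"
    if "k \<in> K" for k using pr that by (auto simp: presents_def)
  have dJ: "xdeg ?J a u = xdeg J a u" if "keys u \<subseteq> J" for u
    by (rule xdeg_restrict) (use fin that in auto)
  have de: "xdeg ?J a ?e = a c" using xdeg_single[of ?J c a 1] fin by simp
  have zero: "u = 0" if "keys u \<subseteq> ?J" "xdeg ?J a u = 0" for u
    by (rule xdeg_eq_0D[OF finJ inv nz that]) 
  have we: "w \<noteq> ?e" using w(1) c by auto
  have "pcong K p q ?e w"
    by (rule presentsD(5)[OF pr]) (use w de dJ[OF w(1)] in auto)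
  \<comment> \<open>Otherwise \<open>?e\<close> would form a class by itself: since it is
    irreducible, a step applied to it uses either a relation with \<open>?e\<close> on one side,
    hence on both, or one with 0 on one side, hence on both.\<close>
  have "\<exists>k\<in>K. (p k = ?e) \<noteq> (q k = ?e)"
  proof (rule ccontr)
    assume "\<not> ?thesis"
    then have no: "p k = ?e \<longleftrightarrow> q k = ?e" if "k \<in> K" for k using that by blast
    have pz: "p k = 0 \<longleftrightarrow> q k = 0" if "k \<in> K" for k
      using zero[of "p k"] zero[of "q k"] pq[OF that] by auto
    have "x = ?e \<longleftrightarrow> y = ?e" if "pcong K p q x y" for x y
      using that
    proof (induction rule: pcong.induct)
      case (base k z)
      then show ?case using no pz unfolding add_eq_single_one_iff by blast
    qed auto
    from this[OF \<open>pcong K p q ?e w\<close>] we show False by simp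
  qed
  then obtain k0 v where k0: "k0 \<in> K" "p k0 = ?e \<and> q k0 = v \<or> p k0 = v \<and> q k0 = ?e" "v \<noteq> ?e"
    by metis
  have v: "keys v \<subseteq> ?J" "xdeg ?J a v = a c" using pq[OF k0(1)] k0(2) de by auto
  have vc: "lookup v c = 0"
  proof (rule ccontr)
    assume nz: "lookup v c \<noteq> 0"
    have eq: "v = ?e + (v - ?e)"
      by (rule poly_mapping_eqI) (use nz in \<open>auto simp: lookup_add lookup_minus lookup_single when_def\<close>)
    have "xdeg ?J a (v - ?e) = 0" using arg_cong[OF eq, of "xdeg ?J a"] v(2) de by (simp add: xdeg_add)
    moreover have "keys (v - ?e) \<subseteq> keys v" by (auto simp: in_keys_iff lookup_minus)
    with v(1) have "keys (v - ?e) \<subseteq> ?J" by blast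
    ultimately have "v - ?e = 0" using zero by blast
    then show False using eq k0(3) by simp
  qed
  then have "c \<notin> keys v" by (simp add: in_keys_iff)
  then have vJ: "keys v \<subseteq> J" using v(1) by blast
  define \<sigma> where "\<sigma> u = except {c} u + nsmult (lookup u c) v" for u
  have \<sigma>l: "lookup (\<sigma> u) i = (if i = c then 0 else lookup u i + lookup u c * lookup v i)" for u i
    using vc by (simp add: \<sigma>_def lookup_add)
  have \<sigma>add: "\<sigma> (x + y) = \<sigma> x + \<sigma> y" for x y
    by (rule poly_mapping_eqI) (simp add: \<sigma>l lookup_add algebra_simps)
  have \<sigma>id: "\<sigma> x = x" if "keys x \<subseteq> J" for x
  proof (rule poly_mapping_eqI)
    fix i
    have "lookup x c = 0" using that c by (auto simp: in_keys_iff)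
    then show "lookup (\<sigma> x) i = lookup x i" by (simp add: \<sigma>l)
  qed
  have \<sigma>e: "\<sigma> ?e = v"
    by (rule poly_mapping_eqI) (simp add: \<sigma>l vc lookup_single when_def)
  have \<sigma>k: "keys (\<sigma> x) \<subseteq> J" if "keys x \<subseteq> ?J" for x
  proof -
    have "keys (except {c} x) \<subseteq> J" using that by (auto simp: keys_except)
    moreover have "keys (nsmult (lookup x c) v) \<subseteq> J"
      using keys_nsmult vJ by (rule order_trans)
    ultimately show ?thesis unfolding \<sigma>_def by (meson Un_least keys_add order_trans)
  qed
  have \<sigma>d: "xdeg J a (\<sigma> x) = xdeg ?J a x" if "keys x \<subseteq> ?J" for x
  proof -
    have x: "x = except {c} x + nsmult (lookup x c) ?e"
      by (rule poly_mapping_eqI) (simp add: lookup_add lookup_single when_def)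
    have "xdeg ?J a x = xdeg ?J a (except {c} x) + zscale (int (lookup x c)) (a c)"
      by (subst x) (simp only: xdeg_add xdeg_nsmult de)
    also have "\<dots> = xdeg ?J a (\<sigma> x)" by (simp add: \<sigma>_def xdeg_add xdeg_nsmult v(2))
    finally show ?thesis using dJ[OF \<sigma>k[OF that]] by simp
  qed
  define K' where "K' = K - {k0}"
  have pc: "pcong K' (\<lambda>k. \<sigma> (p k)) (\<lambda>k. \<sigma> (q k)) (\<sigma> x) (\<sigma> y)" if "pcong K p q x y" for x y
    using that
  proof (induction rule: pcong.induct)
    case (base k z)
    show ?case
    proof (cases "k = k0")
      case True
      then have "\<sigma> (p k) = \<sigma> (q k)" using k0(2) \<sigma>e \<sigma>id[OF vJ] by auto
      then show ?thesis by (simp add: \<sigma>add pcong.refl)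
    next
      case False
      then have "k \<in> K'" using base by (simp add: K'_def)
      then have "pcong K' (\<lambda>k. \<sigma> (p k)) (\<lambda>k. \<sigma> (q k)) (\<sigma> z + \<sigma> (p k)) (\<sigma> z + \<sigma> (q k))" by (rule pcong.base)
      then show ?thesis by (simp only: \<sigma>add)
    qed
  qed (blast intro: pcong.intros)+
  have "presents J a K' (\<lambda>k. \<sigma> (p k)) (\<lambda>k. \<sigma> (q k))"
    unfolding presents_def
  proof (intro conjI ballI allI impI)
    show "finite K'" using finK by (simp add: K'_def)
    fix k assume "k \<in> K'"
    then have "k \<in> K" by (simp add: K'_def)
    from pq[OF this] show "keys (\<sigma> (p k)) \<subseteq> J" "keys (\<sigma> (q k)) \<subseteq> J"
      "xdeg J a (\<sigma> (p k)) = xdeg J a (\<sigma> (q k))" using \<sigma>k \<sigma>d by auto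
  next
    fix x y assume xy: "keys x \<subseteq> J \<and> keys y \<subseteq> J \<and> xdeg J a x = xdeg J a y"
    then have "pcong K p q x y" using pr dJ unfolding presents_def by (metis subset_insertI2)
    from pc[OF this] show "pcong K' (\<lambda>k. \<sigma> (p k)) (\<lambda>k. \<sigma> (q k)) x y" using xy \<sigma>id by simp
  qed
  moreover have "independent_relations K' (\<lambda>k. \<sigma> (p k)) (\<lambda>k. \<sigma> (q k))"
    unfolding independent_relations_def
  proof (rule allI, rule impI)
    fix d :: "nat \<Rightarrow> int"
    assume d: "\<forall>i. (\<Sum>k\<in>K'. d k * (int (lookup (\<sigma> (p k)) i) - int (lookup (\<sigma> (q k)) i))) = 0"
    let ?\<alpha> = "\<lambda>k i. int (lookup (p k) i) - int (lookup (q k) i)"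
    define s :: int where "s = (if p k0 = ?e then 1 else - 1)"
    have \<alpha>0: "?\<alpha> k0 i = s * ((if i = c then 1 else 0) - int (lookup v i))" for i
      using k0(2,3) by (auto simp: s_def lookup_single when_def)
    \<comment> \<open>A dependence of the substituted relations becomes one of the original
      relations after adding the multiple of \<open>k0\<close> that cancels the coordinate
      \<open>c\<close>.\<close>
    define t where "t = (\<Sum>k\<in>K'. d k * ?\<alpha> k c)"
    define d' where "d' = d(k0 := - (s * t))"
    have "(\<Sum>k\<in>K. d' k * ?\<alpha> k i) = 0" for i
    proof -
      have "(\<Sum>k\<in>K. d' k * ?\<alpha> k i) = d' k0 * ?\<alpha> k0 i + (\<Sum>k\<in>K'. d' k * ?\<alpha> k i)"
        unfolding K'_def using k0(1) finK by (rule sum.remove[rotated])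
      also have "(\<Sum>k\<in>K'. d' k * ?\<alpha> k i) = (\<Sum>k\<in>K'. d k * ?\<alpha> k i)"
        by (rule sum.cong) (auto simp: d'_def K'_def)
      also have "d' k0 * ?\<alpha> k0 i = - t * ((if i = c then 1 else 0) - int (lookup v i))"
        unfolding \<alpha>0 by (simp add: d'_def s_def)
      finally have eq: "(\<Sum>k\<in>K. d' k * ?\<alpha> k i) = - t * ((if i = c then 1 else 0) - int (lookup v i)) + (\<Sum>k\<in>K'. d k * ?\<alpha> k i)" .
      show ?thesis
      proof (cases "i = c")
        case True
        then show ?thesis unfolding eq by (simp add: vc t_def)
      next
        case False
        have "0 = (\<Sum>k\<in>K'. d k * (int (lookup (\<sigma> (p k)) i) - int (lookup (\<sigma> (q k)) i)))"
          using d by simp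
        also have "\<dots> = (\<Sum>k\<in>K'. d k * ?\<alpha> k i + d k * ?\<alpha> k c * int (lookup v i))"
          using False by (intro sum.cong) (auto simp: \<sigma>l algebra_simps)
        also have "\<dots> = (\<Sum>k\<in>K'. d k * ?\<alpha> k i) + t * int (lookup v i)"
          by (simp add: sum.distrib t_def sum_distrib_right)
        finally show ?thesis unfolding eq using False by simp
      qed
    qed
    then have "\<forall>k\<in>K. d' k = 0"
      using ind unfolding independent_relations_def by blast
    then show "\<forall>k\<in>K'. d k = 0" by (auto simp: d'_def K'_def split: if_splits)
  qed
  ultimately show ?thesis by (rule ci_presentationI)
qed


text \<open>If two vectors have equal degree, their parts over \<open>E1\<close> differ in degree by
  an element of both subgroups, hence by a multiple of \<open>b\<close>; the new relation carries
  the copies of \<open>b\<close> from one part to the other. For independence, taking degrees over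
  \<open>E1\<close> leaves only \<open>c None\<close> times \<open>b\<close> of a dependence, so
  this coefficient vanishes and the dependence falls apart into the two given parts.\<close>

lemma ci_presentation_glue:
  assumes fin: "finite E1" "finite E2" and dis: "E1 \<inter> E2 = {}"
    and b: "b \<in> nspan (a ` E1)" "b \<in> nspan (a ` E2)" "zspan {b} = zspan (a ` E1) \<inter> zspan (a ` E2)"
    and tf: "\<And>c. zscale c b = 0 \<Longrightarrow> c = 0"
    and ci: "ci_presentation E1 a" "ci_presentation E2 a"
  shows "ci_presentation (E1 \<union> E2) a"
proof -
  let ?J = "E1 \<union> E2"
  obtain u0 v0 where u0: "keys u0 \<subseteq> E1" "b = xdeg E1 a u0" and v0: "keys v0 \<subseteq> E2" "b = xdeg E2 a v0"
    using b by (auto simp: nspan_image_xdeg fin)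
  obtain K1 :: "nat set" and p1 q1 where pr1: "presents E1 a K1 p1 q1" and ind1: "independent_relations K1 p1 q1"
    using ci by (auto simp: ci_presentation_def)
  obtain K2 :: "nat set" and p2 q2 where pr2: "presents E2 a K2 p2 q2" and ind2: "independent_relations K2 p2 q2"
    using ci by (auto simp: ci_presentation_def)
  note P1 = presentsD[OF pr1] and P2 = presentsD[OF pr2]
  define K where "K = insert None (Some ` (K1 <+> K2))"
  define p where "p = case_option u0 (case_sum p1 p2)"
  define q where "q = case_option v0 (case_sum q1 q2)"
  have d1: "xdeg ?J a u = xdeg E1 a u" if "keys u \<subseteq> E1" for u
    by (rule xdeg_restrict) (use fin that in auto)
  have d2: "xdeg ?J a u = xdeg E2 a u" if "keys u \<subseteq> E2" for u
    by (rule xdeg_restrict) (use fin that in auto)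
  have s0: "pcong K p q u0 v0"
    using pcong_rel[of None K p q] by (simp add: K_def p_def q_def)
  have s1: "pcong K p q u v" if "pcong K1 p1 q1 u v" for u v
  proof (rule pcong_mono[OF that])
    fix k assume "k \<in> K1"
    then show "pcong K p q (p1 k) (q1 k)"
      using pcong_rel[of "Some (Inl k)" K p q] by (simp add: K_def p_def q_def InlI)
  qed
  have s2: "pcong K p q u v" if "pcong K2 p2 q2 u v" for u v
  proof (rule pcong_mono[OF that])
    fix k assume "k \<in> K2"
    then show "pcong K p q (p2 k) (q2 k)"
      using pcong_rel[of "Some (Inr k)" K p q] by (simp add: K_def p_def q_def InrI)
  qed
  \<comment> \<open>The path runs through u1 + u2, v1 + t u0 + u2, v1 + t v0 + u2 and v1 + v2, where
    \<open>u0\<close> and \<open>v0\<close> express \<open>b\<close> in the two parts. Negative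
    multiples are handled by exchanging \<open>u\<close> and \<open>v\<close>.\<close>
  have key: "pcong K p q u v"
    if k: "keys u \<subseteq> ?J" "keys v \<subseteq> ?J" and d: "xdeg ?J a u = xdeg ?J a v"
      and t: "xdeg E1 a (except E2 u) - xdeg E1 a (except E2 v) = zscale (int t) b" for u v t
  proof -
    let ?u1 = "except E2 u" and ?u2 = "except E1 u" and ?v1 = "except E2 v" and ?v2 = "except E1 v"
    have k1: "keys ?u1 \<subseteq> E1" "keys ?v1 \<subseteq> E1"
      "keys ?u2 \<subseteq> E2" "keys ?v2 \<subseteq> E2" using k dis by (auto simp: keys_except)
    have z: "lookup u i = 0" "lookup v i = 0" if "i \<notin> E1" "i \<notin> E2" for i
      using k that by (auto simp: in_keys_iff)
    have uv: "u = ?u1 + ?u2" "v = ?v1 + ?v2"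
      using dis z by (auto intro!: poly_mapping_eqI simp: lookup_add)
    have "xdeg ?J a u = xdeg E1 a ?u1 + xdeg E2 a ?u2" "xdeg ?J a v = xdeg E1 a ?v1 + xdeg E2 a ?v2"
      using xdeg_add[of ?J a ?u1 ?u2] xdeg_add[of ?J a ?v1 ?v2] d1 d2 k1 uv by auto
    then have e2: "xdeg E2 a ?v2 = xdeg E2 a ?u2 + zscale (int t) b" using d t by (simp add: algebra_simps)
    have e1: "xdeg E1 a ?u1 = xdeg E1 a ?v1 + zscale (int t) b" using t by (simp add: algebra_simps)
    have "pcong K1 p1 q1 ?u1 (?v1 + nsmult t u0)"
    proof (rule P1(5))
      show "keys (?v1 + nsmult t u0) \<subseteq> E1"
        using keys_add[of ?v1 "nsmult t u0"] keys_nsmult[of t u0] k1 u0 by blast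
      show "xdeg E1 a ?u1 = xdeg E1 a (?v1 + nsmult t u0)" by (simp add: e1 xdeg_add xdeg_nsmult u0(2)[symmetric])
    qed (rule k1)
    then have A: "pcong K p q (?u1 + ?u2) (?v1 + nsmult t u0 + ?u2)" by (intro pcong_add2 s1)
    have "pcong K p q (?v1 + ?u2 + nsmult t u0) (?v1 + ?u2 + nsmult t v0)"
      by (intro pcong_add pcong_nsmult s0)
    then have B: "pcong K p q (?v1 + nsmult t u0 + ?u2) (?v1 + (?u2 + nsmult t v0))"
      by (simp add: ac_simps)
    have "pcong K2 p2 q2 (?u2 + nsmult t v0) ?v2"
    proof (rule P2(5))
      show "keys (?u2 + nsmult t v0) \<subseteq> E2"
        using keys_add[of ?u2 "nsmult t v0"] keys_nsmult[of t v0] k1 v0 by blast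
      show "xdeg E2 a (?u2 + nsmult t v0) = xdeg E2 a ?v2" by (simp add: e2 xdeg_add xdeg_nsmult v0(2)[symmetric])
    qed (rule k1)
    then have C: "pcong K p q (?v1 + (?u2 + nsmult t v0)) (?v1 + ?v2)" by (intro pcong_add s2)
    show ?thesis using A B C uv by (metis pcong.trans)
  qed
  have "presents ?J a K p q"
    unfolding presents_def
  proof (intro conjI ballI allI impI)
    show "finite K" using P1(1) P2(1) by (simp add: K_def)
    fix k assume "k \<in> K"
    then consider "k = None" | i where "k = Some (Inl i)" "i \<in> K1" | i where "k = Some (Inr i)" "i \<in> K2"
      by (auto simp: K_def)
    then have "keys (p k) \<subseteq> ?J \<and> keys (q k) \<subseteq> ?J \<and> xdeg ?J a (p k) = xdeg ?J a (q k)"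
    proof cases
      case 1
      then show ?thesis using u0 v0 d1[of u0] d2[of v0] by (auto simp: p_def q_def)
    next
      case 2
      then show ?thesis using P1(2-4)[of i] d1[of "p1 i"] d1[of "q1 i"] by (auto simp: p_def q_def)
    next
      case 3
      then show ?thesis using P2(2-4)[of i] d2[of "p2 i"] d2[of "q2 i"] by (auto simp: p_def q_def)
    qed
    then show "keys (p k) \<subseteq> ?J" "keys (q k) \<subseteq> ?J" "xdeg ?J a (p k) = xdeg ?J a (q k)"
      by auto
  next
    fix u v
    assume uv: "keys u \<subseteq> ?J \<and> keys v \<subseteq> ?J \<and> xdeg ?J a u = xdeg ?J a v"
    let ?d = "xdeg E1 a (except E2 u) - xdeg E1 a (except E2 v)"
    have i1: "xdeg E1 a x \<in> zspan (a ` E1)" for x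
      unfolding zspan_image_iff[OF fin(1)] xdeg_def by blast
    have i2: "xdeg E2 a x \<in> zspan (a ` E2)" for x
      unfolding zspan_image_iff[OF fin(2)] xdeg_def by blast
    have tot: "xdeg ?J a x = xdeg E1 a (except E2 x) + xdeg E2 a (except E1 x)" for x
      unfolding xdeg_def zdeg_union[OF fin dis]
      by (intro arg_cong2[of _ _ _ _ plus] zdeg_cong) (use dis in auto)
    then have "?d = xdeg E2 a (except E1 v) - xdeg E2 a (except E1 u)"
      using uv by (simp add: algebra_simps)
    then have "?d \<in> zspan (a ` E1) \<inter> zspan (a ` E2)"
      using i1 i2 by (metis IntI zmod.span_diff)
    then obtain t where t: "?d = zscale t b" unfolding b(3)[symmetric] by (auto simp: zmod.span_singleton)
    show "pcong K p q u v"
    proof (cases "t \<ge> 0")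
      case True
      then show ?thesis using key[of u v "nat t"] uv t by simp
    next
      case False
      have "xdeg E1 a (except E2 v) - xdeg E1 a (except E2 u) = zscale (- t) b"
        using t by (simp add: algebra_simps)
      then show ?thesis using key[of v u "nat (- t)"] uv False by (simp add: pcong.sym)
    qed
  qed
  moreover have "independent_relations K p q"
    unfolding independent_relations_def
  proof (rule allI, rule impI)
    fix c :: "(nat + nat) option \<Rightarrow> int"
    let ?\<alpha> = "\<lambda>p q k i. int (lookup (p k) i) - int (lookup (q k) i)"
    assume c: "\<forall>i. (\<Sum>k\<in>K. c k * ?\<alpha> p q k i) = 0"
    define S1 where "S1 i = (\<Sum>k\<in>K1. c (Some (Inl k)) * ?\<alpha> p1 q1 k i)" for i
    define S2 where "S2 i = (\<Sum>k\<in>K2. c (Some (Inr k)) * ?\<alpha> p2 q2 k i)" for i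
    have sum: "(\<Sum>k\<in>K. c k * ?\<alpha> p q k i) = c None * (int (lookup u0 i) - int (lookup v0 i)) + (S1 i + S2 i)" for i
      using P1(1) P2(1) by (simp add: K_def p_def q_def S1_def S2_def sum.reindex sum.Plus)
    have S10: "S1 i = 0" if "i \<notin> E1" for i
    proof -
      have "lookup (p1 k) i = 0 \<and> lookup (q1 k) i = 0" if "k \<in> K1" for k
        using P1(2,3)[OF that] \<open>i \<notin> E1\<close> by (metis in_keys_iff subsetD)
      then show ?thesis unfolding S1_def by (intro sum.neutral) auto
    qed
    have S20: "S2 i = 0" if "i \<notin> E2" for i
    proof -
      have "lookup (p2 k) i = 0 \<and> lookup (q2 k) i = 0" if "k \<in> K2" for k
        using P2(2,3)[OF that] \<open>i \<notin> E2\<close> by (metis in_keys_iff subsetD)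
      then show ?thesis unfolding S2_def by (intro sum.neutral) auto
    qed
    have "zdeg E1 a (\<lambda>i. c None * int (lookup u0 i) + S1 i) = zdeg E1 a (\<lambda>_. 0)"
    proof (rule zdeg_cong)
      fix i assume "i \<in> E1"
      then have "i \<notin> E2" using dis by blast
      then have "lookup v0 i = 0" "S2 i = 0" using v0(1) S20 by (auto simp: in_keys_iff)
      then show "c None * int (lookup u0 i) + S1 i = 0" using c[rule_format, of i] unfolding sum by simp
    qed
    moreover have "zdeg E1 a S1 = 0"
      unfolding S1_def zdeg_combination zdeg_diff using P1(4) by (simp add: xdeg_def)
    ultimately have "zscale (c None) b = 0"
      unfolding zdeg_add zdeg_scale by (simp add: u0(2) xdeg_def)
    then have c0: "c None = 0" by (rule tf)
    have e: "S1 i + S2 i = 0" for i using c[rule_format, of i] unfolding sum c0 by simp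
    have "S1 i = 0 \<and> S2 i = 0" for i
      using e[of i] S10[of i] S20[of i] dis by (cases "i \<in> E1"; cases "i \<in> E2") auto
    then have S: "\<forall>i. S1 i = 0" "\<forall>i. S2 i = 0" by auto
    have "\<forall>k\<in>K1. c (Some (Inl k)) = 0"
      using ind1 S(1) unfolding independent_relations_def S1_def by (elim allE[of _ "\<lambda>k. c (Some (Inl k))"]) blast
    moreover have "\<forall>k\<in>K2. c (Some (Inr k)) = 0"
      using ind2 S(2) unfolding independent_relations_def S2_def by (elim allE[of _ "\<lambda>k. c (Some (Inr k))"]) blast
    ultimately show "\<forall>k\<in>K. c k = 0" using c0 by (auto simp: K_def)
  qed
  ultimately show ?thesis by (rule ci_presentationI)
qed

lemma ci_presentation_insert_many:
  assumes fin: "finite J" "finite F" and sub: "a ` F \<subseteq> nspan (a ` J)" and ci: "ci_presentation J a"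
  shows "ci_presentation (J \<union> F) a"
  using fin(2) sub
proof (induction F rule: finite_induct)
  case (insert c F)
  show ?case
  proof (cases "c \<in> J \<union> F")
    case True
    then show ?thesis using insert by (simp add: insert_absorb)
  next
    case False
    have "a c \<in> nspan (a ` (J \<union> F))"
      using insert.prems nspan_mono[of "a ` J" "a ` (J \<union> F)"] by auto
    then show ?thesis
      using ci_presentation_insert[of "J \<union> F" c a] False insert fin by simp
  qed
qed (use ci in simp)

lemma ci_presentation_remove_many:
  assumes fin: "finite J" "finite F" and sub: "a ` F \<subseteq> nspan (a ` J)"
    and inv: "no_invertibles (nspan (a ` (J \<union> F)))" and nz: "\<And>j. j \<in> J \<union> F \<Longrightarrow> a j \<noteq> 0"
    and ci: "ci_presentation (J \<union> F) a"
  shows "ci_presentation J a"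
  using fin(2) sub inv nz ci
proof (induction F rule: finite_induct)
  case (insert c F)
  have inv: "no_invertibles (nspan (a ` (J \<union> F)))"
    by (rule no_invertibles_mono[OF insert.prems(2)]) auto
  show ?case
  proof (cases "c \<in> J \<union> F")
    case True
    then show ?thesis using insert by (simp add: insert_absorb)
  next
    case False
    have "a c \<in> nspan (a ` (J \<union> F))"
      using insert.prems nspan_mono[of "a ` J" "a ` (J \<union> F)"] by auto
    then have "ci_presentation (J \<union> F) a"
      using ci_presentation_remove[of "J \<union> F" c a] False insert fin by simp
    then show ?thesis using insert inv by simp
  qed
qed simp

lemma nspan_superset: "B \<subseteq> nspan B"
proof
  fix b assume "b \<in> B"
  moreover have "b = (\<Sum>x\<in>{b}. zscale (int 1) x)" by simp
  ultimately show "b \<in> nspan B" unfolding nspan_def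
    by (intro CollectI exI[of _ "{b}"] exI[of _ "\<lambda>_. 1"]) auto
qed

lemma nspan_Un_absorb:
  assumes "finite J" "finite F" "a ` F \<subseteq> nspan (a ` J)"
  shows "nspan (a ` (J \<union> F)) = nspan (a ` J)"
proof
  show "nspan (a ` J) \<subseteq> nspan (a ` (J \<union> F))" by (rule nspan_mono) auto
  show "nspan (a ` (J \<union> F)) \<subseteq> nspan (a ` J)"
    using assms(2,3)
  proof (induction F rule: finite_induct)
    case (insert c F)
    obtain w where w: "keys w \<subseteq> J" "a c = xdeg J a w"
      using insert.prems by (auto simp: nspan_image_xdeg[OF assms(1)])
    show ?case
    proof (cases "c \<in> J \<union> F")
      case True
      then show ?thesis using insert by (simp add: insert_absorb)
    next
      case False
      show ?thesis
      proof
        fix x assume "x \<in> nspan (a ` (J \<union> insert c F))"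
        then obtain f where f: "\<And>i. 0 \<le> f i" "x = zdeg (J \<union> insert c F) a f"
          using nspan_image_iff[of "J \<union> insert c F" x a] assms(1) insert.hyps(1) by auto
        have JF: "finite (J \<union> F)" "c \<notin> J \<union> F" using assms insert False by auto
        have "a c = zdeg (J \<union> F) a (\<lambda>i. int (lookup w i))"
          using w xdeg_restrict[of "J \<union> F" J w a] JF by (simp add: xdeg_def)
        moreover have "x = zdeg (J \<union> F) a f + zscale (f c) (a c)"
          unfolding f(2) using JF by (simp add: zdeg_def)
        ultimately have "x = zdeg (J \<union> F) a (\<lambda>i. f i + f c * int (lookup w i))"
          unfolding zdeg_add zdeg_scale by simp
        then have "x \<in> nspan (a ` (J \<union> F))"
          unfolding nspan_image_iff[OF JF(1)] using f(1)
          by (intro exI[of _ "\<lambda>i. f i + f c * int (lookup w i)"]) auto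
        then show "x \<in> nspan (a ` J)" using insert by auto
      qed
    qed
  qed simp
qed

text \<open>Over each family the generators of the other are redundant, so one passes through the
  union by inserting \<open>J2\<close> and removing \<open>J1\<close>.\<close>

lemma ci_presentation_transfer_disjoint:
  assumes fin: "finite J1" "finite J2" and eq: "nspan (a ` J1) = nspan (a ` J2)"
    and inv: "no_invertibles (nspan (a ` J1))" and nz: "\<And>j. j \<in> J1 \<union> J2 \<Longrightarrow> a j \<noteq> 0"
    and ci: "ci_presentation J1 a"
  shows "ci_presentation J2 a"
proof (rule ci_presentation_remove_many[OF fin(2,1)])
  have s: "a ` J2 \<subseteq> nspan (a ` J1)" "a ` J1 \<subseteq> nspan (a ` J2)" using eq nspan_superset by blast+
  then show "a ` J1 \<subseteq> nspan (a ` J2)" by simp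
  show "no_invertibles (nspan (a ` (J2 \<union> J1)))" using nspan_Un_absorb[OF fin(2,1) s(2)] inv eq by simp
  show "a j \<noteq> 0" if "j \<in> J2 \<union> J1" for j using nz that by blast
  show "ci_presentation (J2 \<union> J1) a"
    using ci_presentation_insert_many[OF fin s(1) ci] by (simp add: Un_commute)
qed

text \<open>Two families whose index sets overlap cannot be united. A copy \<open>J3\<close> of
  \<open>J2\<close>, shifted beyond both index sets, is disjoint from each and mediates between
  them.\<close>

lemma ci_presentation_transfer:
  fixes J1 J2 :: "nat set"
  assumes fin: "finite J1" "finite J2" and eq: "nspan (a ` J1) = nspan (b ` J2)"
    and inv: "no_invertibles (nspan (a ` J1))"
    and nz: "\<And>j. j \<in> J1 \<Longrightarrow> a j \<noteq> 0" "\<And>j. j \<in> J2 \<Longrightarrow> b j \<noteq> 0"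
    and ci: "ci_presentation J1 a"
  shows "ci_presentation J2 b"
proof -
  obtain n where n: "J1 \<union> J2 \<subseteq> {..<n}"
    using finite_nat_bounded[of "J1 \<union> J2"] fin by auto
  define h where "h i = i - n" for i :: nat
  define J3 where "J3 = (\<lambda>j. j + n) ` J2"
  have J3: "h ` J3 = J2" "finite J3" "J3 \<inter> J1 = {}" "J3 \<inter> J2 = {}"
    using n fin by (auto simp: h_def J3_def image_image)
  define a1 where "a1 i = (if i \<in> J3 then b (h i) else a i)" for i
  define a2 where "a2 i = (if i \<in> J3 then b (h i) else b i)" for i
  have im: "a1 ` J1 = a ` J1" "a2 ` J2 = b ` J2" "a1 ` J3 = b ` J2" "a2 ` J3 = b ` J2"
  proof -
    show "a1 ` J1 = a ` J1" using J3(3) by (intro image_cong) (auto simp: a1_def)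
    show "a2 ` J2 = b ` J2" using J3(4) by (intro image_cong) (auto simp: a2_def)
    have "a1 ` J3 = b ` h ` J3" "a2 ` J3 = b ` h ` J3" by (auto simp: a1_def a2_def)
    then show "a1 ` J3 = b ` J2" "a2 ` J3 = b ` J2" using J3(1) by auto
  qed
  have hb: "h i \<in> J2" if "i \<in> J3" for i using J3(1) that by blast
  have "ci_presentation J1 a1" using ci J3(3) by (subst ci_presentation_cong[of _ _ a]) (auto simp: a1_def)
  then have "ci_presentation J3 a1"
    by (rule ci_presentation_transfer_disjoint[rotated -1])
      (use im J3 fin eq inv nz hb in \<open>auto simp: a1_def\<close>)
  then have "ci_presentation J3 a2" by (subst ci_presentation_cong[of _ _ a1]) (auto simp: a1_def a2_def)
  then have "ci_presentation J2 a2"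
    by (rule ci_presentation_transfer_disjoint[rotated -1])
      (use im J3 fin eq inv nz hb in \<open>auto simp: a2_def\<close>)
  then show ?thesis using J3(4) by (subst ci_presentation_cong[of _ _ a2]) (auto simp: a2_def)
qed

lemma ci_presentation_independent:
  assumes fin: "finite B" and ind: "zindependent B"
  obtains n and h :: "nat \<Rightarrow> 'g::ab_group_add" where "h ` {..<n::nat} = B" "ci_presentation {..<n} h" "no_invertibles (nspan B)" "0 \<notin> B"
proof -
  obtain h where h: "bij_betw h {..<card B} B"
    using ex_bij_betw_nat_finite[OF fin] by (auto simp: lessThan_atLeast0)
  let ?n = "card B"
  have im: "h ` {..<?n} = B" "inj_on h {..<?n}" using h by (auto simp: bij_betw_def)
  have z: "f i = 0" if "zdeg {..<?n} h f = 0" "i < ?n" for f i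
  proof -
    define g where "g = the_inv_into {..<?n} h"
    have gh: "g (h k) = k" if "k < ?n" for k
      unfolding g_def using im that by (simp add: the_inv_into_f_f)
    have "(\<Sum>b\<in>B. zscale (f (g b)) b) = zdeg {..<?n} h f"
      using sum.reindex_bij_betw[OF h, of "\<lambda>b. zscale (f (g b)) b"] gh by (simp add: zdeg_def)
    then have "f (g (h i)) = 0"
      using zmod.independentD[OF ind fin order_refl, of "\<lambda>b. f (g b)" "h i"] that im(1) by auto
    then show ?thesis using gh[OF that(2)] by simp
  qed
  have "presents {..<?n} h ({}::nat set) (\<lambda>_. 0) (\<lambda>_. 0)"
    unfolding presents_def
  proof (intro conjI allI impI ballI)
    fix u v assume uv: "keys u \<subseteq> {..<?n} \<and> keys v \<subseteq> {..<?n} \<and> xdeg {..<?n} h u = xdeg {..<?n} h v"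
    have "zdeg {..<?n} h (\<lambda>i. int (lookup u i) - int (lookup v i)) = 0"
      unfolding zdeg_diff using uv by (simp add: xdeg_def)
    from z[OF this] have l: "lookup u i = lookup v i" if "i < ?n" for i using that by force
    have "lookup u i = lookup v i" for i
    proof (cases "i < ?n")
      case False
      then have "i \<notin> keys u" "i \<notin> keys v" using uv by auto
      then show ?thesis by (simp add: in_keys_iff)
    qed (rule l)
    then have "u = v" by (intro poly_mapping_eqI)
    then show "pcong {} (\<lambda>_. 0) (\<lambda>_. 0) u v" by (simp add: pcong.refl)
  qed auto
  then have ci: "ci_presentation {..<?n} h"
    by (rule ci_presentationI) (simp add: independent_relations_def)
  have inv: "no_invertibles (nspan B)"
    unfolding no_invertibles_def
  proof
    have "0 \<in> nspan B" unfolding nspan_def by (intro CollectI exI[of _ "{}"]) auto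
    then show "{0} \<subseteq> nspan B \<inter> uminus ` nspan B" by force
    show "nspan B \<inter> uminus ` nspan B \<subseteq> {0}"
    proof
      fix x assume "x \<in> nspan B \<inter> uminus ` nspan B"
      then have "x \<in> nspan B" "- x \<in> nspan B" by auto
      then obtain f g where fg: "\<And>i. 0 \<le> f i" "x = zdeg {..<?n} h f" "\<And>i. 0 \<le> g i" "- x = zdeg {..<?n} h g"
        using nspan_image_iff[of "{..<?n}" _ h] im(1) by auto
      have "zdeg {..<?n} h (\<lambda>i. f i + g i) = 0" unfolding zdeg_add fg(2,4)[symmetric] by simp
      from z[OF this] fg have "f i = 0" if "i < ?n" for i by (metis add_nonneg_eq_0_iff that)
      then have "zdeg {..<?n} h f = zdeg {..<?n} h (\<lambda>_. 0)" by (intro zdeg_cong) auto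
      then show "x \<in> {0}" using fg by simp
    qed
  qed
  have "0 \<notin> B" using zmod.dependent_zero ind by blast
  then show thesis using that[OF im(1) ci inv] by blast
qed

text \<open>The claim is made for all families of nonzero generators of \<open>S\<close>: the
  families in a derivation need be neither the given one nor free of zeros, and
  \<open>ci_presentation_transfer\<close> moves between them.\<close>

theorem completely_glued_ci_presentation:
  assumes "completely_glued S"
  shows "no_invertibles S \<and> (\<forall>(J::nat set) a. finite J \<longrightarrow> (\<forall>j\<in>J. a j \<noteq> 0) \<longrightarrow> nspan (a ` J) = S \<longrightarrow> ci_presentation J a)"
  using assms
proof (induction rule: completely_glued.induct)
  case (independent B)
  then obtain n and h :: "nat \<Rightarrow> 'a" where h: "h ` {..<n} = B" "ci_presentation {..<n} h" "no_invertibles (nspan B)" "0 \<notin> B"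
    by (rule ci_presentation_independent)
  show ?case
  proof (intro conjI allI impI)
    fix J :: "nat set" and a assume "finite J" "\<forall>j\<in>J. a j \<noteq> 0" "nspan (a ` J) = nspan B"
    then show "ci_presentation J a"
      by (intro ci_presentation_transfer[OF _ _ _ _ _ _ h(2)]) (use h in auto)
  qed (rule h(3))
next
  case (glue a m E1 E2)
  note inv = glue.hyps(1)
  obtain b where E: "E1 \<union> E2 = {..<m}" "E1 \<inter> E2 = {}" and
    b: "b \<in> nspan (a ` E1)" "b \<in> nspan (a ` E2)" "b \<noteq> 0" "zspan {b} = zspan (a ` E1) \<inter> zspan (a ` E2)"
    using glue.hyps(2) unfolding gluing_def by blast
  \<comment> \<open>A glued family may contain zeros. Leaving them out changes neither the
    semigroups nor the subgroups, and the induction hypotheses apply to what remains.\<close>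
  define nzp where "nzp E = {i\<in>E. a i \<noteq> 0}" for E
  have fin: "finite E1" "finite E2" using E by (metis finite_Un finite_lessThan)+
  have red: "zdeg (nzp E) a f = zdeg E a f" if "finite E" for E f
    unfolding zdeg_def nzp_def by (rule sum.mono_neutral_left) (use that in auto)
  have n: "nspan (a ` nzp E) = nspan (a ` E)" if "finite E" for E
    using that red[OF that] by (auto simp: nspan_image_iff nzp_def)
  have z: "zspan (a ` nzp E) = zspan (a ` E)" if "finite E" for E
    using that red[OF that] by (auto simp: zspan_image_iff nzp_def)
  have finn: "finite (nzp E1)" "finite (nzp E2)" using fin by (auto simp: nzp_def)
  have ci1: "ci_presentation (nzp E1) a" using glue.IH(1) finn n[OF fin(1)] by (auto simp: nzp_def)
  have ci2: "ci_presentation (nzp E2) a" using glue.IH(2) finn n[OF fin(2)] by (auto simp: nzp_def)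
  have bS: "b \<in> nspan (a ` {..<m})" using b(1) nspan_mono[of "a ` E1" "a ` {..<m}"] E by blast
  have tf: "c = 0" if "zscale c b = 0" for c
    using nspan_torsion_free[OF finite_lessThan inv bS that] b(3) by blast
  have U: "nzp E1 \<union> nzp E2 = nzp {..<m}" unfolding E(1)[symmetric] by (auto simp: nzp_def)
  have ci: "ci_presentation (nzp {..<m}) a"
    unfolding U[symmetric]
    by (rule ci_presentation_glue[OF finn _ _ _ _ tf ci1 ci2]) (use b n z fin E in \<open>auto simp: nzp_def\<close>)
  show ?case
  proof (intro conjI allI impI)
    fix J :: "nat set" and a' assume "finite J" "\<forall>j\<in>J. a' j \<noteq> 0" "nspan (a' ` J) = nspan (a ` {..<m})"
    then show "ci_presentation J a'"
      by (intro ci_presentation_transfer[OF _ _ _ _ _ _ ci]) (use n[OF finite_lessThan] inv in \<open>auto simp: nzp_def\<close>)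
  qed (rule inv)
qed

section \<open>The space of relations\<close>

text \<open>One rational vector space structure serves for exponent vectors with rational entries,
  for polynomials and for the targets of linear maps on polynomials.\<close>

definition qscale :: "rat \<Rightarrow> ('a \<Rightarrow>\<^sub>0 rat) \<Rightarrow> ('a \<Rightarrow>\<^sub>0 rat)"
  where "qscale c x = Poly_Mapping.map ((*) c) x"

lemma lookup_qscale [simp]: "lookup (qscale c x) i = c * lookup x i"
  by (simp add: qscale_def Poly_Mapping.map.rep_eq when_def)

lemma vector_space_qscale: "vector_space qscale"
  by unfold_locales (auto intro!: poly_mapping_eqI simp: lookup_add algebra_simps)

interpretation qv: vector_space "qscale :: rat \<Rightarrow> ('a \<Rightarrow>\<^sub>0 rat) \<Rightarrow> ('a \<Rightarrow>\<^sub>0 rat)"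
  by (rule vector_space_qscale)

lemma qv_linearI:
  fixes f :: "('a \<Rightarrow>\<^sub>0 rat) \<Rightarrow> ('b \<Rightarrow>\<^sub>0 rat)"
  assumes "\<And>x y. f (x + y) = f x + f y" "\<And>c x. f (qscale c x) = qscale c (f x)"
  shows "Vector_Spaces.linear qscale qscale f"
  unfolding Vector_Spaces.linear_iff using assms by (simp add: vector_space_qscale)

lemma qv_family_independent:
  fixes f :: "'k \<Rightarrow> ('a \<Rightarrow>\<^sub>0 rat)"
  assumes fin: "finite K"
    and ind: "\<forall>c. (\<Sum>k\<in>K. qscale (c k) (f k)) = 0 \<longrightarrow> (\<forall>k\<in>K. c k = 0)"
  shows "inj_on f K" "qv.independent (f ` K)"
proof -
  show inj: "inj_on f K"
  proof (rule inj_onI, rule ccontr)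
    fix k l assume kl: "k \<in> K" "l \<in> K" "f k = f l" "k \<noteq> l"
    let ?c = "\<lambda>j. if j = k then 1 else if j = l then - 1 else (0::rat)"
    have "(\<Sum>j\<in>K. qscale (?c j) (f j)) = (\<Sum>j\<in>{k,l}. qscale (?c j) (f j))"
      by (rule sum.mono_neutral_right) (use fin kl in auto)
    also have "\<dots> = 0" using kl by simp
    finally show False using ind[rule_format, of ?c k] kl(1) by auto
  qed
  show "qv.independent (f ` K)"
  proof
    assume "qv.dependent (f ` K)"
    then obtain u v where u: "v \<in> f ` K" "u v \<noteq> 0" "(\<Sum>v\<in>f ` K. qscale (u v) v) = 0"
      using qv.dependent_finite[of "f ` K"] fin by auto
    then have "(\<Sum>k\<in>K. qscale (u (f k)) (f k)) = 0" by (simp add: sum.reindex[OF inj])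
    then have "\<forall>k\<in>K. u (f k) = 0" by (rule ind[rule_format, of "\<lambda>k. u (f k)", THEN ballI])
    then show False using u by auto
  qed
qed

lemma qv_spanning_independent:
  assumes fin: "finite S" and dim: "card S \<le> qv.dim (qv.span S)"
  shows "qv.independent S"
proof -
  obtain B where B: "B \<subseteq> S" "qv.independent B" "S \<subseteq> qv.span B"
    using qv.maximal_independent_subset by metis
  have "qv.span B = qv.span S" using B by (metis qv.span_mono qv.span_minimal qv.subspace_span subset_antisym)
  then have "qv.dim (qv.span S) = card B" using qv.dim_span_eq_card_independent[OF B(2)] by simp
  then have "card B = card S" using card_mono[OF fin B(1)] dim by linarith
  then have "B = S" by (rule card_subset_eq[OF fin B(1)])
  then show ?thesis using B by simp
qed

lemma qv_independent_Un:
  assumes "finite B" "qv.independent A" "qv.independent B" "qv.span A \<inter> qv.span B \<subseteq> {0}"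
  shows "qv.independent (A \<union> B)"
  using assms
proof (induction B rule: finite_induct)
  case (insert b B)
  have "qv.span B \<subseteq> qv.span (insert b B)" by (rule qv.span_mono) auto
  then have ind: "qv.independent (A \<union> B)"
    using insert qv.independent_mono[OF insert.prems(2), of B] by blast
  have "b \<notin> qv.span (A \<union> B)"
  proof
    assume "b \<in> qv.span (A \<union> B)"
    then obtain x y where xy: "x \<in> qv.span A" "y \<in> qv.span B" "b = x + y" by (auto simp: qv.span_Un)
    then have "x = b - y" by simp
    also have "b - y \<in> qv.span (insert b B)"
      using xy(2) \<open>qv.span B \<subseteq> qv.span (insert b B)\<close> by (intro qv.span_diff) (auto intro: qv.span_base)
    finally have "x = 0" using xy(1) insert.prems(3) by blast
    then have "b \<in> qv.span B" using xy by simp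
    then show False using insert.prems(2) insert.hyps(2) by (simp add: qv.independent_insert)
  qed
  then show ?case using ind qv.independent_insertI by simp
qed simp

section \<open>The rank of the relation lattice\<close>

definition ratvec :: "('i \<Rightarrow>\<^sub>0 nat) \<Rightarrow> ('i \<Rightarrow>\<^sub>0 rat)"
  where "ratvec u = Poly_Mapping.map of_nat u"

lemma lookup_ratvec [simp]: "lookup (ratvec u) i = of_nat (lookup u i)"
  by (simp add: ratvec_def Poly_Mapping.map.rep_eq when_def)

lemma ratvec_add: "ratvec (u + v) = ratvec u + ratvec v"
  by (rule poly_mapping_eqI) (simp add: lookup_add)

text \<open>The lattice L inside the rational vectors: a subgroup and not a subspace, so that its
  members keep representatives \<open>u\<close>, \<open>v\<close> of equal degree. Its linear span
  has dimension the rank of L.\<close>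

definition relspace :: "'i set \<Rightarrow> ('i \<Rightarrow> 'g::ab_group_add) \<Rightarrow> ('i \<Rightarrow>\<^sub>0 rat) set"
  where "relspace J a = {ratvec u - ratvec v | u v.
    keys u \<subseteq> J \<and> keys v \<subseteq> J \<and> xdeg J a u = xdeg J a v}"

definition relrank :: "'i set \<Rightarrow> ('i \<Rightarrow> 'g::ab_group_add) \<Rightarrow> nat"
  where "relrank J a = qv.dim (relspace J a)"

definition unitvecs :: "'i set \<Rightarrow> ('i \<Rightarrow>\<^sub>0 rat) set"
  where "unitvecs J = (\<lambda>j. single j 1) ` J"

lemma unitvecs_fin: "finite J \<Longrightarrow> finite (unitvecs J)"
  by (simp add: unitvecs_def)

lemma card_unitvecs: "card (unitvecs J) = card J"
  unfolding unitvecs_def by (rule card_image) (auto simp: inj_on_def poly_mapping_eq_iff lookup_single fun_eq_iff when_def split: if_splits)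

lemma sum_single_keys:
  fixes x :: "'a \<Rightarrow>\<^sub>0 'b::comm_monoid_add"
  assumes "finite J" "keys x \<subseteq> J"
  shows "x = (\<Sum>j\<in>J. single j (lookup x j))"
proof (rule poly_mapping_eqI)
  fix i
  have "(\<Sum>j\<in>J. (lookup x j when j = i)) = (if i \<in> J then lookup x i else 0)"
    using assms(1) by (simp add: when_def)
  also have "\<dots> = lookup x i" using assms(2) by (auto simp: in_keys_iff)
  finally show "lookup x i = lookup (\<Sum>j\<in>J. single j (lookup x j)) i"
    by (simp add: lookup_sum lookup_single)
qed

lemma in_span_unitvecs:
  assumes "finite J" "keys x \<subseteq> J"
  shows "x \<in> qv.span (unitvecs J)"
proof -
  have "single j (lookup x j) = qscale (lookup x j) (single j 1)" for j
    by (rule poly_mapping_eqI) (simp add: lookup_single when_def)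
  then have "x = (\<Sum>j\<in>J. qscale (lookup x j) (single j 1))"
    using sum_single_keys[OF assms] by simp
  then show ?thesis
    by (metis (no_types, lifting) image_eqI qv.span_base qv.span_scale qv.span_sum unitvecs_def)
qed

lemma keys_span_unitvecs:
  assumes "x \<in> qv.span (unitvecs J)"
  shows "keys x \<subseteq> J"
  using assms
proof (induction rule: qv.span_induct_alt)
  case (step c x y)
  then obtain j where "j \<in> J" "x = single j 1" by (auto simp: unitvecs_def)
  moreover have "keys (qscale c x) \<subseteq> keys x" by (auto simp: in_keys_iff)
  ultimately have "keys (qscale c x) \<subseteq> J" by auto
  then show ?case using step keys_add[of "qscale c x" y] by blast
qed simp

lemma independent_unitvecs:
  assumes "finite J"
  shows "qv.independent (unitvecs J)"
  unfolding unitvecs_def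
proof (rule qv_family_independent(2)[OF assms], intro allI impI)
  fix c :: "'a \<Rightarrow> rat"
  assume s: "(\<Sum>k\<in>J. qscale (c k) (single k 1)) = 0"
  have "lookup (\<Sum>k\<in>J. qscale (c k) (single k 1)) j = c j" if "j \<in> J" for j
    using that assms by (simp add: lookup_sum lookup_single when_def if_distrib[of "\<lambda>x. _ * x"] cong: if_cong)
  then show "\<forall>k\<in>J. c k = 0" unfolding s by auto
qed

lemma keys_ratvec_diff: "keys (ratvec u - ratvec v) \<subseteq> keys u \<union> keys v"
  by (auto simp: in_keys_iff lookup_minus)

lemma relspace_keys: "x \<in> relspace J a \<Longrightarrow> keys x \<subseteq> J"
proof -
  assume "x \<in> relspace J a"
  then obtain u v where "x = ratvec u - ratvec v" "keys u \<subseteq> J" "keys v \<subseteq> J"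
    by (auto simp: relspace_def)
  then show ?thesis using keys_ratvec_diff[of u v] by blast
qed

lemma relspace_span_unitvecs: "finite J \<Longrightarrow> relspace J a \<subseteq> qv.span (unitvecs J)"
  by (meson in_span_unitvecs relspace_keys subsetI)

lemma relspace_basis:
  assumes "finite J"
  obtains B where "B \<subseteq> relspace J a" "qv.independent B" "finite B" "card B = relrank J a"
    "qv.span B = qv.span (relspace J a)"
proof -
  obtain B where B: "B \<subseteq> relspace J a" "qv.independent B" "relspace J a \<subseteq> qv.span B" "card B = relrank J a"
    using qv.basis_exists unfolding relrank_def by metis
  have "B \<subseteq> qv.span (unitvecs J)" using B(1) relspace_span_unitvecs[OF assms, of a] by (rule order_trans)
  then have "finite B" using qv.independent_span_bound[OF unitvecs_fin[OF assms] B(2)] by blast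
  moreover have "qv.span B = qv.span (relspace J a)"
    using B by (metis qv.span_mono qv.span_minimal qv.subspace_span subset_antisym)
  ultimately show thesis using that B by blast
qed

lemma relspace_add: "x \<in> relspace J a \<Longrightarrow> y \<in> relspace J a \<Longrightarrow> x + y \<in> relspace J a"
proof -
  assume "x \<in> relspace J a" "y \<in> relspace J a"
  then obtain u v u' v' where "x = ratvec u - ratvec v" "y = ratvec u' - ratvec v'"
    and k: "keys u \<subseteq> J" "keys v \<subseteq> J" "keys u' \<subseteq> J" "keys v' \<subseteq> J"
      "xdeg J a u = xdeg J a v" "xdeg J a u' = xdeg J a v'"
    by (auto simp: relspace_def)
  then have "x + y = ratvec (u + u') - ratvec (v + v')" by (simp add: ratvec_add)
  moreover have "keys (u + u') \<subseteq> J" "keys (v + v') \<subseteq> J"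
    using keys_add[of u u'] keys_add[of v v'] k by blast+
  moreover have "xdeg J a (u + u') = xdeg J a (v + v')" using k by (simp add: xdeg_add)
  ultimately show ?thesis unfolding relspace_def by blast
qed

lemma relspaceI:
  "keys u \<subseteq> J \<Longrightarrow> keys v \<subseteq> J \<Longrightarrow> xdeg J a u = xdeg J a v \<Longrightarrow>
    ratvec u - ratvec v \<in> relspace J a"
  unfolding relspace_def by blast

lemma relspace_uminus: "x \<in> relspace J a \<Longrightarrow> - x \<in> relspace J a"
proof -
  assume "x \<in> relspace J a"
  then obtain u v where "x = ratvec u - ratvec v" "keys u \<subseteq> J" "keys v \<subseteq> J"
    "xdeg J a u = xdeg J a v" by (auto simp: relspace_def)
  then show ?thesis using relspaceI[of v J u a] by simp
qed

lemma relspace_0: "0 \<in> relspace J a"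
  unfolding relspace_def by (intro CollectI exI[of _ 0]) simp

lemma relspace_int_scale: "x \<in> relspace J a \<Longrightarrow> qscale (of_int n) x \<in> relspace J a"
proof -
  assume x: "x \<in> relspace J a"
  have nat: "qscale (of_nat n) x \<in> relspace J a" for n
  proof (induction n)
    case (Suc n)
    have "qscale (of_nat (Suc n)) x = x + qscale (of_nat n) x" by (simp add: qv.scale_left_distrib)
    then show ?case using relspace_add[OF x Suc.IH] by simp
  qed (simp add: relspace_0)
  show ?thesis
  proof (cases n)
    case (nonneg k)
    then show ?thesis using nat by simp
  next
    case (neg k)
    then have "(of_int n :: rat) = - of_nat (Suc k)" by simp
    then have "qscale (of_int n) x = - qscale (of_nat (Suc k)) x" by (simp only: qv.scale_minus_left)
    then show ?thesis using relspace_uminus[OF nat] by metis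
  qed
qed

lemma rat_clear_denominator: "\<exists>N>0. \<exists>d. of_int N * (c::rat) = of_int d"
proof -
  obtain n d where "quotient_of c = (n, d)" by (cases "quotient_of c")
  then have "c = of_int n / of_int d" "d > 0" using quotient_of_div quotient_of_denom_pos by auto
  then have "of_int d * c = of_int n" by simp
  then show ?thesis using \<open>d > 0\<close> by blast
qed

lemma relspace_span_clear:
  assumes "x \<in> qv.span (relspace J a)"
  shows "\<exists>N>0. qscale (of_int N) x \<in> relspace J a"
  using assms
proof (induction rule: qv.span_induct_alt)
  case base
  then show ?case by (intro exI[of _ 1]) (simp add: relspace_0)
next
  case (step c x y)
  then obtain N where N: "N > 0" "qscale (of_int N) y \<in> relspace J a" by blast
  obtain M d where M: "M > 0" "of_int M * c = of_int d" using rat_clear_denominator by blast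
  have "qscale (of_int (M * N)) (qscale c x + y) = qscale (of_int (d * N)) x + qscale (of_int M) (qscale (of_int N) y)"
    using M(2) by (simp add: qv.scale_right_distrib mult.commute mult.left_commute)
  also have "\<dots> \<in> relspace J a"
    by (intro relspace_add relspace_int_scale N step)
  finally show ?case using M(1) N(1) by (intro exI[of _ "M * N"]) simp
qed

text \<open>Truncated subtraction in both directions cancels the common part of two exponent vectors.\<close>

lemma ratvec_diff: "ratvec (u - v) - ratvec (v - u) = ratvec u - ratvec v"
  by (rule poly_mapping_eqI) (simp add: lookup_minus of_nat_diff)

text \<open>The representatives are the positive and the negative part of \<open>x\<close>.
  Cancelling the common part of two exponent vectors preserves equality of degrees because these
  live in a group.\<close>

lemma relspace_reduced:
  assumes "x \<in> relspace J a"
  obtains u v where "x = ratvec u - ratvec v" "keys u \<subseteq> J" "keys v \<subseteq> J"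
    "xdeg J a u = xdeg J a v"
    "\<And>i. lookup u i > 0 \<longleftrightarrow> lookup x i > 0"
    "\<And>i. lookup v i > 0 \<longleftrightarrow> lookup x i < 0"
proof -
  obtain u v where uv: "x = ratvec u - ratvec v" "keys u \<subseteq> J" "keys v \<subseteq> J" "xdeg J a u = xdeg J a v"
    using assms by (auto simp: relspace_def)
  have "zdeg J a (\<lambda>i. int (lookup (u - v) i) - int (lookup (v - u) i))
      = zdeg J a (\<lambda>i. int (lookup u i) - int (lookup v i))"
    by (rule zdeg_cong) (auto simp: lookup_minus)
  then have "xdeg J a (u - v) = xdeg J a (v - u)"
    using uv(4) unfolding zdeg_diff xdeg_def by simp
  moreover have "x = ratvec (u - v) - ratvec (v - u)" by (simp add: ratvec_diff uv)
  moreover have "keys (u - v) \<subseteq> keys u" "keys (v - u) \<subseteq> keys v"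
    by (auto simp: in_keys_iff lookup_minus)
  moreover have "lookup (u - v) i > 0 \<longleftrightarrow> lookup x i > 0"
    "lookup (v - u) i > 0 \<longleftrightarrow> lookup x i < 0" for i
    by (auto simp: uv(1) lookup_minus)
  ultimately show thesis using that[of "u - v" "v - u"] uv by blast
qed

text \<open>A common denominator turns a rational dependence into an integral one. So the relation
  vectors are linearly independent in a space of dimension \<open>relrank J a\<close>.\<close>

lemma independent_relations_card_le_relrank:
  assumes fin: "finite J" and pr: "presents J a K p q" and ind: "independent_relations K p q"
  shows "card K \<le> relrank J a"
proof -
  have finK: "finite K" using presentsD[OF pr] by blast
  let ?v = "\<lambda>k. ratvec (p k) - ratvec (q k)"
  have "\<forall>k\<in>K. c k = 0" if s: "(\<Sum>k\<in>K. qscale (c k) (?v k)) = 0" for c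
  proof -
    have "\<exists>N>0. \<forall>k\<in>K. \<exists>d. of_int N * c k = of_int d"
      using finK
    proof (induction K rule: finite_induct)
      case (insert k K)
      then obtain N where N: "N > 0" "\<forall>k\<in>K. \<exists>d. of_int N * c k = of_int d" by blast
      obtain M d where M: "M > 0" "of_int M * c k = of_int d" using rat_clear_denominator by blast
      have "\<exists>d. of_int (M * N) * c l = of_int d" if l: "l \<in> insert k K" for l
      proof (cases "l = k")
        case True
        then have "of_int (M * N) * c l = of_int (N * d)" using M(2) by (simp add: mult.commute mult.left_commute)
        then show ?thesis by blast
      next
        case False
        then obtain e where "of_int N * c l = of_int e" using N(2) l by blast
        then have "of_int (M * N) * c l = of_int (M * e)" by (simp add: mult.assoc)
        then show ?thesis by blast
      qed
      then show ?case using N M by (intro exI[of _ "M * N"]) simp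
    qed (auto intro: exI[of _ 1])
    then obtain N where N: "N > 0" "\<forall>k\<in>K. \<exists>d. of_int N * c k = of_int d" by blast
    then obtain d where d: "\<And>k. k \<in> K \<Longrightarrow> of_int N * c k = of_int (d k)" by metis
    have "(\<Sum>k\<in>K. d k * (int (lookup (p k) i) - int (lookup (q k) i))) = 0" for i
    proof -
      have "of_int (\<Sum>k\<in>K. d k * (int (lookup (p k) i) - int (lookup (q k) i)))
          = (\<Sum>k\<in>K. of_int N * (c k * lookup (?v k) i))"
        unfolding of_int_sum by (rule sum.cong) (auto simp: d[symmetric] lookup_minus)
      also have "\<dots> = of_int N * lookup (\<Sum>k\<in>K. qscale (c k) (?v k)) i"
        by (simp add: sum_distrib_left lookup_sum)
      finally have "of_int (\<Sum>k\<in>K. d k * (int (lookup (p k) i) - int (lookup (q k) i))) = (0::rat)"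
        unfolding s by (simp only: lookup_zero mult_zero_right)
      then show ?thesis by (simp only: of_int_eq_0_iff)
    qed
    then have "\<forall>k\<in>K. d k = 0" using ind unfolding independent_relations_def by blast
    then show ?thesis using d N(1) by force
  qed
  then have "\<forall>c. (\<Sum>k\<in>K. qscale (c k) (?v k)) = 0 \<longrightarrow> (\<forall>k\<in>K. c k = 0)" by blast
  note fi = qv_family_independent[OF finK this]
  obtain B where B: "finite B" "card B = relrank J a" "qv.span B = qv.span (relspace J a)"
    using relspace_basis[OF fin, of a] by metis
  have "?v ` K \<subseteq> relspace J a" 
  proof (rule image_subsetI)
    fix k assume "k \<in> K"
    then show "?v k \<in> relspace J a" using presentsD(2-4)[OF pr] by (intro relspaceI) auto
  qed
  then have "?v ` K \<subseteq> qv.span B" unfolding B(3) by (meson order_trans qv.span_superset)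
  then have "card (?v ` K) \<le> card B" by (rule qv.independent_span_bound[OF B(1) fi(2), THEN conjunct2])
  then show ?thesis unfolding card_image[OF fi(1)] B(2) .
qed

text \<open>Dropping the coordinates at the zero generators leaves a relation of the other
  generators; what is dropped is a combination of the corresponding unit vectors.\<close>

lemma relrank_nonzero_part:
  assumes fin: "finite I" and J: "J \<subseteq> I" and z: "\<And>i. i \<in> I - J \<Longrightarrow> a i = 0"
  shows "relrank I a \<le> relrank J a + card (I - J)"
proof -
  have finJ: "finite J" using fin J by (rule finite_subset[rotated])
  obtain B where B: "finite B" "card B = relrank J a" "qv.span B = qv.span (relspace J a)"
    using relspace_basis[OF finJ, of a] by metis
  have xJ: "xdeg I a u = xdeg J a (except (I - J) u)" for u
  proof -
    have "xdeg I a u = zdeg J a (\<lambda>i. int (lookup u i))"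
      unfolding xdeg_def zdeg_def by (rule sum.mono_neutral_right) (use fin J z in auto)
    also have "\<dots> = xdeg J a (except (I - J) u)" unfolding xdeg_def by (rule zdeg_cong) simp
    finally show ?thesis .
  qed
  have "relspace I a \<subseteq> qv.span (B \<union> unitvecs (I - J))"
  proof
    fix x assume "x \<in> relspace I a"
    then obtain u v where uv: "x = ratvec u - ratvec v" "keys u \<subseteq> I" "keys v \<subseteq> I" "xdeg I a u = xdeg I a v"
      by (auto simp: relspace_def)
    let ?y = "ratvec (except (I - J) u) - ratvec (except (I - J) v)"
    have "?y \<in> relspace J a" by (rule relspaceI) (use uv xJ in \<open>auto simp: keys_except\<close>)
    then have 1: "?y \<in> qv.span B" unfolding B(3) by (rule qv.span_base)
    have "lookup (x - ?y) i = 0" if "i \<notin> I - J" for i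
    proof (cases "i \<in> I")
      case False
      then have "i \<notin> keys u" "i \<notin> keys v" using uv by auto
      then show ?thesis by (simp add: uv(1) lookup_minus in_keys_iff)
    qed (use that in \<open>simp add: uv(1) lookup_minus\<close>)
    then have "x - ?y \<in> qv.span (unitvecs (I - J))"
      using fin by (intro in_span_unitvecs) (auto simp: in_keys_iff)
    with 1 have "?y + (x - ?y) \<in> qv.span (B \<union> unitvecs (I - J))"
      unfolding qv.span_Un by blast
    then show "x \<in> qv.span (B \<union> unitvecs (I - J))" by simp
  qed
  then have "relrank I a \<le> card (B \<union> unitvecs (I - J))"
    unfolding relrank_def using B(1) fin by (intro qv.dim_le_card) (auto simp: unitvecs_fin)
  also have "\<dots> \<le> relrank J a + card (I - J)"
    using card_Un_le[of B "unitvecs (I - J)"] B(2) by (simp add: card_unitvecs)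
  finally show ?thesis .
qed

text \<open>A dimension count: the span of the relations and the coordinate subspace of
  \<open>U\<close> have dimensions with sum above \<open>card J\<close>, so they meet outside 0. The
  resulting binomial keeps the variables of \<open>U\<close> from being algebraically independent
  modulo any prime over the ideal.\<close>

lemma relation_in_large_subset:
  assumes fin: "finite J" and U: "U \<subseteq> J" "card J < card U + relrank J a"
  obtains u v where "keys u \<subseteq> U" "keys v \<subseteq> U" "u \<noteq> v" "xdeg J a u = xdeg J a v"
proof -
  have finU: "finite U" using fin U by (metis finite_subset)
  obtain B where B: "B \<subseteq> relspace J a" "qv.independent B" "finite B" "card B = relrank J a" "qv.span B = qv.span (relspace J a)"
    using relspace_basis[OF fin, of a] by metis
  have "\<not> qv.span B \<inter> qv.span (unitvecs U) \<subseteq> {0}"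
  proof
    assume tr: "qv.span B \<inter> qv.span (unitvecs U) \<subseteq> {0}"
    have "qv.independent (B \<union> unitvecs U)"
      by (rule qv_independent_Un[OF unitvecs_fin[OF finU] B(2) independent_unitvecs[OF finU] tr])
    moreover have "B \<union> unitvecs U \<subseteq> qv.span (unitvecs J)"
    proof -
      have "unitvecs U \<subseteq> unitvecs J" using U by (auto simp: unitvecs_def)
      then show ?thesis
        using B(1) relspace_span_unitvecs[OF fin, of a] qv.span_superset[of "unitvecs J"] by blast
    qed
    ultimately have "card (B \<union> unitvecs U) \<le> card J"
      using qv.independent_span_bound[OF unitvecs_fin[OF fin]] card_unitvecs by metis
    moreover have "B \<inter> unitvecs U = {}"
    proof (rule ccontr)
      assume "B \<inter> unitvecs U \<noteq> {}"
      then obtain x where x: "x \<in> B" "x \<in> unitvecs U" by blast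
      then have "x = 0" using tr qv.span_base by blast
      then show False using x B(2) qv.dependent_zero by blast
    qed
    ultimately show False
      using U(2) B(3,4) by (simp add: card_Un_disjoint unitvecs_fin finU card_unitvecs)
  qed
  then obtain x where x: "x \<in> qv.span (relspace J a)" "x \<in> qv.span (unitvecs U)" "x \<noteq> 0" using B(5) by blast
  obtain N where N: "N > 0" "qscale (of_int N) x \<in> relspace J a" using relspace_span_clear[OF x(1)] by blast
  define y where "y = qscale (of_int N) x"
  obtain u v where uv: "y = ratvec u - ratvec v" "keys u \<subseteq> J" "keys v \<subseteq> J"
    "xdeg J a u = xdeg J a v"
    "\<And>i. lookup u i > 0 \<longleftrightarrow> lookup y i > 0"
    "\<And>i. lookup v i > 0 \<longleftrightarrow> lookup y i < 0"
    using relspace_reduced[OF N(2)] unfolding y_def by metis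
  have yU: "keys y \<subseteq> U"
    using keys_span_unitvecs[OF x(2)] by (auto simp: y_def in_keys_iff subset_iff)
  have ku: "i \<in> keys y" if "i \<in> keys u \<or> i \<in> keys v" for i
    using that uv(5,6)[of i] by (auto simp: in_keys_iff)
  have "y \<noteq> 0" using x(3) N(1) by (simp add: y_def)
  then have "u \<noteq> v" using uv(1) by auto
  then show thesis using that[of u v] ku yU uv(4) by blast
qed

text \<open>A basis of the relations is extended by unit vectors to a basis of the whole space. The
  unit vectors that were added span a complement, so a relation supported on their indices
  \<open>U\<close> vanishes.\<close>

lemma complement_of_relations:
  assumes fin: "finite J"
  obtains U where "U \<subseteq> J" "card U + relrank J a = card J"
    "\<And>u v. keys u \<subseteq> U \<Longrightarrow> keys v \<subseteq> U \<Longrightarrow> xdeg J a u = xdeg J a v \<Longrightarrow> u = v"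
proof -
  obtain B where B: "B \<subseteq> relspace J a" "qv.independent B" "finite B" "card B = relrank J a" "qv.span B = qv.span (relspace J a)"
    using relspace_basis[OF fin, of a] by metis
  obtain B' where B': "B \<subseteq> B'" "B' \<subseteq> B \<union> unitvecs J" "qv.independent B'" "B \<union> unitvecs J \<subseteq> qv.span B'"
    using qv.maximal_independent_subset_extend[of B "B \<union> unitvecs J"] B(2) by auto
  have finB': "finite B'" using B'(2) B(3) unitvecs_fin[OF fin] by (meson finite_UnI finite_subset)
  have "B \<union> unitvecs J \<subseteq> qv.span (unitvecs J)"
    using B(1) relspace_span_unitvecs[OF fin, of a] qv.span_superset[of "unitvecs J"] by blast
  then have "card B' \<le> card J"
    using qv.independent_span_bound[OF unitvecs_fin[OF fin] B'(3)] B'(2) card_unitvecs by (metis subset_trans)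
  moreover have "card J \<le> card B'"
    using qv.independent_span_bound[OF finB' independent_unitvecs[OF fin]] B'(4) card_unitvecs by (metis le_sup_iff)
  ultimately have cB': "card B' = card J" by simp
  define U where "U = {j \<in> J. single j 1 \<in> B' - B}"
  have eU: "unitvecs U = B' - B" using B'(2) by (auto simp: unitvecs_def U_def)
  have "card U = card B' - card B"
    using card_unitvecs[of U] card_Diff_subset[OF B(3) B'(1)] unfolding eU by simp
  moreover have "card B \<le> card B'" using B'(1) finB' by (rule card_mono[rotated])
  ultimately have c: "card U + relrank J a = card J" using cB' B(4) by simp
  have finU: "finite U" "U \<subseteq> J" using fin by (auto simp: U_def)
  have "u = v" if k: "keys u \<subseteq> U" "keys v \<subseteq> U" and d: "xdeg J a u = xdeg J a v" for u v
  proof (rule ccontr)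
    assume ne: "u \<noteq> v"
    define x where "x = ratvec u - ratvec v"
    have "x \<in> relspace J a" unfolding x_def by (rule relspaceI) (use k d finU in auto)
    then have xB: "x \<in> qv.span B" unfolding B(5) by (rule qv.span_base)
    obtain i where i: "lookup u i \<noteq> lookup v i" using ne by (metis poly_mapping_eqI)
    then have xi: "lookup x i \<noteq> 0" by (simp add: x_def lookup_minus)
    have kx: "keys x \<subseteq> U"
      using k keys_ratvec_diff[of u v] unfolding x_def by blast
    then have iU: "i \<in> U" using xi by (auto simp: in_keys_iff)
    let ?e = "single i (1::rat)"
    let ?y = "x - qscale (lookup x i) ?e"
    have "lookup ?y i = 0" by (simp add: lookup_minus)
    moreover have "lookup ?y j = lookup x j" if "j \<noteq> i" for j
      using that by (simp add: lookup_minus lookup_single)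
    ultimately have "keys ?y \<subseteq> U - {i}" using kx by (auto simp: in_keys_iff) (metis in_keys_iff subsetD)
    then have y: "?y \<in> qv.span (unitvecs (U - {i}))" using finU by (intro in_span_unitvecs) auto
    have sub: "unitvecs (U - {i}) \<subseteq> B' - {?e}"
    proof -
      have "unitvecs (U - {i}) \<subseteq> B'" using eU by (auto simp: unitvecs_def)
      moreover have "?e \<notin> unitvecs (U - {i})"
        using inj_single[of "1::rat"] by (auto simp: unitvecs_def poly_mapping_eq_iff lookup_single fun_eq_iff when_def split: if_splits)
      ultimately show ?thesis by blast
    qed
    have eB: "?e \<in> B' - B" using iU eU by (auto simp: unitvecs_def)
    have "x \<in> qv.span (B' - {?e})" using xB qv.span_mono[of B "B' - {?e}"] B'(1) eB by blast
    moreover have "?y \<in> qv.span (B' - {?e})" using y qv.span_mono[OF sub] by blast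
    ultimately have "x - ?y \<in> qv.span (B' - {?e})" by (rule qv.span_diff)
    then have "qscale (lookup x i) ?e \<in> qv.span (B' - {?e})" by simp
    then have "qscale (inverse (lookup x i)) (qscale (lookup x i) ?e) \<in> qv.span (B' - {?e})"
      by (rule qv.span_scale)
    then have "?e \<in> qv.span (B' - {?e})" using xi by simp
    then show False using B'(3) eB unfolding qv.dependent_def by blast
  qed
  then show thesis using that[OF finU(2) c] by blast
qed

section \<open>What a congruence path says about its end points\<close>

lemma pcong_span:
  assumes "pcong K p q u v"
  shows "ratvec u - ratvec v \<in> qv.span ((\<lambda>k. ratvec (p k) - ratvec (q k)) ` K)"
  using assms
proof (induction rule: pcong.induct)
  case (base k z)
  then show ?case by (auto simp: ratvec_add intro!: qv.span_base)
next
  case (refl u)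
  then show ?case by (simp add: qv.span_zero)
next
  case (sym u v)
  then show ?case using qv.span_neg by fastforce
next
  case (trans u v w)
  then show ?case using qv.span_add by fastforce
qed

text \<open>Integer coefficients matter: gluing asks for an equality of subgroups, not of their
  rational spans.\<close>

lemma pcong_int_combination:
  assumes "pcong K p q u v" "finite K"
  shows "\<exists>c. \<forall>i. int (lookup u i) - int (lookup v i) =
    (\<Sum>k\<in>K. c k * (int (lookup (p k) i) - int (lookup (q k) i)))"
  using assms(1)
proof (induction rule: pcong.induct)
  case (base k z)
  have "(\<Sum>l\<in>K. (if l = k then 1 else 0) * (int (lookup (p l) i) - int (lookup (q l) i)))
     = int (lookup (p k) i) - int (lookup (q k) i)" for i
    using base assms(2) by (simp add: if_distrib[of "\<lambda>x. x * _"] cong: if_cong)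
  then show ?case by (intro exI[of _ "\<lambda>l. if l = k then 1 else 0"]) (simp add: lookup_add)
next
  case (refl u)
  then show ?case by (intro exI[of _ "\<lambda>_. 0"]) simp
next
  case (sym u v)
  then obtain c where c: "\<forall>i. int (lookup u i) - int (lookup v i) =
    (\<Sum>k\<in>K. c k * (int (lookup (p k) i) - int (lookup (q k) i)))" by blast
  have "int (lookup v i) - int (lookup u i) =
    (\<Sum>k\<in>K. (- c k) * (int (lookup (p k) i) - int (lookup (q k) i)))" for i
  proof -
    have "int (lookup v i) - int (lookup u i) = - (int (lookup u i) - int (lookup v i))" by simp
    then show ?thesis unfolding c[rule_format] by (simp add: sum_negf[symmetric])
  qed
  then show ?case by (intro exI[of _ "\<lambda>k. - c k"]) blast
next
  case (trans u v w)
  then obtain c d where c: "\<forall>i. int (lookup u i) - int (lookup v i) =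
    (\<Sum>k\<in>K. c k * (int (lookup (p k) i) - int (lookup (q k) i)))"
    "\<forall>i. int (lookup v i) - int (lookup w i) =
    (\<Sum>k\<in>K. d k * (int (lookup (p k) i) - int (lookup (q k) i)))" by blast
  have "int (lookup u i) - int (lookup w i) =
    (\<Sum>k\<in>K. (c k + d k) * (int (lookup (p k) i) - int (lookup (q k) i)))" for i
  proof -
    have "int (lookup u i) - int (lookup w i) =
      (int (lookup u i) - int (lookup v i)) + (int (lookup v i) - int (lookup w i))" by simp
    then show ?thesis unfolding c[rule_format] by (simp add: sum.distrib[symmetric] distrib_right)
  qed
  then show ?case by (intro exI[of _ "\<lambda>k. c k + d k"]) blast
qed


text \<open>A step by a relation outside \<open>T\<close> leads from a vector meeting
  \<open>C\<close> to a vector meeting \<open>C\<close>, and a step by a relation in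
  \<open>T\<close> does not change the coordinates in \<open>C\<close>. So a path starting off
  \<open>C\<close> stays off \<open>C\<close> and uses relations in \<open>T\<close> only.\<close>

lemma pcong_support:
  assumes "pcong K p q u v"
    and T: "\<And>k. k \<in> K - T \<Longrightarrow> keys (p k) \<inter> C \<noteq> {} \<and> keys (q k) \<inter> C \<noteq> {}"
      "\<And>k i. k \<in> T \<Longrightarrow> i \<in> C \<Longrightarrow> lookup (p k) i = lookup (q k) i"
  shows "(keys u \<inter> C = {} \<longleftrightarrow> keys v \<inter> C = {}) \<and>
    (keys u \<inter> C = {} \<longrightarrow> ratvec u - ratvec v \<in> qv.span ((\<lambda>k. ratvec (p k) - ratvec (q k)) ` T))"
  using assms(1)
proof (induction rule: pcong.induct)
  case (base k z)
  have ks: "keys (z + x) = keys z \<union> keys x" for x :: "'b \<Rightarrow>\<^sub>0 nat"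
    by (auto simp: in_keys_iff lookup_add)
  show ?case
  proof (cases "k \<in> T")
    case True
    have "keys (p k) \<inter> C = keys (q k) \<inter> C"
      using T(2)[OF True] by (auto simp: in_keys_iff)
    moreover have "ratvec (z + p k) - ratvec (z + q k) \<in> qv.span ((\<lambda>k. ratvec (p k) - ratvec (q k)) ` T)"
      using True by (auto simp: ratvec_add intro!: qv.span_base)
    ultimately show ?thesis unfolding ks Int_Un_distrib2 by simp
  next
    case False
    then have "k \<in> K - T" using base by simp
    from T(1)[OF this] show ?thesis unfolding ks Int_Un_distrib2 by simp
  qed
next
  case (refl u)
  then show ?case by (simp add: qv.span_zero)
next
  case (sym u v)
  then show ?case using qv.span_neg by fastforce
next
  case (trans u v w)
  then show ?case using qv.span_add by fastforce
qed

lemma linear_except: "Vector_Spaces.linear qscale qscale (except C)"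
  by (rule qv_linearI) (auto intro!: poly_mapping_eqI simp: lookup_add)

text \<open>The Krull-height argument in combinatorial form: if at least as many rows as columns were mixed
  on a set of columns, then either a relation avoiding these columns would be a combination of mixed rows,
  or some column would be, up to a multiple, congruent to a vector avoiding all of them.\<close>

theorem presents_mixed_dominating:
  fixes a :: "'i \<Rightarrow> 'g::ab_group_add"
  assumes fin: "finite J" and inv: "no_invertibles (nspan (a ` J))" and nz: "\<And>j. j \<in> J \<Longrightarrow> a j \<noteq> 0"
    and pr: "presents J a K p q" and ne: "\<And>k. k \<in> K \<Longrightarrow> p k \<noteq> q k" and card: "card K \<le> relrank J a"
  shows "mixed_dominating J K (\<lambda>k. {i. lookup (q k) i < lookup (p k) i})
    (\<lambda>k. {i. lookup (p k) i < lookup (q k) i})"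
proof -
  define P where "P k = {i. lookup (q k) i < lookup (p k) i}" for k
  define N where "N k = {i. lookup (p k) i < lookup (q k) i}" for k
  note PR = presentsD[OF pr]
  have finK: "finite K" by (rule PR(1))
  have kz: "lookup (p k) i = 0 \<and> lookup (q k) i = 0" if "k \<in> K" "i \<notin> J" for k i
    using PR(2,3)[OF that(1)] that(2) by (metis in_keys_iff subsetD)
  have PN: "P k \<union> N k \<subseteq> J" if "k \<in> K" for k
  proof
    fix i assume "i \<in> P k \<union> N k"
    then show "i \<in> J" using kz[OF that, of i] by (cases "i \<in> J") (auto simp: P_def N_def)
  qed
  have one: False if uv: "keys u \<subseteq> J" "keys v \<subseteq> J" "xdeg J a u = xdeg J a v" "u \<noteq> v"
      "\<And>i. lookup v i \<le> lookup u i" for u v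
  proof -
    have eq: "u = v + (u - v)" by (rule poly_mapping_eqI) (simp add: lookup_add lookup_minus uv(5))
    have "xdeg J a (u - v) = 0" using arg_cong[OF eq, of "xdeg J a"] uv(3) by (simp add: xdeg_add)
    moreover have "keys (u - v) \<subseteq> keys u" by (auto simp: in_keys_iff lookup_minus)
    ultimately have "u - v = 0" using xdeg_eq_0D[OF fin inv nz, of "u - v"] uv(1) by (meson order_trans)
    then show False using eq uv(4) by simp
  qed
  have Pne: "P k \<noteq> {}" if "k \<in> K" for k
  proof
    assume "P k = {}"
    then show False using one[of "q k" "p k"] PR(2-4)[OF that] ne[OF that] by (force simp: P_def not_less)
  qed
  have Nne: "N k \<noteq> {}" if "k \<in> K" for k
  proof
    assume "N k = {}"
    then show False using one[of "p k" "q k"] PR(2-4)[OF that] ne[OF that] by (force simp: N_def not_less)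
  qed
  let ?v = "\<lambda>k. ratvec (p k) - ratvec (q k)"
  have vR: "?v k \<in> relspace J a" if "k \<in> K" for k using PR(2-4)[OF that] by (rule relspaceI)
  have span: "qv.span (?v ` K) = qv.span (relspace J a)"
  proof
    show "qv.span (?v ` K) \<subseteq> qv.span (relspace J a)" using vR by (intro qv.span_mono) auto
    have "relspace J a \<subseteq> qv.span (?v ` K)"
    proof
      fix x assume "x \<in> relspace J a"
      then obtain u v where uv: "x = ratvec u - ratvec v" "keys u \<subseteq> J" "keys v \<subseteq> J" "xdeg J a u = xdeg J a v"
        by (auto simp: relspace_def)
      from pcong_span[OF PR(5)[OF uv(2-4)]] show "x \<in> qv.span (?v ` K)" unfolding uv(1) .
    qed
    then show "qv.span (relspace J a) \<subseteq> qv.span (?v ` K)" by (simp add: qv.span_minimal)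
  qed
  have dim: "qv.dim (qv.span (?v ` K)) = relrank J a" unfolding span relrank_def by simp
  have "card (?v ` K) \<le> qv.dim (qv.span (?v ` K))"
    unfolding dim using card card_image_le[OF finK, of ?v] by simp
  then have ind: "qv.independent (?v ` K)" using finK by (intro qv_spanning_independent) auto
  have "relrank J a = card (?v ` K)" using qv.dim_span_eq_card_independent[OF ind] dim by simp
  then have inj: "inj_on ?v K" using card card_image_le[OF finK, of ?v] finK by (simp add: eq_card_imp_inj_on)
  have bad: "card (mixed_rows K P N C) < card C" if "C \<subseteq> J" "C \<noteq> {}" for C
  proof (rule ccontr)
    assume nC: "\<not> ?thesis"
    define bad where "bad D \<longleftrightarrow> D \<subseteq> J \<and> D \<noteq> {} \<and> card D \<le> card (mixed_rows K P N D)" for D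
    have "bad C" using that nC by (simp add: bad_def)
    moreover have "card D \<le> card J" if "bad D" for D using that fin by (auto simp: bad_def intro: card_mono)
    ultimately obtain D where D: "bad D" and max: "\<And>D'. bad D' \<Longrightarrow> card D' \<le> card D"
      using ex_has_greatest_nat[of bad C card "card J + 1"] by (metis less_Suc_eq_le Suc_eq_plus1)
    have DJ: "D \<subseteq> J" "D \<noteq> {}" "card D \<le> card (mixed_rows K P N D)" using D by (auto simp: bad_def)
    have finD: "finite D" using DJ(1) fin by (rule finite_subset)
    define M where "M = mixed_rows K P N D"
    define T where "T = K - M"
    have MK: "M \<subseteq> K" "finite M" using finK by (auto simp: M_def mixed_rows_def)
    \<comment> \<open>A row that is not mixed but has an entry in \<open>D\<close> becomes mixed
      when a column \<open>c\<close> of the missing sign is added. With one more column and one more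
      mixed row, \<open>insert c D\<close> would violate dominance too, against the maximality of
      \<open>D\<close>.\<close>
    have zero: "lookup (p k) i = lookup (q k) i" if k: "k \<in> T" and i: "i \<in> D" for k i
    proof (rule ccontr)
      assume "lookup (p k) i \<noteq> lookup (q k) i"
      then have iPN: "i \<in> P k \<union> N k" by (auto simp: P_def N_def)
      have kK: "k \<in> K" "k \<notin> M" using k by (auto simp: T_def)
      then have "P k \<inter> D = {} \<or> N k \<inter> D = {}" by (auto simp: M_def mixed_rows_def)
      then obtain c where c: "c \<in> P k \<union> N k" "c \<notin> D" "P k \<inter> insert c D \<noteq> {}" "N k \<inter> insert c D \<noteq> {}"
        using iPN i Pne[OF kK(1)] Nne[OF kK(1)] by blast
      have "insert k M \<subseteq> mixed_rows K P N (insert c D)"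
        using c(3,4) kK(1) unfolding M_def mixed_rows_def by blast
      then have "card (insert k M) \<le> card (mixed_rows K P N (insert c D))"
        using mixed_rows_fin[OF finK] by (meson card_mono)
      then have "card (insert c D) \<le> card (mixed_rows K P N (insert c D))"
        using kK(2) MK(2) finD c(2) DJ(3) by (simp add: M_def)
      moreover have "c \<in> J" using c(1) PN[OF kK(1)] by blast
      ultimately have "bad (insert c D)" using DJ by (simp add: bad_def)
      from max[OF this] show False using finD c(2) by simp
    qed
    have mix: "keys (p k) \<inter> D \<noteq> {} \<and> keys (q k) \<inter> D \<noteq> {}" if "k \<in> K - T" for k
    proof -
      have "P k \<inter> D \<noteq> {}" "N k \<inter> D \<noteq> {}" using that by (auto simp: T_def M_def mixed_rows_def)
      moreover have "P k \<subseteq> keys (p k)" "N k \<subseteq> keys (q k)"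
        by (auto simp: P_def N_def in_keys_iff)
      ultimately show ?thesis by blast
    qed
    note supp = pcong_support[OF _ mix zero]
    let ?\<pi> = "except (- D)"
    show False
    proof (cases "\<exists>c. (\<Sum>k\<in>M. qscale (c k) (?\<pi> (?v k))) = 0 \<and> (\<exists>k\<in>M. c k \<noteq> 0)")
      case True
      then obtain c k0 where c: "(\<Sum>k\<in>M. qscale (c k) (?\<pi> (?v k))) = 0" "k0 \<in> M" "c k0 \<noteq> 0" by blast
      define x where "x = (\<Sum>k\<in>M. qscale (c k) (?v k))"
      have xD: "lookup x i = 0" if "i \<in> D" for i
        using arg_cong[OF c(1), of "\<lambda>y. lookup y i"] that by (simp add: x_def lookup_sum)
      have "x \<in> qv.span (relspace J a)"
        unfolding x_def using vR MK by (intro qv.span_sum qv.span_scale qv.span_base) auto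
      then obtain n where n: "n > 0" "qscale (of_int n) x \<in> relspace J a" using relspace_span_clear by blast
      define y where "y = qscale (of_int n) x"
      obtain u v where uv: "y = ratvec u - ratvec v" "keys u \<subseteq> J" "keys v \<subseteq> J"
        "xdeg J a u = xdeg J a v"
        "\<And>i. lookup u i > 0 \<longleftrightarrow> lookup y i > 0"
        "\<And>i. lookup v i > 0 \<longleftrightarrow> lookup y i < 0"
        using relspace_reduced[OF n(2)] unfolding y_def by metis
      have "lookup y i = 0" if "i \<in> D" for i using xD[OF that] by (simp add: y_def)
      then have "keys u \<inter> D = {}" using uv(5) by (force simp: in_keys_iff)
      then have "y \<in> qv.span (?v ` T)" unfolding uv(1) using supp[OF PR(5)[OF uv(2-4)]] by blast
      then have "qscale (inverse (of_int n)) y \<in> qv.span (?v ` T)" by (rule qv.span_scale)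
      then have xT: "x \<in> qv.span (?v ` T)" using n(1) by (simp add: y_def)
      have T0: "?v ` T \<subseteq> ?v ` K - {?v k0}"
        using inj c(2) MK(1) by (auto simp: T_def inj_on_def)
      have M0: "?v ` (M - {k0}) \<subseteq> ?v ` K - {?v k0}"
        using inj c(2) MK(1) by (auto simp: inj_on_def)
      have "qscale (c k0) (?v k0) = x - (\<Sum>k\<in>M - {k0}. qscale (c k) (?v k))"
        unfolding x_def using sum.remove[OF MK(2) c(2), of "\<lambda>k. qscale (c k) (?v k)"] by simp
      also have "\<dots> \<in> qv.span (?v ` K - {?v k0})"
      proof (rule qv.span_diff)
        show "x \<in> qv.span (?v ` K - {?v k0})" using xT qv.span_mono[OF T0] by blast
        show "(\<Sum>k\<in>M - {k0}. qscale (c k) (?v k)) \<in> qv.span (?v ` K - {?v k0})"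
          using M0 by (intro qv.span_sum qv.span_scale qv.span_base) auto
      qed
      finally have "qscale (inverse (c k0)) (qscale (c k0) (?v k0)) \<in> qv.span (?v ` K - {?v k0})"
        by (rule qv.span_scale)
      then have "?v k0 \<in> qv.span (?v ` K - {?v k0})" using c(3) by simp
      then show False using ind c(2) MK(1) unfolding qv.dependent_def by blast
    next
      case False
      then have "\<forall>c. (\<Sum>k\<in>M. qscale (c k) (?\<pi> (?v k))) = 0 \<longrightarrow> (\<forall>k\<in>M. c k = 0)" by blast
      note fi = qv_family_independent[OF MK(2) this]
      let ?S = "(\<lambda>k. ?\<pi> (?v k)) ` M"
      obtain c0 where c0: "c0 \<in> D" using DJ(2) by blast
      let ?e = "single c0 (1::rat)"
      have Su: "?S \<subseteq> qv.span (unitvecs D)"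
      proof (rule image_subsetI)
        fix k
        show "?\<pi> (?v k) \<in> qv.span (unitvecs D)" by (rule in_span_unitvecs[OF finD]) (simp add: keys_except)
      qed
      \<comment> \<open>There are at least \<open>card D\<close> mixed rows and their projections to
        \<open>D\<close> are independent, so these span all coordinates of \<open>D\<close>.\<close>
      have eS: "?e \<in> qv.span ?S"
      proof (rule ccontr)
        assume "?e \<notin> qv.span ?S"
        then have "qv.independent (insert ?e ?S)" using fi(2) by (rule qv.independent_insertI)
        moreover have "insert ?e ?S \<subseteq> qv.span (unitvecs D)"
          using Su c0 by (auto simp: unitvecs_def intro: qv.span_base)
        ultimately have "card (insert ?e ?S) \<le> card D"
          using qv.independent_span_bound[OF unitvecs_fin[OF finD]] card_unitvecs by metis
        moreover have "?e \<notin> ?S" using \<open>?e \<notin> qv.span ?S\<close> by (metis qv.span_base)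
        ultimately show False using MK(2) card_image[OF fi(1)] DJ(3) by (simp add: M_def)
      qed
      interpret lin: Vector_Spaces.linear qscale qscale "?\<pi> :: ('i \<Rightarrow>\<^sub>0 rat) \<Rightarrow> ('i \<Rightarrow>\<^sub>0 rat)" by (rule linear_except)
      have "?S = ?\<pi> ` (?v ` M)" by (simp add: image_image)
      then have "?e \<in> ?\<pi> ` qv.span (?v ` M)" using eS lin.span_image[of "?v ` M"] by simp
      then obtain x where "?e = ?\<pi> x" and xM: "x \<in> qv.span (?v ` M)" by (rule imageE)
      then have xe: "?\<pi> x = ?e" by simp
      have "?v ` M \<subseteq> relspace J a" using vR MK by auto
      then have "x \<in> qv.span (relspace J a)" using xM by (meson qv.span_mono subsetD)
      then obtain n where n: "n > 0" "qscale (of_int n) x \<in> relspace J a" using relspace_span_clear by blast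
      define y where "y = qscale (of_int n) x"
      obtain u v where uv: "y = ratvec u - ratvec v" "keys u \<subseteq> J" "keys v \<subseteq> J"
        "xdeg J a u = xdeg J a v"
        "\<And>i. lookup u i > 0 \<longleftrightarrow> lookup y i > 0"
        "\<And>i. lookup v i > 0 \<longleftrightarrow> lookup y i < 0"
        using relspace_reduced[OF n(2)] unfolding y_def by metis
      have xl: "lookup x i = (if i = c0 then 1 else 0)" if "i \<in> D" for i
        using arg_cong[OF xe, of "\<lambda>z. lookup z i"] that by (simp add: lookup_single when_def eq_commute)
      have "keys v \<inter> D = {}"
      proof -
        have "i \<notin> keys v" if "i \<in> D" for i
          using uv(6)[of i] xl[OF that] n(1) by (auto simp: y_def in_keys_iff split: if_splits)
        then show ?thesis by blast
      qed
      moreover have "c0 \<in> keys u"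
        using uv(5)[of c0] xl[OF c0] n(1) by (auto simp: y_def in_keys_iff)
      ultimately show False using supp[OF PR(5)[OF uv(2-4)]] c0 by blast
    qed
  qed
  have "mixed_dominating J K P N"
    unfolding mixed_dominating_def using fin finK Pne Nne PN bad by blast
  then show ?thesis unfolding P_def N_def .
qed

text \<open>Positive and negative part turn an arbitrary integer relation into two exponent vectors
  of equal degree; the path between them writes the relation as an integer combination of the given
  ones.\<close>

theorem presents_completely_glued:
  fixes a :: "nat \<Rightarrow> 'g::ab_group_add" and K :: "nat set"
  assumes fin: "finite J" and inv: "no_invertibles (nspan (a ` J))" and nz: "\<And>j. j \<in> J \<Longrightarrow> a j \<noteq> 0"
    and pr: "presents J a K p q" and ne: "\<And>k. k \<in> K \<Longrightarrow> p k \<noteq> q k" and card: "card K \<le> relrank J a"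
  shows "completely_glued (nspan (a ` J))"
proof -
  define \<alpha> where "\<alpha> k i = int (lookup (p k) i) - int (lookup (q k) i)" for k i
  note PR = presentsD[OF pr]
  show ?thesis
  proof (rule mixed_dominating_completely_glued[OF inv nz])
    show "zdeg J a (\<alpha> k) = 0" if "k \<in> K" for k
      unfolding \<alpha>_def zdeg_diff using PR(4)[OF that] by (simp add: xdeg_def)
    have "{i. 0 < \<alpha> k i} = {i. lookup (q k) i < lookup (p k) i}"
      "{i. \<alpha> k i < 0} = {i. lookup (p k) i < lookup (q k) i}" for k
      by (auto simp: \<alpha>_def)
    then show "mixed_dominating J K (\<lambda>k. {i. 0 < \<alpha> k i}) (\<lambda>k. {i. \<alpha> k i < 0})"
      using presents_mixed_dominating[OF fin inv nz pr ne card] by simp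
    show "\<exists>c. \<forall>i\<in>J. f i = (\<Sum>k\<in>K. c k * \<alpha> k i)" if f: "zdeg J a f = 0" for f
    proof -
      define u where "u = Abs_poly_mapping (\<lambda>i. if i \<in> J then nat (f i) else 0)"
      define v where "v = Abs_poly_mapping (\<lambda>i. if i \<in> J then nat (- f i) else 0)"
      have u: "lookup u i = (if i \<in> J then nat (f i) else 0)" for i
        unfolding u_def by (subst lookup_Abs_poly_mapping) (auto intro: finite_subset[OF _ fin])
      have v: "lookup v i = (if i \<in> J then nat (- f i) else 0)" for i
        unfolding v_def by (subst lookup_Abs_poly_mapping) (auto intro: finite_subset[OF _ fin])
      have k: "keys u \<subseteq> J" "keys v \<subseteq> J" by (auto simp: in_keys_iff u v split: if_splits)
      have "zdeg J a (\<lambda>i. int (lookup u i) - int (lookup v i)) = zdeg J a f"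
        by (rule zdeg_cong) (simp add: u v)
      then have "xdeg J a u = xdeg J a v" using f by (simp add: zdeg_diff xdeg_def)
      from pcong_int_combination[OF PR(5)[OF k this] PR(1)]
      obtain c where c: "\<And>i. int (lookup u i) - int (lookup v i) = (\<Sum>k\<in>K. c k * \<alpha> k i)"
        unfolding \<alpha>_def by blast
      have "f i = (\<Sum>k\<in>K. c k * \<alpha> k i)" if "i \<in> J" for i unfolding c[symmetric] using that by (simp add: u v)
      then show ?thesis by blast
    qed
  qed
qed

section \<open>Lattice ideals\<close>

type_synonym rpoly = "(nat \<Rightarrow>\<^sub>0 nat) \<Rightarrow>\<^sub>0 rat"

abbreviation mon :: "(nat \<Rightarrow>\<^sub>0 nat) \<Rightarrow> rpoly"
  where "mon u \<equiv> single u 1"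

text \<open>Arbitrary sets of variables are allowed, since the height is found by comparing primes
  with the subrings \<open>polys U\<close>.\<close>

definition polys :: "nat set \<Rightarrow> rpoly set"
  where "polys V = {p. \<forall>u\<in>keys p. keys u \<subseteq> V}"

lemma poly_ring_simps [simp]:
  "carrier (poly_ring m) = polys {..<m}" "mult (poly_ring m) = (*)" "one (poly_ring m) = 1"
  "zero (poly_ring m) = 0" "add (poly_ring m) = (+)"
  by (simp_all add: poly_ring_def polys_def)

lemma polys_mono: "V \<subseteq> W \<Longrightarrow> polys V \<subseteq> polys W"
  by (auto simp: polys_def)

lemma polys_0 [simp]: "0 \<in> polys V" and polys_1 [simp]: "1 \<in> polys V"
  by (simp_all add: polys_def)

lemma polys_add: "p \<in> polys V \<Longrightarrow> q \<in> polys V \<Longrightarrow> p + q \<in> polys V"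
  using Poly_Mapping.keys_add[of p q] unfolding polys_def by blast

lemma polys_uminus: "p \<in> polys V \<Longrightarrow> - p \<in> polys V"
  by (simp add: polys_def)

lemma polys_diff: "p \<in> polys V \<Longrightarrow> q \<in> polys V \<Longrightarrow> p - q \<in> polys V"
  using polys_add[of p V "- q"] polys_uminus[of q V] by simp

lemma polys_single: "keys u \<subseteq> V \<Longrightarrow> single u c \<in> polys V"
  by (simp add: polys_def)

lemma polys_mult: "p \<in> polys V \<Longrightarrow> q \<in> polys V \<Longrightarrow> p * q \<in> polys V"
proof -
  assume pq: "p \<in> polys V" "q \<in> polys V"
  show ?thesis unfolding polys_def
  proof (intro CollectI ballI)
    fix u assume "u \<in> keys (p * q)"
    then obtain s t where st: "s \<in> keys p" "t \<in> keys q" "u = s + t"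
      using Poly_Mapping.keys_mult[of p q] by blast
    then have "keys s \<union> keys t \<subseteq> V" using pq unfolding polys_def by blast
    then show "keys u \<subseteq> V" using Poly_Mapping.keys_add[of s t] st(3) by blast
  qed
qed

lemma qscale_mult: "qscale c p = single 0 c * (p :: 'm::monoid_add \<Rightarrow>\<^sub>0 rat)"
  unfolding qscale_def by (rule mult_map_scale_conv_mult)

lemma qscale_single: "qscale c (single u d) = single u (c * d)"
  by (rule poly_mapping_eqI) (simp add: lookup_single when_def)

lemma qscale_mult_left: "qscale c p * q = qscale c (p * (q :: rpoly))"
  by (simp add: qscale_mult mult.assoc)

lemma qscale_mult_right: "p * qscale c q = qscale c (p * (q :: rpoly))"
  by (simp add: qscale_mult mult.left_commute)

lemma mon_mult: "mon u * mon v = mon (u + v)"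
  by (simp add: mult_single)

lemma polys_qscale: "p \<in> polys V \<Longrightarrow> qscale c p \<in> polys V"
  unfolding qscale_mult by (intro polys_mult polys_single) auto

lemma polys_sum: "(\<And>i. i \<in> I \<Longrightarrow> f i \<in> polys V) \<Longrightarrow> sum f I \<in> polys V"
  by (induction I rule: infinite_finite_induct) (auto intro: polys_add)

lemma poly_expansion: "p = (\<Sum>u\<in>keys p. qscale (lookup p u) (mon u))"
  using sum_single_keys[of "keys p" p] by (simp add: qscale_single)

lemma poly_idealI:
  assumes "C \<subseteq> polys {..<m}" "0 \<in> C" "\<And>x y. x \<in> C \<Longrightarrow> y \<in> C \<Longrightarrow> x + y \<in> C"
    and mult: "\<And>r x. r \<in> polys {..<m} \<Longrightarrow> x \<in> C \<Longrightarrow> r * x \<in> C"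
  shows "ideal C (poly_ring m)"
proof -
  interpret R: cring "poly_ring m" by (rule cring_poly_ring)
  have neg: "- x \<in> C" if "x \<in> C" for x
    using mult[of "- 1" x] that polys_uminus[of 1 "{..<m}"] by simp
  show ?thesis
  proof (rule idealI[OF R.ring_axioms])
    show "subgroup C (add_monoid (poly_ring m))"
    proof (rule group.subgroupI[OF R.a_group])
      show "C \<subseteq> carrier (add_monoid (poly_ring m))" using assms(1) by simp
      show "C \<noteq> {}" using assms(2) by blast
      fix x assume x: "x \<in> C"
      then have xc: "x \<in> carrier (poly_ring m)" using assms(1) by auto
      have "\<ominus>\<^bsub>poly_ring m\<^esub> x = - x"
        using R.minus_equality[of "- x" x] xc polys_uminus by simp
      then show "inv\<^bsub>add_monoid (poly_ring m)\<^esub> x \<in> C" using neg[OF x] by (simp add: a_inv_def)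
    qed (use assms in auto)
  next
    fix a x assume "a \<in> C" "x \<in> carrier (poly_ring m)"
    then show "x \<otimes>\<^bsub>poly_ring m\<^esub> a \<in> C" "a \<otimes>\<^bsub>poly_ring m\<^esub> x \<in> C"
      using mult[of x a] by (simp_all add: mult.commute)
  qed
qed

lemma poly_idealD:
  assumes "ideal C (poly_ring m)"
  shows "C \<subseteq> polys {..<m}" "0 \<in> C" "x \<in> C \<Longrightarrow> y \<in> C \<Longrightarrow> x + y \<in> C"
    "r \<in> polys {..<m} \<Longrightarrow> x \<in> C \<Longrightarrow> r * x \<in> C"
proof -
  interpret I: ideal C "poly_ring m" by fact
  show "C \<subseteq> polys {..<m}" using I.a_subset by simp
  show "0 \<in> C" using additive_subgroup.zero_closed[OF I.additive_subgroup_axioms] by simp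
  show "x + y \<in> C" if "x \<in> C" "y \<in> C" using additive_subgroup.a_closed[OF I.additive_subgroup_axioms, of x y] that by simp
  show "r * x \<in> C" if "r \<in> polys {..<m}" "x \<in> C" using I.I_l_closed that by simp
qed

lemma poly_ideal_subspace:
  assumes "ideal C (poly_ring m)"
  shows "qv.subspace C"
proof (rule qv.subspaceI)
  fix c x assume "x \<in> C"
  then show "qscale c x \<in> C" unfolding qscale_mult by (intro poly_idealD(4)[OF assms] polys_single) auto
qed (use poly_idealD[OF assms] in auto)

lemma genideal_least:
  assumes "ideal C (poly_ring m)" "B \<subseteq> C"
  shows "genideal (poly_ring m) B \<subseteq> C"
  using assms unfolding genideal_def by blast

lemma genideal_facts:
  assumes "B \<subseteq> polys {..<m}"
  shows "ideal (genideal (poly_ring m) B) (poly_ring m)" "B \<subseteq> genideal (poly_ring m) B"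
proof -
  interpret R: cring "poly_ring m" by (rule cring_poly_ring)
  show "ideal (genideal (poly_ring m) B) (poly_ring m)" using R.genideal_ideal assms by simp
  show "B \<subseteq> genideal (poly_ring m) B" using R.genideal_self assms by simp
qed

text \<open>Unlike in the generators of \<open>lattice_ideal\<close>, the two monomials may have a
  common factor. This makes the set closed under multiplication by monomials, so its linear span is
  already an ideal.\<close>

definition binomials :: "nat \<Rightarrow> (nat \<Rightarrow> 'g::ab_group_add) \<Rightarrow> rpoly set"
  where "binomials m a = {mon u - mon v | u v.
    keys u \<subseteq> {..<m} \<and> keys v \<subseteq> {..<m} \<and> xdeg {..<m} a u = xdeg {..<m} a v}"

lemma binomials_polys: "binomials m a \<subseteq> polys {..<m}"
  by (auto simp: binomials_def intro!: polys_diff polys_single)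

lemma subspace_polys: "qv.subspace (polys V)"
  by (rule qv.subspaceI) (auto intro: polys_add polys_qscale)

lemma span_binomials_ideal: "ideal (qv.span (binomials m a)) (poly_ring m)"
proof (rule poly_idealI)
  show "qv.span (binomials m a) \<subseteq> polys {..<m}"
    by (rule qv.span_minimal[OF binomials_polys subspace_polys])
  fix r x assume r: "r \<in> polys {..<m}" and x: "x \<in> qv.span (binomials m a)"
  from x show "r * x \<in> qv.span (binomials m a)"
  proof (induction rule: qv.span_induct_alt)
    case base
    then show ?case by (simp add: qv.span_zero)
  next
    case (step c x y)
    then obtain u v where uv: "x = mon u - mon v" "keys u \<subseteq> {..<m}" "keys v \<subseteq> {..<m}"
      "xdeg {..<m} a u = xdeg {..<m} a v" by (auto simp: binomials_def)
    have "mon w * x \<in> binomials m a" if "w \<in> keys r" for w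
    proof -
      have "keys w \<subseteq> {..<m}" using r that by (simp add: polys_def)
      then have "keys (w + u) \<subseteq> {..<m}" "keys (w + v) \<subseteq> {..<m}"
        using uv(2,3) keys_add[of w u] keys_add[of w v] by blast+
      moreover have "mon w * x = mon (w + u) - mon (w + v)"
        unfolding uv(1) by (simp add: right_diff_distrib mon_mult)
      moreover have "xdeg {..<m} a (w + u) = xdeg {..<m} a (w + v)" using uv(4) by (simp add: xdeg_add)
      ultimately show ?thesis unfolding binomials_def by blast
    qed
    moreover have "r * x = (\<Sum>w\<in>keys r. qscale (lookup r w) (mon w * x))"
      by (subst poly_expansion[of r]) (simp add: sum_distrib_right qscale_mult_left)
    ultimately have "r * x \<in> qv.span (binomials m a)"
      by (metis (no_types, lifting) qv.span_base qv.span_scale qv.span_sum)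
    then show ?case
      unfolding distrib_left qscale_mult_right by (intro qv.span_add qv.span_scale step)
  qed
qed (auto intro: qv.span_zero qv.span_add)

lemma lookup_pos_part [simp]: "lookup (pos_part \<alpha>) i = nat (lookup \<alpha> i)"
  by (simp add: pos_part_def Poly_Mapping.map.rep_eq when_def)

lemma lookup_neg_part [simp]: "lookup (neg_part \<alpha>) i = nat (- lookup \<alpha> i)"
  by (simp add: neg_part_def)

text \<open>A member of \<open>binomials m a\<close> is the product of its common monomial factor
  and the reduced binomial of the difference of its exponents.\<close>

lemma lattice_ideal_span: "lattice_ideal m (relation_lattice m a) = qv.span (binomials m a)"
proof
  let ?L = "relation_lattice m a"
  let ?G = "{mon (pos_part \<alpha>) - mon (neg_part \<alpha>) | \<alpha>. \<alpha> \<in> ?L}"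
  have GB: "?G \<subseteq> binomials m a"
  proof
    fix x assume "x \<in> ?G"
    then obtain \<alpha> where \<alpha>: "x = mon (pos_part \<alpha>) - mon (neg_part \<alpha>)" "keys \<alpha> \<subseteq> {..<m}"
      "zdeg {..<m} a (lookup \<alpha>) = 0" by (auto simp: relation_lattice_def zdeg_def)
    have "keys (pos_part \<alpha>) \<subseteq> keys \<alpha>" "keys (neg_part \<alpha>) \<subseteq> keys \<alpha>"
      by (auto simp: in_keys_iff)
    moreover have "zdeg {..<m} a (\<lambda>i. int (lookup (pos_part \<alpha>) i) - int (lookup (neg_part \<alpha>) i))
        = zdeg {..<m} a (lookup \<alpha>)" by (rule zdeg_cong) simp
    then have "xdeg {..<m} a (pos_part \<alpha>) = xdeg {..<m} a (neg_part \<alpha>)"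
      using \<alpha>(3) unfolding zdeg_diff xdeg_def by simp
    ultimately show "x \<in> binomials m a" using \<alpha> unfolding binomials_def by blast
  qed
  then have "?G \<subseteq> qv.span (binomials m a)" by (meson order_trans qv.span_superset)
  then show "lattice_ideal m ?L \<subseteq> qv.span (binomials m a)"
    unfolding lattice_ideal_def by (rule genideal_least[OF span_binomials_ideal])
  have "?G \<subseteq> polys {..<m}" using GB binomials_polys by (rule order_trans)
  note gi = genideal_facts[OF this, folded lattice_ideal_def]
  have "binomials m a \<subseteq> lattice_ideal m ?L"
  proof
    fix x assume "x \<in> binomials m a"
    then obtain u v where uv: "x = mon u - mon v" "keys u \<subseteq> {..<m}" "keys v \<subseteq> {..<m}"
      "xdeg {..<m} a u = xdeg {..<m} a v" by (auto simp: binomials_def)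
    define \<alpha> where "\<alpha> = Poly_Mapping.map int u - Poly_Mapping.map int v"
    have l\<alpha>: "lookup \<alpha> i = int (lookup u i) - int (lookup v i)" for i
      by (simp add: \<alpha>_def lookup_minus Poly_Mapping.map.rep_eq when_def)
    have "keys \<alpha> \<subseteq> keys u \<union> keys v"
      by (auto simp: in_keys_iff l\<alpha>)
    moreover have "zdeg {..<m} a (lookup \<alpha>) = zdeg {..<m} a (\<lambda>i. int (lookup u i) - int (lookup v i))"
      by (rule zdeg_cong) (simp add: l\<alpha>)
    then have "zdeg {..<m} a (lookup \<alpha>) = 0"
      using uv(4) unfolding zdeg_diff xdeg_def by simp
    ultimately have "\<alpha> \<in> ?L" using uv(2,3) unfolding relation_lattice_def zdeg_def by blast
    then have g: "mon (pos_part \<alpha>) - mon (neg_part \<alpha>) \<in> lattice_ideal m ?L" using gi(2) by blast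
    have pn: "pos_part \<alpha> = u - v" "neg_part \<alpha> = v - u"
      by (rule poly_mapping_eqI, simp add: l\<alpha> lookup_minus)+
    \<comment> \<open>With truncated subtraction this is the componentwise minimum of
      \<open>u\<close> and \<open>v\<close>.\<close>
    let ?w = "u - (u - v)"
    have w: "?w + (u - v) = u" "?w + (v - u) = v"
      by (rule poly_mapping_eqI, simp add: lookup_add lookup_minus)+
    have "keys ?w \<subseteq> keys u" by (auto simp: in_keys_iff lookup_minus)
    then have "mon ?w \<in> polys {..<m}" using uv(2) by (intro polys_single) simp
    from poly_idealD(4)[OF gi(1) this g] show "x \<in> lattice_ideal m ?L"
      unfolding pn right_diff_distrib mon_mult w uv(1) .
  qed
  then show "qv.span (binomials m a) \<subseteq> lattice_ideal m ?L"
    by (rule qv.span_minimal[OF _ poly_ideal_subspace[OF gi(1)]])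
qed

section \<open>Linear maps on the ideal and the number of generators\<close>

definition linext :: "('a \<Rightarrow> 'b \<Rightarrow>\<^sub>0 rat) \<Rightarrow> ('a \<Rightarrow>\<^sub>0 rat) \<Rightarrow> ('b \<Rightarrow>\<^sub>0 rat)"
  where "linext h f = (\<Sum>u\<in>keys f. qscale (lookup f u) (h u))"

lemma linext_superset:
  "finite A \<Longrightarrow> keys f \<subseteq> A \<Longrightarrow> linext h f = (\<Sum>u\<in>A. qscale (lookup f u) (h u))"
  unfolding linext_def by (rule sum.mono_neutral_left) (auto simp: in_keys_iff)

lemma linext_add: "linext h (f + g) = linext h f + linext h g"
proof -
  let ?A = "keys f \<union> keys g"
  have "linext h (f + g) = (\<Sum>u\<in>?A. qscale (lookup (f + g) u) (h u))"
    by (rule linext_superset) (simp_all add: keys_add)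
  also have "\<dots> = (\<Sum>u\<in>?A. qscale (lookup f u) (h u)) + (\<Sum>u\<in>?A. qscale (lookup g u) (h u))"
    by (simp add: lookup_add qv.scale_left_distrib sum.distrib)
  also have "\<dots> = linext h f + linext h g"
    by (simp add: linext_superset[of ?A])
  finally show ?thesis .
qed

lemma linext_qscale: "linext h (qscale c f) = qscale c (linext h f)"
proof -
  have "linext h (qscale c f) = (\<Sum>u\<in>keys f. qscale (lookup (qscale c f) u) (h u))"
    by (rule linext_superset) (auto simp: in_keys_iff)
  then show ?thesis by (simp add: linext_def qv.scale_sum_right)
qed

lemma linext_mon [simp]: "linext h (single u 1) = h u"
  by (simp add: linext_def)

lemma linext_diff: "linext h (f - g) = linext h f - linext h g"
  using linext_add[of h "f - g" g] by simp

lemma linext_sum: "linext h (sum f A) = (\<Sum>x\<in>A. linext h (f x))"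
  by (induction A rule: infinite_finite_induct) (simp_all add: linext_add, simp_all add: linext_def)

text \<open>\<open>\<chi>\<close> plays the role of the evaluation of monomials at a point: on the
  ideal I, multiplication by a monomial \<open>w\<close> acts on the values of
  \<open>linext h\<close> as the scalar \<open>\<chi> w\<close>. The map thus factors through I
  modulo M I, where M is the maximal ideal of the point, and this quotient is spanned by the classes
  of any generating set.\<close>

lemma linext_ideal_in_span:
  fixes h :: "(nat \<Rightarrow>\<^sub>0 nat) \<Rightarrow> 'b \<Rightarrow>\<^sub>0 rat"
  assumes B: "B \<subseteq> polys {..<m}" "genideal (poly_ring m) B = qv.span (binomials m a)"
    and \<chi>: "\<And>u v w. keys u \<subseteq> {..<m} \<Longrightarrow> keys v \<subseteq> {..<m} \<Longrightarrow>
      xdeg {..<m} a u = xdeg {..<m} a v \<Longrightarrow> keys w \<subseteq> {..<m} \<Longrightarrow>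
      h (w + u) - h (w + v) = qscale (\<chi> w) (h u - h v)"
  shows "linext h ` qv.span (binomials m a) \<subseteq> qv.span (linext h ` B)"
proof -
  let ?I = "qv.span (binomials m a)"
  note I = poly_idealD[OF span_binomials_ideal[of m a]]
  have mon: "linext h (mon w * f) = qscale (\<chi> w) (linext h f)"
    if "f \<in> ?I" and w: "keys w \<subseteq> {..<m}" for f w
    using that(1)
  proof (induction rule: qv.span_induct_alt)
    case base
    then show ?case by (simp add: linext_def)
  next
    case (step c x y)
    then obtain u v where "x = mon u - mon v" "keys u \<subseteq> {..<m}" "keys v \<subseteq> {..<m}"
      "xdeg {..<m} a u = xdeg {..<m} a v" by (auto simp: binomials_def)
    then have "linext h (mon w * x) = qscale (\<chi> w) (linext h x)"
      by (simp add: right_diff_distrib mon_mult linext_diff \<chi> w)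
    then show ?case using step
      by (simp add: distrib_left linext_add qscale_mult_right linext_qscale qv.scale_right_distrib mult.commute[of c])
  qed
  let ?C = "{f \<in> ?I. linext h f \<in> qv.span (linext h ` B)}"
  have "ideal ?C (poly_ring m)"
  proof (rule poly_idealI)
    show "?C \<subseteq> polys {..<m}" using I(1) by blast
    show "0 \<in> ?C" by (simp add: qv.span_zero linext_def)
    show "x + y \<in> ?C" if "x \<in> ?C" "y \<in> ?C" for x y
      using that by (auto simp: linext_add intro: qv.span_add)
    show "r * x \<in> ?C" if r: "r \<in> polys {..<m}" and x: "x \<in> ?C" for r x
    proof -
      have "r * x = (\<Sum>w\<in>keys r. qscale (lookup r w) (mon w * x))"
        by (subst poly_expansion[of r]) (simp add: sum_distrib_right qscale_mult_left)
      then have "linext h (r * x) = (\<Sum>w\<in>keys r. qscale (lookup r w) (qscale (\<chi> w) (linext h x)))"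
        using mon x r by (simp add: linext_sum linext_qscale polys_def)
      also have "\<dots> \<in> qv.span (linext h ` B)" using x by (intro qv.span_sum qv.span_scale) auto
      finally show ?thesis using I(4)[OF r, of x] x by simp
    qed
  qed
  moreover have "B \<subseteq> ?C" using genideal_facts(2)[OF B(1)] B(2) qv.span_superset[of "linext h ` B"] by auto
  ultimately have "genideal (poly_ring m) B \<subseteq> ?C" by (rule genideal_least)
  then show ?thesis unfolding B(2) by blast
qed

text \<open>The gradient of a monomial at (1,...,1) is its exponent vector, so the gradients of the
  binomials are exactly the vectors of the relation lattice; every monomial has the value 1 there,
  whence the constant \<open>\<chi>\<close>.\<close>

lemma relrank_le_card_generators:
  assumes "finite B" "B \<subseteq> polys {..<m}" "genideal (poly_ring m) B = qv.span (binomials m a)"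
  shows "relrank {..<m} a \<le> card B"
proof -
  have "relspace {..<m} a \<subseteq> linext ratvec ` qv.span (binomials m a)"
  proof
    fix x assume "x \<in> relspace {..<m} a"
    then obtain u v where uv: "x = ratvec u - ratvec v" "mon u - mon v \<in> binomials m a"
      unfolding relspace_def binomials_def by blast
    then have "x = linext ratvec (mon u - mon v)" by (simp add: linext_diff)
    then show "x \<in> linext ratvec ` qv.span (binomials m a)" using uv(2) by (metis image_eqI qv.span_base)
  qed
  also have "\<dots> \<subseteq> qv.span (linext ratvec ` B)"
    by (rule linext_ideal_in_span[OF assms(2,3), where \<chi> = "\<lambda>_. 1"]) (simp add: ratvec_add)
  finally have "relrank {..<m} a \<le> card (linext ratvec ` B)"
    unfolding relrank_def using assms(1) by (intro qv.dim_le_card) auto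
  also have "\<dots> \<le> card B" using assms(1) by (rule card_image_le)
  finally show ?thesis .
qed

text \<open>Along a congruence path the binomial of the end points is a telescoping sum of monomial
  multiples of generators. The claim also records that a path starting in the variables below
  \<open>m\<close> stays there, which the definition of \<open>pcong\<close> does not
  enforce.\<close>

lemma presents_generates:
  assumes pr: "presents {..<m} a K p q"
  shows "genideal (poly_ring m) ((\<lambda>k. mon (p k) - mon (q k)) ` K) = qv.span (binomials m a)"
proof
  let ?B = "(\<lambda>k. mon (p k) - mon (q k)) ` K"
  note PR = presentsD[OF pr]
  have "?B \<subseteq> binomials m a" using PR(2-4) unfolding binomials_def by blast
  then have "?B \<subseteq> qv.span (binomials m a)" and Bp: "?B \<subseteq> polys {..<m}"
    using qv.span_superset[of "binomials m a"] binomials_polys[of m a] by (meson order_trans)+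
  then show "genideal (poly_ring m) ?B \<subseteq> qv.span (binomials m a)"
    by (intro genideal_least span_binomials_ideal)
  note gi = genideal_facts[OF Bp]
  let ?G = "genideal (poly_ring m) ?B"
  have sub: "qv.subspace ?G" by (rule poly_ideal_subspace[OF gi(1)])
  have ks: "keys (z + x) = keys z \<union> keys x" for x z :: "nat \<Rightarrow>\<^sub>0 nat"
    by (auto simp: in_keys_iff lookup_add)
  have "(keys u \<subseteq> {..<m} \<longleftrightarrow> keys v \<subseteq> {..<m}) \<and>
      (keys u \<subseteq> {..<m} \<longrightarrow> mon u - mon v \<in> ?G)" if "pcong K p q u v" for u v
    using that
  proof (induction rule: pcong.induct)
    case (base k z)
    have "mon z * (mon (p k) - mon (q k)) \<in> ?G" if "keys z \<subseteq> {..<m}"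
      using base gi(2) by (intro poly_idealD(4)[OF gi(1)] polys_single that) auto
    then show ?case using PR(2,3)[OF base] by (simp add: ks right_diff_distrib mon_mult)
  next
    case (refl u)
    then show ?case using poly_idealD(2)[OF gi(1)] by simp
  next
    case (sym u v)
    then show ?case using qv.subspace_neg[OF sub, of "mon u - mon v"] by auto
  next
    case (trans u v w)
    then show ?case using qv.subspace_add[OF sub, of "mon u - mon v" "mon v - mon w"] by auto
  qed
  then have "binomials m a \<subseteq> ?G" using PR(5) unfolding binomials_def by blast
  then show "qv.span (binomials m a) \<subseteq> ?G" by (rule qv.span_minimal[OF _ sub])
qed

section \<open>From generators of the ideal to presentations\<close>

text \<open>A monotone subsequence exists; if it decreases, it is constant from the place on where
  its minimum is attained.\<close>

lemma nat_seq_incseq_subseq: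
  fixes s :: "nat \<Rightarrow> nat"
  obtains r where "strict_mono r" "incseq (s \<circ> r)"
proof -
  obtain f where f: "strict_mono f" "monoseq (\<lambda>n. s (f n))" using seq_monosub by blast
  show thesis
  proof (cases "incseq (\<lambda>n. s (f n))")
    case True
    then show ?thesis using that[OF f(1)] by (simp add: comp_def)
  next
    case False
    then have dec: "decseq (\<lambda>n. s (f n))" using f(2) by (simp add: monoseq_iff)
    define k where "k = (LEAST x. x \<in> range (\<lambda>n. s (f n)))"
    have "k \<in> range (\<lambda>n. s (f n))" unfolding k_def by (rule LeastI[of _ "s (f 0)"]) simp
    then obtain n0 where n0: "k = s (f n0)" by blast
    have "s (f (n0 + n)) = k" for n
    proof (rule antisym)
      show "s (f (n0 + n)) \<le> k" unfolding n0 using dec by (rule decseqD) simp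
      show "k \<le> s (f (n0 + n))" unfolding k_def by (rule Least_le) simp
    qed
    then have "incseq (s \<circ> (\<lambda>n. f (n0 + n)))" by (simp add: incseq_def)
    moreover have "strict_mono (\<lambda>n. f (n0 + n))" using f(1) by (simp add: strict_mono_def)
    ultimately show ?thesis using that by blast
  qed
qed

text \<open>Dickson's lemma in sequence form, obtained by thinning out for one coordinate after
  another.\<close>

lemma dickson_subseq:
  fixes f :: "nat \<Rightarrow> 'i \<Rightarrow>\<^sub>0 nat"
  assumes "finite J"
  obtains r where "strict_mono r" "\<And>i. i \<in> J \<Longrightarrow> incseq (\<lambda>n. lookup (f (r n)) i)"
proof -
  have "\<exists>r. strict_mono r \<and> (\<forall>i\<in>J. incseq (\<lambda>n. lookup (f (r n)) i))"
    using assms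
  proof (induction J rule: finite_induct)
    case empty
    have "strict_mono (\<lambda>n::nat. n)" by (simp add: strict_mono_def)
    then show ?case by blast
  next
    case (insert j J)
    then obtain r where r: "strict_mono r" "\<forall>i\<in>J. incseq (\<lambda>n. lookup (f (r n)) i)" by blast
    obtain r' where r': "strict_mono r'" "incseq ((\<lambda>n. lookup (f (r n)) j) \<circ> r')"
      by (rule nat_seq_incseq_subseq)
    have "strict_mono (\<lambda>n. r (r' n))" using r(1) r'(1) by (simp add: strict_mono_def)
    moreover have "incseq (\<lambda>n. lookup (f (r (r' n))) i)" if "i \<in> insert j J" for i
    proof (cases "i = j")
      case True
      then show ?thesis using r'(2) by (simp add: comp_def)
    next
      case False
      then have "incseq (\<lambda>n. lookup (f (r n)) i)" using r(2) that by blast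
      then show ?thesis using strict_mono_mono[OF r'(1)] by (simp add: incseq_def mono_def)
    qed
    ultimately show ?case by blast
  qed
  then show thesis using that by blast
qed

text \<open>An infinite fibre would contain two distinct comparable vectors, whose difference is
  nonzero and of degree 0. Finiteness makes it possible to measure a fibre by its largest total
  degree.\<close>

lemma finite_fibre:
  fixes a :: "'i \<Rightarrow> 'g::ab_group_add"
  assumes fin: "finite J" and inv: "no_invertibles (nspan (a ` J))" and nz: "\<And>j. j \<in> J \<Longrightarrow> a j \<noteq> 0"
  shows "finite {u. keys u \<subseteq> J \<and> xdeg J a u = d}"
proof (rule ccontr)
  assume "infinite {u. keys u \<subseteq> J \<and> xdeg J a u = d}"
  then obtain f :: "nat \<Rightarrow> 'i \<Rightarrow>\<^sub>0 nat" where f: "inj f" "range f \<subseteq> {u. keys u \<subseteq> J \<and> xdeg J a u = d}"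
    using infinite_countable_subset by blast
  obtain r where r: "strict_mono r" "\<And>i. i \<in> J \<Longrightarrow> incseq (\<lambda>n. lookup (f (r n)) i)"
    using dickson_subseq[OF fin, of f] by blast
  define u where "u = f (r 0)"
  define v where "v = f (r 1)"
  have k: "keys u \<subseteq> J" "keys v \<subseteq> J" "xdeg J a u = d" "xdeg J a v = d"
    using f(2) unfolding u_def v_def by blast+
  have le: "lookup u i \<le> lookup v i" for i
  proof (cases "i \<in> J")
    case True
    then show ?thesis using r(2)[OF True] unfolding u_def v_def by (simp add: incseq_def)
  next
    case False
    then have "i \<notin> keys u" using k(1) by blast
    then show ?thesis by (simp add: in_keys_iff)
  qed
  have eq: "v = u + (v - u)" by (rule poly_mapping_eqI) (simp add: lookup_add lookup_minus le)
  have "xdeg J a (v - u) = 0" using arg_cong[OF eq, of "xdeg J a"] k by (simp add: xdeg_add)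
  moreover have "keys (v - u) \<subseteq> keys v" by (auto simp: in_keys_iff lookup_minus)
  ultimately have "v - u = 0" using xdeg_eq_0D[OF fin inv nz, of "v - u"] k(2) by (meson order_trans)
  then have "v = u" using eq by simp
  then have "r 0 = r 1" using f(1) unfolding u_def v_def by (simp add: inj_eq)
  then show False using r(1) by (metis strict_mono_eq zero_neq_one)
qed

text \<open>The edges of a graph on the monomials of one degree, joining monomials with a common
  variable. Their difference is a variable times another element of the ideal, so only the connected
  components matter for minimal generators.\<close>

definition linked :: "'i set \<Rightarrow> ('i \<Rightarrow> 'g::ab_group_add) \<Rightarrow> ('i \<Rightarrow>\<^sub>0 nat) \<Rightarrow> ('i \<Rightarrow>\<^sub>0 nat) \<Rightarrow> bool"
  where "linked J a u v \<longleftrightarrow> keys u \<subseteq> J \<and> keys v \<subseteq> J \<and> xdeg J a u = xdeg J a v \<and>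
    keys u \<inter> keys v \<noteq> {}"

definition fibre_class :: "'i set \<Rightarrow> ('i \<Rightarrow> 'g::ab_group_add) \<Rightarrow> ('i \<Rightarrow>\<^sub>0 nat) \<Rightarrow> ('i \<Rightarrow>\<^sub>0 nat) set"
  where "fibre_class J a u = {v. (linked J a)\<^sup>*\<^sup>* u v}"

lemma linked_sym: "linked J a u v \<Longrightarrow> linked J a v u"
  by (auto simp: linked_def)

lemma linked_rtranclp_sym: "(linked J a)\<^sup>*\<^sup>* u v \<Longrightarrow> (linked J a)\<^sup>*\<^sup>* v u"
  by (induction rule: rtranclp_induct) (auto intro: linked_sym converse_rtranclp_into_rtranclp)

lemma fibre_class_eq_iff: "fibre_class J a u = fibre_class J a v \<longleftrightarrow> (linked J a)\<^sup>*\<^sup>* u v"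
proof
  assume "fibre_class J a u = fibre_class J a v"
  moreover have "v \<in> fibre_class J a v" by (simp add: fibre_class_def)
  ultimately have "v \<in> fibre_class J a u" by metis
  then show "(linked J a)\<^sup>*\<^sup>* u v" by (simp add: fibre_class_def)
next
  assume uv: "(linked J a)\<^sup>*\<^sup>* u v"
  then show "fibre_class J a u = fibre_class J a v"
    unfolding fibre_class_def using linked_rtranclp_sym[OF uv] by (auto intro: rtranclp_trans)
qed

text \<open>The summand \<open>'i\<close> of the index type is reserved for the derivatives with respect to the variables
  of degree zero.\<close>

definition class_vec :: "'i set \<Rightarrow> ('i \<Rightarrow> 'g::ab_group_add) \<Rightarrow> ('i \<Rightarrow>\<^sub>0 nat) \<Rightarrow> (('i \<Rightarrow>\<^sub>0 nat) set + 'i) \<Rightarrow>\<^sub>0 rat"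
  where "class_vec J a u = single (Inl (fibre_class J a u)) 1"

text \<open>The images of the binomials in a model of the ideal modulo its products with variables:
  linked monomials are identified.\<close>

definition class_diffs :: "'i set \<Rightarrow> ('i \<Rightarrow> 'g::ab_group_add) \<Rightarrow> ((('i \<Rightarrow>\<^sub>0 nat) set + 'i) \<Rightarrow>\<^sub>0 rat) set"
  where "class_diffs J a = {class_vec J a u - class_vec J a v | u v.
    keys u \<subseteq> J \<and> keys v \<subseteq> J \<and> xdeg J a u = xdeg J a v}"

text \<open>If the conclusion failed, then in a fibre of minimal size the indicator functional of the classes
  reached from one vector would separate two classes while vanishing on all given relations.\<close>

lemma class_diffs_span_pcong:
  fixes a :: "'i \<Rightarrow> 'g::ab_group_add"
  assumes fin: "finite J" and inv: "no_invertibles (nspan (a ` J))" and nz: "\<And>j. j \<in> J \<Longrightarrow> a j \<noteq> 0"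
    and pq: "\<And>k. k \<in> K \<Longrightarrow> keys (p k) \<subseteq> J \<and> keys (q k) \<subseteq> J \<and> xdeg J a (p k) = xdeg J a (q k)"
    and span: "class_diffs J a \<subseteq> qv.span ((\<lambda>k. class_vec J a (p k) - class_vec J a (q k)) ` K)"
    and uv: "keys u \<subseteq> J" "keys v \<subseteq> J" "xdeg J a u = xdeg J a v"
  shows "pcong K p q u v"
proof -
  define F where "F d = {w. keys w \<subseteq> J \<and> xdeg J a w = d}" for d
  have finF: "finite (F d)" for d unfolding F_def by (rule finite_fibre[OF fin inv nz])
  define size where "size w = (\<Sum>i\<in>J. lookup w i)" for w :: "'i \<Rightarrow>\<^sub>0 nat"
  \<comment> \<open>The induction measure: the largest total degree of a monomial in the fibre of
    \<open>d\<close>.\<close>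
  define bound where "bound d = Max (size ` F d)" for d
  show ?thesis
    using uv
  proof (induction "bound (xdeg J a u)" arbitrary: u v rule: less_induct)
    case less
    define d where "d = xdeg J a u"
    have linked_pc: "pcong K p q x y" if "linked J a x y" "x \<in> F d" for x y
    proof -
      from that obtain i where i: "i \<in> keys x" "i \<in> keys y" "i \<in> J"
        and k: "keys x \<subseteq> J" "keys y \<subseteq> J" "xdeg J a y = d" "xdeg J a x = d"
        by (auto simp: linked_def F_def)
      let ?e = "single i (1::nat)"
      have ex: "x = ?e + (x - ?e)" "y = ?e + (y - ?e)"
        by (rule poly_mapping_eqI, use i in \<open>auto simp: lookup_add lookup_minus lookup_single when_def in_keys_iff\<close>)+
      have kx: "keys (x - ?e) \<subseteq> J" "keys (y - ?e) \<subseteq> J"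
      proof -
        have "keys (x - ?e) \<subseteq> keys x" "keys (y - ?e) \<subseteq> keys y"
          by (auto simp: in_keys_iff lookup_minus)
        then show "keys (x - ?e) \<subseteq> J" "keys (y - ?e) \<subseteq> J" using k by auto
      qed
      have dx: "xdeg J a (x - ?e) = d - a i" "xdeg J a (y - ?e) = d - a i"
        using arg_cong[OF ex(1), of "xdeg J a"] arg_cong[OF ex(2), of "xdeg J a"] k xdeg_single[OF fin i(3), of a 1]
        by (simp_all add: xdeg_add algebra_simps)
      \<comment> \<open>Every vector of the fibre of \<open>d - a i\<close> gains the common
        variable \<open>i\<close> and becomes one of the fibre of \<open>d\<close>, of total degree
        larger by one.\<close>
      have "bound (d - a i) < bound d"
      proof -
        have ne: "x - ?e \<in> F (d - a i)" using kx dx by (simp add: F_def)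
        then have "bound (d - a i) \<in> size ` F (d - a i)" unfolding bound_def using finF by (intro Max_in) auto
        then obtain w where w: "w \<in> F (d - a i)" "bound (d - a i) = size w" by blast
        have "w + ?e \<in> F d"
          using w(1) i(3) keys_add[of w ?e] xdeg_single[OF fin i(3), of a 1] by (auto simp: F_def xdeg_add)
        then have "size (w + ?e) \<le> bound d" unfolding bound_def using finF by (intro Max_ge) auto
        moreover have "size (w + ?e) = size w + 1"
          using fin i(3) by (simp add: size_def lookup_add sum.distrib lookup_single when_def)
        ultimately show ?thesis using w(2) by simp
      qed
      then have "pcong K p q (x - ?e) (y - ?e)"
        using less.hyps[of "x - ?e" "y - ?e"] kx dx by (simp add: d_def)
      then have "pcong K p q (?e + (x - ?e)) (?e + (y - ?e))" by (rule pcong_add)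
      then show ?thesis using ex by simp
    qed
    have links_pc: "pcong K p q x y \<and> y \<in> F d" if "(linked J a)\<^sup>*\<^sup>* x y" "x \<in> F d" for x y
      using that
    proof (induction rule: rtranclp_induct)
      case (step y z)
      then have "pcong K p q y z" using linked_pc by blast
      moreover have "z \<in> F d" using step by (auto simp: linked_def F_def)
      ultimately show ?case using step by (blast intro: pcong.trans)
    qed (simp add: pcong.refl)
    define W where "W = {w \<in> F d. pcong K p q u w}"
    \<comment> \<open>\<open>linext\<close> has values in finitely supported functions; with the
      index type \<open>unit\<close> it is a linear functional.\<close>
    define h where "h k = (if k \<in> Inl ` fibre_class J a ` W then single () (1::rat) else 0)"
      for k :: "('i \<Rightarrow>\<^sub>0 nat) set + 'i"
    have hW: "linext h (class_vec J a x) = (if x \<in> W then single () 1 else 0)"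
      if x: "keys x \<subseteq> J" for x
    proof -
      have "fibre_class J a x \<in> fibre_class J a ` W \<longleftrightarrow> x \<in> W"
      proof
        assume "fibre_class J a x \<in> fibre_class J a ` W"
        then obtain w where w: "w \<in> W" "fibre_class J a w = fibre_class J a x" by auto
        then have "(linked J a)\<^sup>*\<^sup>* w x" by (simp add: fibre_class_eq_iff)
        from links_pc[OF this] w(1) show "x \<in> W" by (auto simp: W_def intro: pcong.trans)
      qed auto
      then show ?thesis by (auto simp: class_vec_def h_def)
    qed
    have ker: "linext h x = 0" if "x \<in> qv.span ((\<lambda>k. class_vec J a (p k) - class_vec J a (q k)) ` K)" for x
      using that
    proof (induction rule: qv.span_induct_alt)
      case base
      then show ?case by (simp add: linext_def)
    next
      case (step c x y)
      then obtain k where k: "k \<in> K" "x = class_vec J a (p k) - class_vec J a (q k)" by blast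
      have "p k \<in> W \<longleftrightarrow> q k \<in> W"
        using pq[OF k(1)] pcong_rel[OF k(1), of p q] unfolding W_def F_def by (auto intro: pcong.trans pcong.sym)
      then have "linext h x = 0" using k pq[OF k(1)] by (simp add: linext_diff hW)
      then show ?case using step by (simp add: linext_add linext_qscale)
    qed
    have uF: "u \<in> F d" "v \<in> F d" using less.prems by (auto simp: F_def d_def)
    then have "u \<in> W" by (simp add: W_def pcong.refl)
    have "class_vec J a u - class_vec J a v \<in> class_diffs J a"
      unfolding class_diffs_def using less.prems by blast
    then have "linext h (class_vec J a u - class_vec J a v) = 0" using span ker by blast
    moreover have "single () (1::rat) \<noteq> 0" by (metis lookup_single_eq lookup_zero zero_neq_one)
    ultimately have "v \<in> W" using \<open>u \<in> W\<close> less.prems by (auto simp: linext_diff hW split: if_splits)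
    then show ?case by (simp add: W_def)
  qed
qed

text \<open>The factor \<open>w\<close> supplies a common variable. Consequently the class vectors
  do not see multiples of binomials by monomials other than 1.\<close>

lemma fibre_class_add:
  assumes "keys u \<subseteq> J" "keys v \<subseteq> J" "keys w \<subseteq> J"
    "xdeg J a u = xdeg J a v" "w \<noteq> 0"
  shows "fibre_class J a (w + u) = fibre_class J a (w + v)"
proof -
  have ks: "keys (w + x) = keys w \<union> keys x" for x
    by (auto simp: in_keys_iff lookup_add)
  have "keys w \<noteq> {}" using assms(5) by (metis (no_types) ex_in_conv in_keys_iff lookup_zero poly_mapping_eqI)
  then have "keys (w + u) \<inter> keys (w + v) \<noteq> {}" unfolding ks by blast
  moreover have "keys (w + u) \<subseteq> J" "keys (w + v) \<subseteq> J"
    unfolding ks using assms(1-3) by blast+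
  ultimately have "linked J a (w + u) (w + v)" unfolding linked_def using assms(4) by (simp add: xdeg_add)
  then show ?thesis by (simp add: fibre_class_eq_iff)
qed

text \<open>The ideal is studied at its zero with coordinate 1 at the generators that are zero and coordinate 0
  elsewhere; \<open>\<chi>\<close> evaluates monomials at this point.\<close>

theorem generators_presentation:
  fixes m :: nat and a :: "nat \<Rightarrow> 'g::ab_group_add"
  defines "Z \<equiv> {i. i < m \<and> a i = 0}"
  defines "J \<equiv> {i. i < m \<and> a i \<noteq> 0}"
  assumes inv: "no_invertibles (nspan (a ` {..<m}))"
    and B: "finite B" "B \<subseteq> polys {..<m}" "genideal (poly_ring m) B = qv.span (binomials m a)"
  obtains K :: "nat set" and p q where "presents J a K p q" "\<forall>k\<in>K. p k \<noteq> q k" "card K + card Z \<le> card B"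
proof -
  have fin: "finite J" "finite Z" by (auto simp: J_def Z_def)
  have JZ: "{..<m} = J \<union> Z" "J \<inter> Z = {}" by (auto simp: J_def Z_def)
  have nz: "a j \<noteq> 0" if "j \<in> J" for j using that by (simp add: J_def)
  have "J \<subseteq> {..<m}" by (auto simp: J_def)
  then have invJ: "no_invertibles (nspan (a ` J))" using no_invertibles_mono[OF inv] by blast
  have dJ: "xdeg {..<m} a u = xdeg J a (except Z u)" for u
  proof -
    have "xdeg {..<m} a u = zdeg J a (\<lambda>i. int (lookup u i))"
      unfolding xdeg_def zdeg_def by (rule sum.mono_neutral_right) (auto simp: J_def)
    also have "\<dots> = xdeg J a (except Z u)" unfolding xdeg_def by (rule zdeg_cong) (use JZ(2) in auto)
    finally show ?thesis .
  qed
  have kJ: "keys (except Z u) \<subseteq> J" if "keys u \<subseteq> {..<m}" for u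
    using that unfolding keys_except JZ(1) by blast
  have exadd: "except Z (u + v) = except Z u + except Z v" for u v :: "nat \<Rightarrow>\<^sub>0 nat"
    by (rule poly_mapping_eqI) (simp add: lookup_add)
  \<comment> \<open>For a monomial in the variables of degree zero, these are its derivatives at the
    point where all these variables are 1.\<close>
  define zv :: "(nat \<Rightarrow>\<^sub>0 nat) \<Rightarrow> ((nat \<Rightarrow>\<^sub>0 nat) set + nat) \<Rightarrow>\<^sub>0 rat"
    where "zv u = (\<Sum>z\<in>Z. single (Inr z) (of_nat (lookup u z)))" for u
  have zv_add: "zv (u + v) = zv u + zv v" for u v
    by (simp add: zv_def lookup_add single_add sum.distrib)
  \<comment> \<open>The second summand is present only if the variables in \<open>J\<close> are
    absent: otherwise the derivatives with respect to the variables in \<open>Z\<close> contain a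
    factor that is 0 at the point.\<close>
  define h where "h u = class_vec J a (except Z u) + (if except Z u = 0 then zv u else 0)" for u
  define \<chi> :: "(nat \<Rightarrow>\<^sub>0 nat) \<Rightarrow> rat" where "\<chi> w = (if except Z w = 0 then 1 else 0)" for w
  have tw: "h (w + u) - h (w + v) = qscale (\<chi> w) (h u - h v)"
    if k: "keys u \<subseteq> {..<m}" "keys v \<subseteq> {..<m}" and d: "xdeg {..<m} a u = xdeg {..<m} a v"
      and w: "keys w \<subseteq> {..<m}" for u v w
  proof (cases "except Z w = 0")
    case True
    have "except Z u = 0 \<longleftrightarrow> except Z v = 0"
      using d kJ[OF k(1)] kJ[OF k(2)] xdeg_eq_0D[OF fin(1) invJ nz] unfolding dJ by (metis xdeg_0)
    then show ?thesis using True by (simp add: h_def \<chi>_def exadd zv_add)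
  next
    case False
    have "fibre_class J a (except Z w + except Z u) = fibre_class J a (except Z w + except Z v)"
      using kJ[OF k(1)] kJ[OF k(2)] kJ[OF w] d False unfolding dJ by (rule fibre_class_add)
    moreover have "except Z w + x \<noteq> 0" for x :: "nat \<Rightarrow>\<^sub>0 nat"
    proof
      assume z: "except Z w + x = 0"
      have "lookup (except Z w) i = 0" for i
        using arg_cong[OF z, of "\<lambda>y. lookup y i"] by (simp add: lookup_add)
      then have "except Z w = 0" by (intro poly_mapping_eqI) simp
      then show False using False by simp
    qed
    ultimately show ?thesis using False by (simp add: h_def \<chi>_def exadd class_vec_def)
  qed
  have im: "linext h ` qv.span (binomials m a) \<subseteq> qv.span (linext h ` B)"
    by (rule linext_ideal_in_span[OF B(2,3)]) (rule tw)
  have im1: "linext h f \<in> qv.span (linext h ` B)" if "f \<in> binomials m a" for f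
    using im that by (meson image_subset_iff qv.span_base)
  have ez: "except Z u = u" if "keys u \<subseteq> J" for u :: "nat \<Rightarrow>\<^sub>0 nat"
  proof (rule poly_mapping_eqI)
    fix i
    show "lookup (except Z u) i = lookup u i"
      using that JZ(2) by (auto simp: in_keys_iff)
  qed
  have cd: "class_diffs J a \<subseteq> qv.span (linext h ` B)"
  proof
    fix x assume "x \<in> class_diffs J a"
    then obtain u v where uv: "x = class_vec J a u - class_vec J a v" "keys u \<subseteq> J" "keys v \<subseteq> J"
      "xdeg J a u = xdeg J a v" by (auto simp: class_diffs_def)
    have "lookup u z = 0" "lookup v z = 0" if "z \<in> Z" for z
    proof -
      have "z \<notin> keys u" "z \<notin> keys v" using uv(2,3) JZ(2) that by blast+
      then show "lookup u z = 0" "lookup v z = 0" by (simp_all add: in_keys_iff)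
    qed
    then have "zv u = 0" "zv v = 0"
      unfolding zv_def by (simp_all add: sum.neutral)
    moreover have "zv 0 = 0" by (simp add: zv_def)
    ultimately have "x = linext h (mon u - mon v)"
      unfolding linext_diff uv(1) using uv(2,3) by (simp add: h_def ez)
    moreover have "mon u - mon v \<in> binomials m a"
      unfolding binomials_def dJ using uv JZ(1) by (auto simp: ez intro!: exI)
    ultimately show "x \<in> qv.span (linext h ` B)" using im1[of "mon u - mon v"] by (simp only:)
  qed
  \<comment> \<open>The values of \<open>linext h\<close> at the binomials x_z - 1. They are
    independent of the class differences, so the variables of degree zero use up
    \<open>card Z\<close> of the generators.\<close>
  let ?E = "(\<lambda>z. single (Inr z) (1::rat)) ` Z :: (((nat \<Rightarrow>\<^sub>0 nat) set + nat) \<Rightarrow>\<^sub>0 rat) set"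
  have Esp: "?E \<subseteq> qv.span (linext h ` B)"
  proof (rule image_subsetI)
    fix z assume z: "z \<in> Z"
    let ?e = "single z (1::nat)"
    have e0: "except Z ?e = 0" "except Z 0 = (0 :: nat \<Rightarrow>\<^sub>0 nat)"
      by (rule poly_mapping_eqI, use z in \<open>auto simp: lookup_single when_def\<close>)+
    have "zv ?e = single (Inr z) 1"
    proof -
      have "zv ?e = (\<Sum>x\<in>Z. if x = z then single (Inr z) 1 else 0)"
        unfolding zv_def by (rule sum.cong) (auto simp: lookup_single when_def)
      then show ?thesis using z fin by simp
    qed
    moreover have "zv 0 = 0" by (simp add: zv_def)
    ultimately have "single (Inr z) 1 = linext h (mon ?e - mon 0)"
      unfolding linext_diff linext_mon by (simp add: h_def e0[unfolded One_nat_def])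
    moreover have "mon ?e - mon 0 \<in> binomials m a"
    proof -
      have "keys ?e \<subseteq> {..<m}" using z by (simp add: Z_def)
      moreover have "xdeg {..<m} a ?e = xdeg {..<m} a 0" unfolding dJ e0 by simp
      ultimately show ?thesis unfolding binomials_def by (intro CollectI exI[of _ ?e] exI[of _ 0]) simp
    qed
    ultimately show "single (Inr z) 1 \<in> qv.span (linext h ` B)"
      using im1[of "mon ?e - mon 0"] by (simp only:)
  qed
  \<comment> \<open>The basis is chosen among the differences themselves, not merely in their span:
    each member comes from a pair of exponent vectors and thus gives a relation of the
    presentation.\<close>
  obtain T where T: "T \<subseteq> class_diffs J a" "qv.independent T" "class_diffs J a \<subseteq> qv.span T"
    using qv.maximal_independent_subset by metis
  have TB: "T \<subseteq> qv.span (linext h ` B)" using T(1) cd by (rule order_trans)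
  have finLB: "finite (linext h ` B)" using B(1) by simp
  have finT: "finite T" using qv.independent_span_bound[OF finLB T(2) TB] by (rule conjunct1)
  have Einj: "inj_on (\<lambda>z. single (Inr z) (1::rat) :: ((nat \<Rightarrow>\<^sub>0 nat) set + nat) \<Rightarrow>\<^sub>0 rat) Z"
    and Eind: "qv.independent ?E"
  proof -
    have "\<forall>z\<in>Z. c z = 0" if s: "(\<Sum>z\<in>Z. qscale (c z) (single (Inr z) 1 :: ((nat \<Rightarrow>\<^sub>0 nat) set + nat) \<Rightarrow>\<^sub>0 rat)) = 0" for c
    proof
      fix y assume y: "y \<in> Z"
      have "lookup (\<Sum>z\<in>Z. qscale (c z) (single (Inr z) 1 :: ((nat \<Rightarrow>\<^sub>0 nat) set + nat) \<Rightarrow>\<^sub>0 rat)) (Inr y) = c y"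
        using y fin by (simp add: lookup_sum lookup_single when_def if_distrib[of "\<lambda>x. _ * x"] cong: if_cong)
      then show "c y = 0" unfolding s by simp
    qed
    then have "\<forall>c. (\<Sum>z\<in>Z. qscale (c z) (single (Inr z) 1 :: ((nat \<Rightarrow>\<^sub>0 nat) set + nat) \<Rightarrow>\<^sub>0 rat)) = 0 \<longrightarrow> (\<forall>z\<in>Z. c z = 0)"
      by blast
    note fi = qv_family_independent[OF fin(2) this]
    show "inj_on (\<lambda>z. single (Inr z) (1::rat) :: ((nat \<Rightarrow>\<^sub>0 nat) set + nat) \<Rightarrow>\<^sub>0 rat) Z" by (rule fi(1))
    show "qv.independent ?E" by (rule fi(2))
  qed
  have Tl: "lookup x (Inr z) = 0" if "x \<in> qv.span T" for x z
    using that
  proof (induction rule: qv.span_induct_alt)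
    case (step c x y)
    then have "x \<in> class_diffs J a" using T(1) by blast
    then have "lookup x (Inr z) = 0" by (auto simp: class_diffs_def class_vec_def lookup_minus lookup_single)
    then show ?case using step by (simp add: lookup_add)
  qed simp
  have El: "lookup x (Inl c) = 0" if "x \<in> qv.span ?E" for x c
    using that
  proof (induction rule: qv.span_induct_alt)
    case (step c' x y)
    then have "lookup x (Inl c) = 0" by (auto simp: lookup_single)
    then show ?case using step by (simp add: lookup_add)
  qed simp
  have tr: "qv.span T \<inter> qv.span ?E \<subseteq> {0}"
  proof
    fix x assume x: "x \<in> qv.span T \<inter> qv.span ?E"
    have "lookup x k = 0" for k using x Tl[of x] El[of x] by (cases k) auto
    then have "x = 0" by (intro poly_mapping_eqI) simp
    then show "x \<in> {0}" by simp
  qed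
  have "qv.independent (T \<union> ?E)"
    using fin by (intro qv_independent_Un T(2) Eind tr) auto
  then have "card (T \<union> ?E) \<le> card (linext h ` B)"
    using qv.independent_span_bound[OF finLB, of "T \<union> ?E"] TB Esp by simp
  moreover have "T \<inter> ?E = {}"
  proof (rule ccontr)
    assume "T \<inter> ?E \<noteq> {}"
    then obtain x where x: "x \<in> T" "x \<in> ?E" by blast
    then have "x \<in> qv.span T \<inter> qv.span ?E" by (metis IntI qv.span_base)
    then have "x = 0" using tr by blast
    then show False using x(1) T(2) qv.dependent_zero by blast
  qed
  ultimately have "card T + card Z \<le> card (linext h ` B)"
    using finT fin card_image[OF Einj] by (simp add: card_Un_disjoint)
  also have "\<dots> \<le> card B" using B(1) by (rule card_image_le)
  finally have cT: "card T + card Z \<le> card B" .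
  obtain t where t: "bij_betw t {..<card T} T"
    using ex_bij_betw_nat_finite[OF finT] by (auto simp: lessThan_atLeast0)
  have "\<forall>k\<in>{..<card T}. \<exists>u v. t k = class_vec J a u - class_vec J a v \<and> keys u \<subseteq> J \<and> keys v \<subseteq> J \<and>
      xdeg J a u = xdeg J a v"
  proof
    fix k assume "k \<in> {..<card T}"
    then have "t k \<in> class_diffs J a" using t T(1) unfolding bij_betw_def by blast
    then show "\<exists>u v. t k = class_vec J a u - class_vec J a v \<and> keys u \<subseteq> J \<and> keys v \<subseteq> J \<and>
      xdeg J a u = xdeg J a v" unfolding class_diffs_def by blast
  qed
  then obtain p q where pq: "\<And>k. k \<in> {..<card T} \<Longrightarrow> t k = class_vec J a (p k) - class_vec J a (q k) \<and>
      keys (p k) \<subseteq> J \<and> keys (q k) \<subseteq> J \<and> xdeg J a (p k) = xdeg J a (q k)" by metis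
  have "t ` {..<card T} = T" using t by (simp add: bij_betw_def)
  then have imT: "(\<lambda>k. class_vec J a (p k) - class_vec J a (q k)) ` {..<card T} = T"
    using pq by (metis (no_types, lifting) image_cong)
  have "presents J a {..<card T} p q"
    unfolding presents_def
  proof (intro conjI ballI allI impI)
    fix u v assume "keys u \<subseteq> J \<and> keys v \<subseteq> J \<and> xdeg J a u = xdeg J a v"
    then show "pcong {..<card T} p q u v"
      by (intro class_diffs_span_pcong[OF fin(1) invJ nz]) (use pq T(3) imT in auto)
  qed (use pq in auto)
  moreover have "\<forall>k\<in>{..<card T}. p k \<noteq> q k"
  proof (intro ballI notI)
    fix k assume k: "k \<in> {..<card T}" and "p k = q k"
    then have "t k = 0" using pq[OF k] by simp
    then show False using t k T(2) qv.dependent_zero[of T] unfolding bij_betw_def by (metis imageI)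
  qed
  moreover have "card {..<card T} + card Z \<le> card B" using cT by simp
  ultimately show thesis by (rule that)
qed

section \<open>The height of a lattice ideal\<close>

lemma poly_primeideal_iff:
  "primeideal C (poly_ring m) \<longleftrightarrow> ideal C (poly_ring m) \<and> 1 \<notin> C \<and>
    (\<forall>x\<in>polys {..<m}. \<forall>y\<in>polys {..<m}. x * y \<in> C \<longrightarrow> x \<in> C \<or> y \<in> C)" (is "?l \<longleftrightarrow> ?r")
proof
  assume p: ?l
  interpret P: primeideal C "poly_ring m" by (rule p)
  have id: "ideal C (poly_ring m)" by (rule P.is_ideal)
  have "1 \<notin> C"
  proof
    assume "1 \<in> C"
    then have "polys {..<m} \<subseteq> C" using poly_idealD(4)[OF id, of _ 1] by auto
    then have "C = carrier (poly_ring m)" using poly_idealD(1)[OF id] by auto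
    then show False using P.I_notcarr by simp
  qed
  then show ?r using id P.I_prime by auto
next
  assume r: ?r
  show ?l
  proof (rule primeidealI)
    show "carrier (poly_ring m) \<noteq> C" using r by auto
  qed (use r cring_poly_ring in auto)
qed

section \<open>Growth modulo a prime ideal and the upper bound for the height\<close>

definition box_monomials :: "nat set \<Rightarrow> nat \<Rightarrow> (nat \<Rightarrow>\<^sub>0 nat) set"
  where "box_monomials V d = {u. keys u \<subseteq> V \<and> (\<forall>i. lookup u i \<le> d)}"

lemma card_box_monomials:
  assumes "finite V"
  shows "finite (box_monomials V d)" "card (box_monomials V d) = (d + 1) ^ card V"
proof -
  have "bij_betw (\<lambda>u. restrict (lookup u) V) (box_monomials V d) (V \<rightarrow>\<^sub>E {..d})"
  proof (rule bij_betw_imageI)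
    show "inj_on (\<lambda>u. restrict (lookup u) V) (box_monomials V d)"
    proof (rule inj_onI)
      fix u v assume uv: "u \<in> box_monomials V d" "v \<in> box_monomials V d"
        "restrict (lookup u) V = restrict (lookup v) V"
      show "u = v"
      proof (rule poly_mapping_eqI)
        fix i
        show "lookup u i = lookup v i"
        proof (cases "i \<in> V")
          case True
          then show ?thesis using fun_cong[OF uv(3), of i] by simp
        next
          case False
          then have "i \<notin> keys u" "i \<notin> keys v" using uv(1,2) by (auto simp: box_monomials_def)
          then show ?thesis by (simp add: in_keys_iff)
        qed
      qed
    qed
    show "(\<lambda>u. restrict (lookup u) V) ` box_monomials V d = (V \<rightarrow>\<^sub>E {..d})"
    proof (intro equalityI subsetI)
      fix g assume g: "g \<in> V \<rightarrow>\<^sub>E {..d}"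
      define u where "u = Abs_poly_mapping (\<lambda>i. if i \<in> V then g i else 0)"
      have u: "lookup u i = (if i \<in> V then g i else 0)" for i
        unfolding u_def by (subst lookup_Abs_poly_mapping) (auto intro: finite_subset[OF _ assms])
      have "u \<in> box_monomials V d" using g by (auto simp: box_monomials_def in_keys_iff u split: if_splits)
      moreover have "restrict (lookup u) V = g" using g by (auto simp: u fun_eq_iff)
      ultimately show "g \<in> (\<lambda>u. restrict (lookup u) V) ` box_monomials V d" by blast
    qed (auto simp: box_monomials_def)
  qed
  from bij_betw_same_card[OF this] bij_betw_finite[OF this] show "finite (box_monomials V d)" "card (box_monomials V d) = (d + 1) ^ card V"
    using assms by (simp_all add: card_PiE finite_PiE)
qed

definition box_polys :: "nat \<Rightarrow> nat \<Rightarrow> rpoly set"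
  where "box_polys m d = {p. keys p \<subseteq> box_monomials {..<m} d}"

lemma box_polys_polys: "box_polys m d \<subseteq> polys {..<m}"
  by (auto simp: box_polys_def polys_def box_monomials_def)

lemma box_polys_mono: "d \<le> e \<Longrightarrow> box_polys m d \<subseteq> box_polys m e"
proof -
  assume de: "d \<le> e"
  have "box_monomials {..<m} d \<subseteq> box_monomials {..<m} e"
    using order_trans[OF _ de] by (auto simp: box_monomials_def)
  then show ?thesis by (auto simp: box_polys_def)
qed

lemma box_polys_mult:
  assumes "p \<in> box_polys m d" "q \<in> box_polys m e"
  shows "p * q \<in> box_polys m (d + e)"
  unfolding box_polys_def
proof (intro CollectI subsetI)
  fix u assume "u \<in> keys (p * q)"
  then obtain s t where st: "s \<in> keys p" "t \<in> keys q" "u = s + t"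
    using Poly_Mapping.keys_mult[of p q] by blast
  then have "s \<in> box_monomials {..<m} d" "t \<in> box_monomials {..<m} e" using assms by (auto simp: box_polys_def)
  then show "u \<in> box_monomials {..<m} (d + e)"
    using keys_add[of s t] unfolding box_monomials_def st(3) by (auto simp: lookup_add intro: add_mono)
qed

lemma polys_box: "p \<in> polys {..<m} \<Longrightarrow> \<exists>d. p \<in> box_polys m d"
proof -
  assume p: "p \<in> polys {..<m}"
  define d where "d = (\<Sum>u\<in>keys p. \<Sum>i<m. lookup u i)"
  have "lookup u i \<le> d" if u: "u \<in> keys p" for u i
  proof (cases "i < m")
    case True
    then have "lookup u i \<le> (\<Sum>i<m. lookup u i)" by (intro member_le_sum) auto
    also have "\<dots> \<le> d" unfolding d_def
      by (rule member_le_sum[of u _ "\<lambda>u. \<Sum>i<m. lookup u i"]) (use u in auto)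
    finally show ?thesis .
  next
    case False
    then have "i \<notin> keys u" using p u by (auto simp: polys_def)
    then show ?thesis by (simp add: in_keys_iff)
  qed
  then have "p \<in> box_polys m d" using p by (auto simp: box_polys_def box_monomials_def polys_def)
  then show ?thesis by blast
qed

definition independent_mod :: "rpoly set \<Rightarrow> rpoly set \<Rightarrow> bool"
  where "independent_mod C A \<longleftrightarrow> finite A \<and> qv.independent A \<and> qv.span A \<inter> C \<subseteq> {0}"

text \<open>A substitute for the transcendence degree: if \<open>f \<in> D - C\<close> for primes \<open>C \<subset> D\<close>, then multiplication by \<open>f\<close>
  embeds the polynomials modulo \<open>C\<close> into \<open>D / C\<close>, which raises the growth exponent by one.\<close>

definition growth :: "nat \<Rightarrow> rpoly set \<Rightarrow> nat \<Rightarrow> bool"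
  where "growth m C s \<longleftrightarrow> (\<exists>c. \<forall>n. \<exists>A. A \<subseteq> box_polys m (c * n) \<and> independent_mod C A \<and> (n + s) choose s \<le> card A)"

text \<open>The multiples of \<open>f\<close> lie in \<open>D\<close>, so a combination in
  \<open>C\<close> has its part from \<open>A\<close> in \<open>D\<close>, where it must vanish.
  What remains is \<open>f\<close> times an element of the span of \<open>A'\<close>; primality of
  \<open>C\<close> removes the factor \<open>f\<close>.\<close>

lemma independent_mod_Un:
  assumes C: "primeideal C (poly_ring m)" and D: "ideal D (poly_ring m)" and CD: "C \<subseteq> D"
    and f: "f \<in> D" "f \<notin> C" and A: "independent_mod D A" and A': "independent_mod C A'" "A' \<subseteq> polys {..<m}"
  shows "independent_mod C (A \<union> (*) f ` A')" "card (A \<union> (*) f ` A') = card A + card A'"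
proof -
  have Cid: "ideal C (poly_ring m)" and Cpr: "x * y \<in> C \<Longrightarrow> x \<in> polys {..<m} \<Longrightarrow> y \<in> polys {..<m} \<Longrightarrow> x \<in> C \<or> y \<in> C" for x y
    using C unfolding poly_primeideal_iff by blast+
  have f0: "f \<noteq> 0" using f(2) poly_idealD(2)[OF Cid] by blast
  have fp: "f \<in> polys {..<m}" using f(1) poly_idealD(1)[OF D] by blast
  have lin: "Vector_Spaces.linear qscale qscale ((*) f)"
    by (rule qv_linearI) (simp_all add: distrib_left qscale_mult_right)
  interpret lin: Vector_Spaces.linear qscale qscale "(*) f" by (rule lin)
  have inj: "inj ((*) f)" using f0 by (simp add: inj_on_def)
  have finA: "finite A" "finite A'" and indA: "qv.independent A" "qv.independent A'"
    and spA: "qv.span A \<inter> D \<subseteq> {0}" "qv.span A' \<inter> C \<subseteq> {0}"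
    using A A' by (auto simp: independent_mod_def)
  have sf: "qv.span ((*) f ` A') = (*) f ` qv.span A'" by (rule lin.span_image)
  have sA': "qv.span A' \<subseteq> polys {..<m}" by (rule qv.span_minimal[OF A'(2) subspace_polys])
  have sfD: "qv.span ((*) f ` A') \<subseteq> D"
  proof
    fix y assume "y \<in> qv.span ((*) f ` A')"
    then obtain x where "x \<in> qv.span A'" "y = f * x" unfolding sf by blast
    then show "y \<in> D" using poly_idealD(4)[OF D, of x f] sA' f(1) by (auto simp: mult.commute)
  qed
  have tr: "qv.span A \<inter> qv.span ((*) f ` A') \<subseteq> {0}" using sfD spA(1) by blast
  have indf: "qv.independent ((*) f ` A')"
    by (rule lin.independent_injective_image[OF indA(2)]) (use inj in \<open>auto simp: inj_on_def\<close>)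
  have indU: "qv.independent (A \<union> (*) f ` A')"
    using finA by (intro qv_independent_Un indA(1) indf tr) auto
  have "qv.span (A \<union> (*) f ` A') \<inter> C \<subseteq> {0}"
  proof
    fix z assume z: "z \<in> qv.span (A \<union> (*) f ` A') \<inter> C"
    then obtain x y where xy: "x \<in> qv.span A" "y \<in> qv.span ((*) f ` A')" "z = x + y" by (auto simp: qv.span_Un)
    have "x = z - y" using xy(3) by simp
    moreover have "z - y \<in> D"
      using z CD xy(2) sfD qv.subspace_diff[OF poly_ideal_subspace[OF D]] by blast
    ultimately have x0: "x = 0" using xy(1) spA(1) by blast
    obtain y' where y': "y' \<in> qv.span A'" "y = f * y'" using xy(2) unfolding sf by blast
    have "f * y' \<in> C" using z xy(3) x0 y'(2) by simp
    then have "y' \<in> C" using Cpr[of f y'] fp y'(1) sA' f(2) by blast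
    then have "y' = 0" using y'(1) spA(2) by blast
    then show "z \<in> {0}" using xy(3) x0 y'(2) by simp
  qed
  then show "independent_mod C (A \<union> (*) f ` A')" unfolding independent_mod_def using indU finA by simp
  have "A \<inter> (*) f ` A' = {}"
  proof (rule ccontr)
    assume "A \<inter> (*) f ` A' \<noteq> {}"
    then obtain x where x: "x \<in> A" "x \<in> (*) f ` A'" by blast
    then have "x \<in> qv.span A \<inter> qv.span ((*) f ` A')" by (metis IntI qv.span_base)
    then have "x = 0" using tr by blast
    then show False using x(1) indA(1) qv.dependent_zero by blast
  qed
  then show "card (A \<union> (*) f ` A') = card A + card A'"
    using finA card_image[OF inj_on_subset[OF inj subset_UNIV], of A'] by (simp add: card_Un_disjoint)
qed

text \<open>Level n + 1 for \<open>C\<close> consists of level n + 1 for \<open>D\<close> together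
  with \<open>f\<close> times level n for \<open>C\<close>. The sizes add up by Pascal's rule, which
  is the reason for the binomial coefficient in \<open>growth\<close>.\<close>

lemma growth_step:
  assumes C: "primeideal C (poly_ring m)" and D: "ideal D (poly_ring m)" and CD: "C \<subset> D" and g: "growth m D s"
  shows "growth m C (Suc s)"
proof -
  obtain c where c: "\<And>n. \<exists>A. A \<subseteq> box_polys m (c * n) \<and> independent_mod D A \<and> (n + s) choose s \<le> card A"
    using g unfolding growth_def by blast
  obtain f where f: "f \<in> D" "f \<notin> C" using CD by blast
  then obtain e where e: "f \<in> box_polys m e" using poly_idealD(1)[OF D] polys_box by blast
  \<comment> \<open>Each level contributes one more factor \<open>f\<close>, whose exponents are at
    most \<open>e\<close>.\<close>
  let ?c = "c + e"
  have "\<exists>A. A \<subseteq> box_polys m (?c * n) \<and> independent_mod C A \<and> (n + Suc s) choose Suc s \<le> card A" for n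
  proof (induction n)
    case 0
    obtain A where A: "A \<subseteq> box_polys m (c * 0)" "independent_mod D A" "(0 + s) choose s \<le> card A" using c by blast
    then have "independent_mod C A" using CD unfolding independent_mod_def by blast
    then show ?case using A by auto
  next
    case (Suc n)
    obtain A where A: "A \<subseteq> box_polys m (c * Suc n)" "independent_mod D A" "(Suc n + s) choose s \<le> card A" using c by blast
    obtain A' where A': "A' \<subseteq> box_polys m (?c * n)" "independent_mod C A'" "(n + Suc s) choose Suc s \<le> card A'"
      using Suc by blast
    have A'p: "A' \<subseteq> polys {..<m}" using A'(1) box_polys_polys by (rule order_trans)
    note U = independent_mod_Un[OF C D _ f A(2) A'(2) A'p]
    have "(*) f ` A' \<subseteq> box_polys m (e + ?c * n)" using A'(1) box_polys_mult[OF e] by blast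
    moreover have "box_polys m (e + ?c * n) \<subseteq> box_polys m (?c * Suc n)"
      "box_polys m (c * Suc n) \<subseteq> box_polys m (?c * Suc n)" by (rule box_polys_mono, simp add: algebra_simps)+
    ultimately have "A \<union> (*) f ` A' \<subseteq> box_polys m (?c * Suc n)" using A(1) by blast
    moreover have "(Suc n + Suc s) choose Suc s \<le> card (A \<union> (*) f ` A')"
      using U(2) A(3) A'(3) CD by simp
    ultimately show ?case using U(1) CD by blast
  qed
  then show ?thesis unfolding growth_def by blast
qed

text \<open>An independent set fits into a box whose dimension grows like n^m, whereas the binomial
  coefficient grows like n^s.\<close>

lemma growth_le:
  assumes "growth m C s"
  shows "s \<le> m"
proof (rule ccontr)
  assume "\<not> s \<le> m"
  then have sm: "m < s" by simp
  obtain c where c: "\<And>n. \<exists>A. A \<subseteq> box_polys m (c * n) \<and> independent_mod C A \<and> (n + s) choose s \<le> card A"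
    using assms unfolding growth_def by blast
  have le: "(n + s) choose s \<le> (c * n + 1) ^ m" for n
  proof -
    obtain A where A: "A \<subseteq> box_polys m (c * n)" "independent_mod C A" "(n + s) choose s \<le> card A" using c by blast
    note fb = card_box_monomials[of "{..<m}" "c * n", OF finite_lessThan]
    have "A \<subseteq> qv.span (unitvecs (box_monomials {..<m} (c * n)))"
    proof
      fix p assume "p \<in> A"
      then have "keys p \<subseteq> box_monomials {..<m} (c * n)" using A(1) by (auto simp: box_polys_def)
      then show "p \<in> qv.span (unitvecs (box_monomials {..<m} (c * n)))" by (rule in_span_unitvecs[OF fb(1)])
    qed
    then have "card A \<le> card (unitvecs (box_monomials {..<m} (c * n)))"
      using qv.independent_span_bound[OF unitvecs_fin[OF fb(1)], of A] A(2) by (simp add: independent_mod_def)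
    then show ?thesis using A(3) by (simp add: card_unitvecs fb(2))
  qed
  \<comment> \<open>Taking n = s t makes the binomial coefficient at least (t + 1)^s, while the box
    has dimension at most b (t + 1)^m. For t = b these bounds contradict each other.\<close>
  define b where "b = (c * s + 1) ^ m"
  have "(t + 1) ^ s \<le> b * (t + 1) ^ m" for t
  proof -
    have "(of_nat (s * t + s) / of_nat s :: rat) ^ s \<le> of_nat ((s * t + s) choose s)"
      by (rule binomial_ge_n_over_k_pow_k) simp
    moreover have "(of_nat (s * t + s) / of_nat s :: rat) = of_nat (t + 1)" using sm by (simp add: field_simps)
    ultimately have "(of_nat ((t + 1) ^ s) :: rat) \<le> of_nat ((s * t + s) choose s)" by simp
    then have "(t + 1) ^ s \<le> (s * t + s) choose s" by (simp only: of_nat_le_iff)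
    also have "\<dots> \<le> (c * (s * t) + 1) ^ m" by (rule le)
    also have "\<dots> \<le> ((c * s + 1) * (t + 1)) ^ m" by (rule power_mono) (simp_all add: algebra_simps)
    also have "\<dots> = b * (t + 1) ^ m" by (simp only: b_def power_mult_distrib)
    finally show ?thesis .
  qed
  from this[of b] have "(b + 1) ^ s \<le> b * (b + 1) ^ m" .
  moreover have "(b + 1) ^ s \<ge> (b + 1) ^ Suc m" using sm by (intro power_increasing) auto
  ultimately have "(b + 1) ^ Suc m \<le> b * (b + 1) ^ m" by (rule order_trans[rotated])
  then have "(b + 1) * (b + 1) ^ m \<le> b * (b + 1) ^ m" by (simp only: power_Suc)
  moreover have "0 < (b + 1) ^ m" by simp
  ultimately show False by (simp only: mult_le_cancel2) simp
qed

lemma growth_chain: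
  assumes "\<And>i. i \<le> n \<Longrightarrow> primeideal (C i) (poly_ring m)" "\<And>i. i < n \<Longrightarrow> C i \<subset> C (Suc i)" "growth m (C n) s"
  shows "growth m (C 0) (s + n)"
  using assms
proof (induction n arbitrary: s)
  case (Suc n)
  have "ideal (C (Suc n)) (poly_ring m)" using Suc.prems(1)[of "Suc n"] unfolding poly_primeideal_iff by blast
  then have "growth m (C n) (Suc s)"
    using growth_step[of "C n" m "C (Suc n)" s] Suc.prems by simp
  then have "growth m (C 0) (Suc s + n)" using Suc.IH[of "Suc s"] Suc.prems by simp
  then show ?case by simp
qed simp

lemma binomial_le_power: "(n + s) choose s \<le> (n + 1) ^ s"
proof (induction s)
  case (Suc s)
  have "Suc s * ((n + Suc s) choose Suc s) = Suc (n + s) * ((n + s) choose s)"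
    using Suc_times_binomial[of s "n + s"] by simp
  also have "\<dots> \<le> (Suc s * (n + 1)) * ((n + s) choose s)" by (rule mult_right_mono) simp_all
  finally have "(n + Suc s) choose Suc s \<le> (n + 1) * ((n + s) choose s)"
    by (simp only: mult.assoc Suc_mult_le_cancel1)
  also have "\<dots> \<le> (n + 1) * (n + 1) ^ s" using Suc by (rule mult_left_mono) simp
  finally show ?case by simp
qed simp

text \<open>The monomials in the variables of \<open>U\<close> are independent modulo
  \<open>P\<close>, so \<open>P\<close> has growth \<open>card U\<close>. Every step down a chain of
  primes adds one, and growth cannot exceed \<open>m\<close>.\<close>

lemma prime_height_le:
  assumes P: "primeideal P (poly_ring m)" and U: "U \<subseteq> {..<m}" and tr: "P \<inter> polys U \<subseteq> {0}"
  shows "prime_height (poly_ring m) P \<le> enat (m - card U)"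
proof -
  have finU: "finite U" using U by (rule finite_subset) simp
  have g: "growth m P (card U)"
    unfolding growth_def
  proof (intro exI[of _ 1] allI)
    fix n
    let ?A = "unitvecs (box_monomials U n)"
    note fb = card_box_monomials[OF finU, of n]
    have "?A \<subseteq> box_polys m (1 * n)" using U by (auto simp: unitvecs_def box_polys_def box_monomials_def)
    moreover have "?A \<subseteq> polys U" by (auto simp: unitvecs_def polys_def box_monomials_def)
    then have "qv.span ?A \<subseteq> polys U" by (rule qv.span_minimal[OF _ subspace_polys])
    then have "independent_mod P ?A"
      unfolding independent_mod_def using fb(1) independent_unitvecs[OF fb(1)] tr by (auto simp: unitvecs_fin)
    moreover have "(n + card U) choose card U \<le> card ?A"
      using binomial_le_power[of n "card U"] by (simp add: card_unitvecs fb(2))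
    ultimately show "\<exists>A. A \<subseteq> box_polys m (1 * n) \<and> independent_mod P A \<and> (n + card U) choose card U \<le> card A" by blast
  qed
  show ?thesis
    unfolding prime_height_def
  proof (rule Sup_least)
    fix x assume "x \<in> {enat n | n. \<exists>C :: nat \<Rightarrow> rpoly set. (\<forall>i\<le>n. primeideal (C i) (poly_ring m)) \<and> (\<forall>i<n. C i \<subset> C (Suc i)) \<and> C n = P}"
    then obtain n C where n: "x = enat n" "\<And>i. i \<le> n \<Longrightarrow> primeideal (C i) (poly_ring m)" "\<And>i. i < n \<Longrightarrow> C i \<subset> C (Suc i)" "C n = P"
      by blast
    have "growth m (C 0) (card U + n)" by (rule growth_chain[of n C m "card U"]) (use n g in auto)
    then have "card U + n \<le> m" by (rule growth_le)
    then show "x \<le> enat (m - card U)" unfolding n(1) by simp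
  qed
qed

text \<open>The nonzero polynomials in the variables of \<open>U\<close> are closed under
  multiplication, and an ideal maximal among those avoiding them is prime.\<close>

lemma exists_prime_avoiding:
  assumes I: "ideal I (poly_ring m)" and U: "U \<subseteq> {..<m}" and tr: "I \<inter> polys U \<subseteq> {0}"
  obtains P where "primeideal P (poly_ring m)" "I \<subseteq> P" "P \<inter> polys U \<subseteq> {0}"
proof -
  let ?S = "{C. ideal C (poly_ring m) \<and> I \<subseteq> C \<and> C \<inter> polys U \<subseteq> {0}}"
  have "\<exists>M\<in>?S. \<forall>X\<in>?S. M \<subseteq> X \<longrightarrow> X = M"
  proof (rule subset_Zorn_nonempty)
    show "?S \<noteq> {}" using I tr by blast
    fix c assume c: "c \<noteq> {}" "subset.chain ?S c"
    have mem: "ideal C (poly_ring m)" "I \<subseteq> C" "C \<inter> polys U \<subseteq> {0}" if "C \<in> c" for C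
      using c(2) that unfolding subset.chain_def by blast+
    have lin: "C \<subseteq> D \<or> D \<subseteq> C" if "C \<in> c" "D \<in> c" for C D
      using c(2) that unfolding subset.chain_def by blast
    have "ideal (\<Union>c) (poly_ring m)"
    proof (rule poly_idealI)
      show "\<Union>c \<subseteq> polys {..<m}" using mem(1) poly_idealD(1) by blast
      show "0 \<in> \<Union>c" using c(1) mem(1) poly_idealD(2) by blast
      show "x + y \<in> \<Union>c" if "x \<in> \<Union>c" "y \<in> \<Union>c" for x y
      proof -
        from that obtain C D where CD: "C \<in> c" "D \<in> c" "x \<in> C" "y \<in> D" by blast
        then consider "x \<in> D" | "y \<in> C" using lin by blast
        then show ?thesis
        proof cases
          case 1
          then show ?thesis using poly_idealD(3)[OF mem(1)[OF CD(2)], of x y] CD by blast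
        next
          case 2
          then show ?thesis using poly_idealD(3)[OF mem(1)[OF CD(1)], of x y] CD by blast
        qed
      qed
      show "r * x \<in> \<Union>c" if "r \<in> polys {..<m}" "x \<in> \<Union>c" for r x
        using that mem(1) poly_idealD(4) by blast
    qed
    moreover have "I \<subseteq> \<Union>c" using c(1) mem(2) by blast
    moreover have "\<Union>c \<inter> polys U \<subseteq> {0}" using mem(3) by blast
    ultimately show "\<Union>c \<in> ?S" by blast
  qed
  then obtain P where PS: "P \<in> ?S" "\<forall>X\<in>?S. P \<subseteq> X \<longrightarrow> X = P" by (elim bexE)
  then have P: "ideal P (poly_ring m)" "I \<subseteq> P" "P \<inter> polys U \<subseteq> {0}" by simp_all
  have max: "X = P" if "ideal X (poly_ring m)" "I \<subseteq> X" "X \<inter> polys U \<subseteq> {0}" "P \<subseteq> X" for X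
    using PS(2) that by simp
  note PD = poly_idealD[OF P(1)]
  \<comment> \<open>By maximality, adjoining an element outside \<open>P\<close> produces a nonzero
    polynomial in the variables of \<open>U\<close>. If the product of two such elements were in
    \<open>P\<close>, so would be the product of the two polynomials.\<close>
  have bigger: "\<exists>p r. p \<in> P \<and> r \<in> polys {..<m} \<and> p + r * x \<in> polys U \<and> p + r * x \<noteq> 0"
    if x: "x \<in> polys {..<m}" "x \<notin> P" for x
  proof (rule ccontr)
    assume no: "\<not> ?thesis"
    let ?X = "{p + r * x | p r. p \<in> P \<and> r \<in> polys {..<m}}"
    have "ideal ?X (poly_ring m)"
    proof (rule poly_idealI)
      show "?X \<subseteq> polys {..<m}" using PD(1) x(1) by (auto intro!: polys_add polys_mult)
      show "0 \<in> ?X" using PD(2) by (auto intro!: exI[of _ 0])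
      show "y + z \<in> ?X" if "y \<in> ?X" "z \<in> ?X" for y z
      proof -
        from that obtain p r p' r' where "y = p + r * x" "z = p' + r' * x" "p \<in> P" "p' \<in> P" "r \<in> polys {..<m}" "r' \<in> polys {..<m}"
          by blast
        then have "y + z = (p + p') + (r + r') * x" "p + p' \<in> P" "r + r' \<in> polys {..<m}"
          using PD(3) by (auto simp: algebra_simps intro: polys_add)
        then show ?thesis by blast
      qed
      show "s * y \<in> ?X" if "s \<in> polys {..<m}" "y \<in> ?X" for s y
      proof -
        from that obtain p r where "y = p + r * x" "p \<in> P" "r \<in> polys {..<m}" by blast
        then have "s * y = s * p + (s * r) * x" "s * p \<in> P" "s * r \<in> polys {..<m}"
          using PD(4)[OF that(1)] polys_mult[OF that(1)] by (simp_all add: distrib_left mult.assoc)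
        then show ?thesis by blast
      qed
    qed
    moreover have PX: "P \<subseteq> ?X"
    proof
      fix p assume "p \<in> P"
      then show "p \<in> ?X" by (intro CollectI exI[of _ p] exI[of _ 0]) simp
    qed
    moreover have "?X \<inter> polys U \<subseteq> {0}" using no by blast
    ultimately have "?X = P" using max P(2) by blast
    moreover have "x \<in> ?X" using PD(2) by (intro CollectI exI[of _ 0] exI[of _ 1]) simp
    ultimately show False using x(2) by blast
  qed
  have "primeideal P (poly_ring m)"
    unfolding poly_primeideal_iff
  proof (intro conjI ballI impI)
    show "1 \<notin> P" using P(3) by auto
    fix x y assume xy: "x \<in> polys {..<m}" "y \<in> polys {..<m}" "x * y \<in> P"
    show "x \<in> P \<or> y \<in> P"
    proof (rule ccontr)
      assume no: "\<not> ?thesis"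
      obtain p r where p: "p \<in> P" "r \<in> polys {..<m}" "p + r * x \<in> polys U" "p + r * x \<noteq> 0" using bigger xy(1) no by blast
      obtain q s where q: "q \<in> P" "s \<in> polys {..<m}" "q + s * y \<in> polys U" "q + s * y \<noteq> 0" using bigger xy(2) no by blast
      have "(p + r * x) * (q + s * y) = (q + s * y) * p + ((r * x) * q + (r * s) * (x * y))"
        by (simp add: algebra_simps)
      also have "\<dots> \<in> P"
      proof (intro PD(3))
        have "q \<in> polys {..<m}" using q(1) PD(1) by blast
        then show "(q + s * y) * p \<in> P" using p(1) q(2) xy(2) by (intro PD(4) polys_add polys_mult)
        show "(r * x) * q \<in> P" using p(2) q(1) xy(1) by (intro PD(4) polys_mult)
        show "(r * s) * (x * y) \<in> P" using p(2) q(2) xy(3) by (intro PD(4)[of "r * s"] polys_mult)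
      qed
      finally have "(p + r * x) * (q + s * y) \<in> P \<inter> polys U" using p(3) q(3) by (simp add: polys_mult)
      then show False using P(3) p(4) q(4) by auto
    qed
  qed (rule P(1))
  then show thesis using that P by blast
qed

section \<open>Coefficients of polynomials over the subring \<open>polys V\<close>, and the lower
  bound for the height\<close>

definition coef_of :: "nat set \<Rightarrow> rpoly \<Rightarrow> (nat \<Rightarrow>\<^sub>0 nat) \<Rightarrow> rpoly"
  where "coef_of V f w = linext (\<lambda>u. if except V u = w then mon (except (- V) u) else 0) f"

lemma coef_of_add: "coef_of V (f + g) w = coef_of V f w + coef_of V g w"
  by (simp add: coef_of_def linext_add)

lemma coef_of_0 [simp]: "coef_of V 0 w = 0"
  by (simp add: coef_of_def linext_def)

lemma except_add: "except V (u + v) = except V u + except V (v :: 'i \<Rightarrow>\<^sub>0 nat)"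
  by (rule poly_mapping_eqI) (simp add: lookup_add)

lemma except_split: "except (- V) u + except V (u :: 'i \<Rightarrow>\<^sub>0 nat) = u"
  by (rule poly_mapping_eqI) (simp add: lookup_add)

lemma coef_of_polys: "f \<in> polys W \<Longrightarrow> coef_of V f w \<in> polys (W \<inter> V)"
  unfolding coef_of_def linext_def
proof (rule polys_sum, rule polys_qscale)
  fix u assume "f \<in> polys W" "u \<in> keys f"
  then have "keys u \<subseteq> W" by (simp add: polys_def)
  then have "keys (except (- V) u) \<subseteq> W \<inter> V" by (auto simp: keys_except)
  then show "(if except V u = w then mon (except (- V) u) else 0) \<in> polys (W \<inter> V)" by (simp add: polys_single)
qed

lemma coef_of_expansion:
  assumes "finite A" "except V ` keys f \<subseteq> A"
  shows "f = (\<Sum>w\<in>A. coef_of V f w * mon w)"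
proof -
  have "(\<Sum>w\<in>A. coef_of V f w * mon w) = (\<Sum>w\<in>A. \<Sum>u\<in>keys f.
      if except V u = w then qscale (lookup f u) (mon u) else 0)"
  proof (rule sum.cong[OF HOL.refl])
    fix w
    show "coef_of V f w * mon w = (\<Sum>u\<in>keys f. if except V u = w then qscale (lookup f u) (mon u) else 0)"
      unfolding coef_of_def linext_def sum_distrib_right
      by (rule sum.cong) (auto simp: qscale_mult_left mon_mult except_split)
  qed
  also have "\<dots> = (\<Sum>u\<in>keys f. \<Sum>w\<in>A. if except V u = w then qscale (lookup f u) (mon u) else 0)"
    by (rule sum.swap)
  also have "\<dots> = (\<Sum>u\<in>keys f. qscale (lookup f u) (mon u))"
    using assms by (intro sum.cong) auto
  also have "\<dots> = f" by (rule poly_expansion[symmetric])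
  finally show ?thesis by simp
qed

lemma coef_of_self:
  assumes "p \<in> polys V"
  shows "coef_of V p w = (if w = 0 then p else 0)"
proof -
  have e: "except V u = 0" "except (- V) u = u" if "u \<in> keys p" for u
  proof -
    have k: "keys u \<subseteq> V" using assms that by (simp add: polys_def)
    then have z: "lookup u i = 0" if "i \<notin> V" for i using that by (metis in_keys_iff subsetD)
    show "except V u = 0" "except (- V) u = u" by (rule poly_mapping_eqI, simp add: z)+
  qed
  have "coef_of V p w = (\<Sum>u\<in>keys p. if w = 0 then qscale (lookup p u) (mon u) else 0)"
    unfolding coef_of_def linext_def by (rule sum.cong) (auto simp: e)
  also have "\<dots> = (if w = 0 then p else 0)" using poly_expansion[of p] by simp
  finally show ?thesis .
qed

lemma coef_of_mult_mon:
  assumes p: "p \<in> polys V" and w: "except V w = w"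
  shows "coef_of V (p * mon w) w' = (if w' = w then p else 0)"
proof -
  have e: "except V u = 0" "except (- V) u = u" if "u \<in> keys p" for u
  proof -
    have k: "keys u \<subseteq> V" using p that by (simp add: polys_def)
    then have z: "lookup u i = 0" if "i \<notin> V" for i using that by (metis in_keys_iff subsetD)
    show "except V u = 0" "except (- V) u = u" by (rule poly_mapping_eqI, simp add: z)+
  qed
  have w0: "except (- V) w = 0" using except_split[of V w] w by simp
  have "p * mon w = (\<Sum>u\<in>keys p. qscale (lookup p u) (mon (u + w)))"
    by (subst poly_expansion[of p]) (simp add: sum_distrib_right qscale_mult_left mon_mult)
  then have "coef_of V (p * mon w) w' = (\<Sum>u\<in>keys p. qscale (lookup p u)
      (if except V (u + w) = w' then mon (except (- V) (u + w)) else 0))"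
    unfolding coef_of_def by (simp only: linext_sum linext_qscale linext_mon)
  also have "\<dots> = (\<Sum>u\<in>keys p. qscale (lookup p u) (if w = w' then mon u else 0))"
  proof (rule sum.cong[OF HOL.refl])
    fix u assume "u \<in> keys p"
    then have "except V (u + w) = w" "except (- V) (u + w) = u" by (simp_all add: except_add e w w0)
    then show "qscale (lookup p u) (if except V (u + w) = w' then mon (except (- V) (u + w)) else 0)
        = qscale (lookup p u) (if w = w' then mon u else 0)" by (simp only:)
  qed
  also have "\<dots> = (if w' = w then p else 0)" using poly_expansion[of p] by auto
  finally show ?thesis .
qed

lemma coef_of_mult:
  assumes A: "finite A" "except V ` keys f \<subseteq> A" "\<And>x. x \<in> A \<Longrightarrow> except V x = x"
    and B: "finite B" "except V ` keys g \<subseteq> B" "\<And>x. x \<in> B \<Longrightarrow> except V x = x"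
  shows "coef_of V (f * g) w = (\<Sum>x\<in>A. \<Sum>y\<in>B. if x + y = w then coef_of V f x * coef_of V g y else 0)"
proof -
  have pV: "coef_of V h x \<in> polys V" for h x
    using coef_of_polys[of h UNIV V x] by (simp add: polys_def)
  have "f * g = (\<Sum>x\<in>A. coef_of V f x * mon x) * (\<Sum>y\<in>B. coef_of V g y * mon y)"
    using coef_of_expansion[OF A(1,2)] coef_of_expansion[OF B(1,2)] by simp
  also have "\<dots> = (\<Sum>x\<in>A. \<Sum>y\<in>B. (coef_of V f x * coef_of V g y) * mon (x + y))"
    unfolding sum_product by (intro sum.cong HOL.refl) (simp add: mon_mult[symmetric] ac_simps)
  finally have "coef_of V (f * g) w = (\<Sum>x\<in>A. \<Sum>y\<in>B. coef_of V ((coef_of V f x * coef_of V g y) * mon (x + y)) w)"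
    unfolding coef_of_def[of V "f * g"] by (simp add: linext_sum coef_of_def)
  also have "\<dots> = (\<Sum>x\<in>A. \<Sum>y\<in>B. if x + y = w then coef_of V f x * coef_of V g y else 0)"
  proof (intro sum.cong HOL.refl)
    fix x y assume "x \<in> A" "y \<in> B"
    then have "except V (x + y) = x + y" using A(3) B(3) by (simp add: except_add)
    from coef_of_mult_mon[OF polys_mult[OF pV pV] this]
    show "coef_of V ((coef_of V f x * coef_of V g y) * mon (x + y)) w = (if x + y = w then coef_of V f x * coef_of V g y else 0)"
      by auto
  qed
  finally show ?thesis .
qed

text \<open>The ideal generated by \<open>P \<inter> polys V\<close>, described by the coefficients with respect to the variables
  outside \<open>V\<close>.\<close>

definition extended_ideal :: "nat \<Rightarrow> rpoly set \<Rightarrow> nat set \<Rightarrow> rpoly set"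
  where "extended_ideal m P V = {f \<in> polys {..<m}. \<forall>w. coef_of V f w \<in> P}"

lemma except_idem: "except V (except V u) = except V u"
  by (rule poly_mapping_eqI) simp

text \<open>As in Gauss's lemma: if neither factor lies in the ideal, take in each the largest
  exponent whose coefficient is outside \<open>P\<close>. In the coefficient of the product at the
  sum of these exponents, all terms but one lie in \<open>P\<close>.\<close>

lemma extended_ideal_prime:
  assumes P: "primeideal P (poly_ring m)"
  shows "primeideal (extended_ideal m P V) (poly_ring m)"
proof -
  have Pid: "ideal P (poly_ring m)" and P1: "1 \<notin> P"
    and Ppr: "x \<in> polys {..<m} \<Longrightarrow> y \<in> polys {..<m} \<Longrightarrow> x * y \<in> P \<Longrightarrow> x \<in> P \<or> y \<in> P" for x y
    using P unfolding poly_primeideal_iff by blast+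
  note PD = poly_idealD[OF Pid]
  have Psum: "(\<And>i. i \<in> S \<Longrightarrow> h i \<in> P) \<Longrightarrow> sum h S \<in> P" for h and S :: "'s set"
    by (rule qv.subspace_sum[OF poly_ideal_subspace[OF Pid]])
  define Ex where "Ex f = except V ` keys f" for f :: rpoly
  have Ex: "finite (Ex f)" "x \<in> Ex f \<Longrightarrow> except V x = x" for f x by (auto simp: Ex_def except_idem)
  have mult: "coef_of V (f * g) w = (\<Sum>x\<in>Ex f. \<Sum>y\<in>Ex g. if x + y = w then coef_of V f x * coef_of V g y else 0)" for f g w
    by (rule coef_of_mult) (auto simp: Ex_def except_idem)
  have cm: "coef_of V f x \<in> polys {..<m}" if "f \<in> polys {..<m}" for f x
    using coef_of_polys[OF that, of V x] polys_mono[of "{..<m} \<inter> V" "{..<m}"] by blast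
  have out: "coef_of V f x = 0" if "x \<notin> Ex f" for f x
    unfolding coef_of_def linext_def using that by (intro sum.neutral) (auto simp: Ex_def)
  show ?thesis
    unfolding poly_primeideal_iff
  proof (intro conjI ballI impI)
    show "ideal (extended_ideal m P V) (poly_ring m)"
    proof (rule poly_idealI)
      show "extended_ideal m P V \<subseteq> polys {..<m}" by (auto simp: extended_ideal_def)
      show "0 \<in> extended_ideal m P V" using PD(2) by (simp add: extended_ideal_def)
      show "x + y \<in> extended_ideal m P V" if "x \<in> extended_ideal m P V" "y \<in> extended_ideal m P V" for x y
        using that PD(3) by (auto simp: extended_ideal_def coef_of_add intro: polys_add)
      show "r * x \<in> extended_ideal m P V" if r: "r \<in> polys {..<m}" and x: "x \<in> extended_ideal m P V" for r x
        unfolding extended_ideal_def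
      proof (intro CollectI conjI allI)
        show "r * x \<in> polys {..<m}" using r x by (auto simp: extended_ideal_def intro: polys_mult)
        show "coef_of V (r * x) w \<in> P" for w
          unfolding mult using cm[OF r] x PD(2,4) by (intro Psum) (auto simp: extended_ideal_def)
      qed
    qed
    show "1 \<notin> extended_ideal m P V"
      using coef_of_self[of 1 V 0] P1 by (auto simp: extended_ideal_def intro!: exI[of _ 0])
    fix f g assume fg: "f \<in> polys {..<m}" "g \<in> polys {..<m}" "f * g \<in> extended_ideal m P V"
    show "f \<in> extended_ideal m P V \<or> g \<in> extended_ideal m P V"
    proof (rule ccontr)
      assume no: "\<not> ?thesis"
      define A where "A = {x \<in> Ex f. coef_of V f x \<notin> P}"
      define B where "B = {y \<in> Ex g. coef_of V g y \<notin> P}"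
      have fin: "finite A" "finite B" using Ex by (auto simp: A_def B_def)
      have ne: "A \<noteq> {}" "B \<noteq> {}"
        using no fg out PD(2) unfolding A_def B_def extended_ideal_def by fastforce+
      \<comment> \<open>Exponent vectors carry a linear order that is compatible with
        addition.\<close>
      define x0 where "x0 = Max A"
      define y0 where "y0 = Max B"
      have x0: "x0 \<in> A" and xmax: "\<And>x. x \<in> A \<Longrightarrow> x \<le> x0" using fin ne by (auto simp: x0_def)
      have y0: "y0 \<in> B" and ymax: "\<And>y. y \<in> B \<Longrightarrow> y \<le> y0" using fin ne by (auto simp: y0_def)
      let ?t = "\<lambda>x y. if x + y = x0 + y0 then coef_of V f x * coef_of V g y else 0"
      have rest: "?t x y \<in> P" if xy: "x \<in> Ex f" "y \<in> Ex g" "(x, y) \<noteq> (x0, y0)" for x y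
      proof (cases "x + y = x0 + y0")
        case True
        have "x \<notin> A \<or> y \<notin> B"
        proof (rule ccontr)
          assume "\<not> ?thesis"
          then have le: "x \<le> x0" "y \<le> y0" using xmax ymax by auto
          then consider "x < x0" | "y < y0" using xy(3) by fastforce
          then show False
          proof cases
            case 1
            then have "x + y < x0 + y0" using le(2) by (rule add_less_le_mono)
            then show False using True by simp
          next
            case 2
            then have "x + y < x0 + y0" using le(1) by (metis add_le_less_mono)
            then show False using True by simp
          qed
        qed
        then have "coef_of V f x \<in> P \<or> coef_of V g y \<in> P" using xy by (auto simp: A_def B_def)
        then have "coef_of V f x * coef_of V g y \<in> P"
          using PD(4)[of "coef_of V f x" "coef_of V g y"] PD(4)[of "coef_of V g y" "coef_of V f x"] cm[OF fg(1)] cm[OF fg(2)]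
          by (auto simp: mult.commute)
        then show ?thesis using True by simp
      qed (simp add: PD(2))
      let ?S = "Ex f \<times> Ex g"
      have m0: "(x0, y0) \<in> ?S" using x0 y0 by (auto simp: A_def B_def)
      have "coef_of V (f * g) (x0 + y0) = (\<Sum>(x, y)\<in>?S. ?t x y)"
        unfolding mult by (simp add: sum.cartesian_product)
      also have "\<dots> = ?t x0 y0 + (\<Sum>(x, y)\<in>?S - {(x0, y0)}. ?t x y)"
        using sum.remove[OF _ m0, of "\<lambda>(x, y). ?t x y"] Ex by simp
      finally have "coef_of V f x0 * coef_of V g y0 = coef_of V (f * g) (x0 + y0) - (\<Sum>(x, y)\<in>?S - {(x0, y0)}. ?t x y)"
        by simp
      also have "\<dots> \<in> P"
      proof (rule qv.subspace_diff[OF poly_ideal_subspace[OF Pid]])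
        show "coef_of V (f * g) (x0 + y0) \<in> P" using fg(3) by (simp add: extended_ideal_def)
        show "(\<Sum>(x, y)\<in>?S - {(x0, y0)}. ?t x y) \<in> P"
        proof (rule Psum)
          fix z assume z: "z \<in> ?S - {(x0, y0)}"
          obtain x y where "z = (x, y)" by (cases z)
          then show "(case z of (x, y) \<Rightarrow> ?t x y) \<in> P" using rest[of x y] z by auto
        qed
      qed
      finally have "coef_of V f x0 \<in> P \<or> coef_of V g y0 \<in> P"
        by (rule Ppr[OF cm[OF fg(1)] cm[OF fg(2)]])
      then show False using x0 y0 by (auto simp: A_def B_def)
    qed
  qed
qed

lemma polys_in_extended_ideal:
  assumes P: "ideal P (poly_ring m)" and p: "p \<in> P" "p \<in> polys V"
  shows "p \<in> extended_ideal m P V"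
  using coef_of_self[OF p(2)] p(1) poly_idealD(1,2)[OF P] by (auto simp: extended_ideal_def)

text \<open>The coefficients with respect to \<open>V\<close> lie in \<open>P\<close> and in
  \<open>polys V\<close>, hence in the larger ideal, which is closed under multiplication by the
  monomials of the expansion.\<close>

lemma extended_ideal_mono:
  assumes P: "primeideal P (poly_ring m)" and V: "V \<subseteq> V'"
  shows "extended_ideal m P V \<subseteq> extended_ideal m P V'"
proof
  fix f assume f: "f \<in> extended_ideal m P V"
  have Pid: "ideal P (poly_ring m)" using P unfolding poly_primeideal_iff by blast
  have id: "ideal (extended_ideal m P V') (poly_ring m)"
    using extended_ideal_prime[OF P, of V'] unfolding poly_primeideal_iff by blast
  have fm: "f \<in> polys {..<m}" using f by (simp add: extended_ideal_def)
  let ?A = "except V ` keys f"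
  have "coef_of V f w * mon w \<in> extended_ideal m P V'" if w: "w \<in> ?A" for w
  proof -
    have "coef_of V f w \<in> polys ({..<m} \<inter> V)" by (rule coef_of_polys[OF fm])
    then have "coef_of V f w \<in> polys V'" using polys_mono[of "{..<m} \<inter> V" V'] V by blast
    then have "coef_of V f w \<in> extended_ideal m P V'"
      using f by (intro polys_in_extended_ideal[OF Pid]) (auto simp: extended_ideal_def)
    moreover have "mon w \<in> polys {..<m}"
    proof (rule polys_single)
      obtain u where u: "u \<in> keys f" "w = except V u" using w by blast
      have "keys u \<subseteq> {..<m}" using u(1) fm by (simp add: polys_def)
      then show "keys w \<subseteq> {..<m}" unfolding u(2) keys_except by blast
    qed
    ultimately have "mon w * coef_of V f w \<in> extended_ideal m P V'" by (intro poly_idealD(4)[OF id])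
    then show ?thesis by (simp add: mult.commute)
  qed
  then have "(\<Sum>w\<in>?A. coef_of V f w * mon w) \<in> extended_ideal m P V'"
    by (rule qv.subspace_sum[OF poly_ideal_subspace[OF id]])
  then show "f \<in> extended_ideal m P V'" using coef_of_expansion[of ?A V f] by simp
qed

text \<open>A monomial is determined by its parts inside and outside \<open>V\<close>, so no terms
  cancel in the coefficient.\<close>

lemma coef_of_nonzero:
  assumes "u \<in> keys f"
  shows "coef_of V f (except V u) \<noteq> 0"
proof -
  have eq: "x = u" if "except V x = except V u" "except (- V) x = except (- V) u" for x
    using that by (metis except_split)
  have "lookup (coef_of V f (except V u)) (except (- V) u)
      = (\<Sum>x\<in>keys f. if x = u then lookup f u else 0)"
    unfolding coef_of_def linext_def lookup_sum
  proof (rule sum.cong[OF HOL.refl])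
    fix x
    show "lookup (qscale (lookup f x) (if except V x = except V u then mon (except (- V) x) else 0)) (except (- V) u)
        = (if x = u then lookup f u else 0)"
      using eq[of x] by (auto simp: lookup_single when_def)
  qed
  also have "\<dots> = lookup f u" using assms by simp
  finally show ?thesis using assms by (auto simp: in_keys_iff)
qed

text \<open>Starting from a maximal algebraically independent set \<open>U\<close> of variables modulo \<open>P\<close>, the variables outside \<open>U\<close>
  are added one at a time to obtain a chain of extended ideals.\<close>

lemma prime_height_ge:
  assumes P: "primeideal P (poly_ring m)" and dep: "\<And>U. U \<subseteq> {..<m} \<Longrightarrow> m < card U + r \<Longrightarrow> \<not> P \<inter> polys U \<subseteq> {0}"
  shows "enat r \<le> prime_height (poly_ring m) P"
proof -
  have Pid: "ideal P (poly_ring m)" and P1: "1 \<notin> P"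
    using P unfolding poly_primeideal_iff by blast+
  note PD = poly_idealD[OF Pid]
  define good where "good U \<longleftrightarrow> U \<subseteq> {..<m} \<and> P \<inter> polys U \<subseteq> {0}" for U
  have "good {}"
    unfolding good_def
  proof (intro conjI subsetI)
    fix p assume p: "p \<in> P \<inter> polys {}"
    then have "keys p \<subseteq> {0}" by (auto simp: polys_def)
    then have p0: "p = single 0 (lookup p 0)"
      using sum_single_keys[of "{0}" p] by simp
    define c where "c = lookup p 0"
    have "c = 0"
    proof (rule ccontr)
      assume "c \<noteq> 0"
      then have "qscale (inverse c) p = 1"
        by (subst p0) (simp add: qscale_single c_def[symmetric])
      moreover have "qscale (inverse c) p \<in> P"
        using p by (intro qv.subspace_scale[OF poly_ideal_subspace[OF Pid]]) auto
      ultimately show False using P1 by simp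
    qed
    then show "p \<in> {0}" using p0 by (simp add: c_def)
  qed simp
  moreover have "card U \<le> m" if "good U" for U
    using that card_mono[of "{..<m}" U] by (simp add: good_def)
  ultimately obtain U where U: "good U" and max: "\<And>U'. good U' \<Longrightarrow> card U' \<le> card U"
    using ex_has_greatest_nat[of good "{}" card "m + 1"] by (metis less_Suc_eq_le Suc_eq_plus1)
  have Um: "U \<subseteq> {..<m}" "P \<inter> polys U \<subseteq> {0}" using U by (auto simp: good_def)
  have finU: "finite U" using Um(1) by (rule finite_subset) simp
  \<comment> \<open>Hypothesis \<open>dep\<close> bounds the size of \<open>U\<close>, so at least
    \<open>r\<close> variables remain to be added.\<close>
  have r: "card U + r \<le> m" using dep[OF Um(1)] Um(2) by (meson not_less)
  define n where "n = card ({..<m} - U)"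
  have n: "r \<le> n" using r finU Um(1) by (simp add: n_def card_Diff_subset)
  obtain j where j: "bij_betw j {..<n} ({..<m} - U)"
    using ex_bij_betw_nat_finite[of "{..<m} - U"] by (auto simp: n_def lessThan_atLeast0)
  define V where "V i = U \<union> j ` {..<i}" for i
  define C where "C i = extended_ideal m P (V i)" for i
  have jm: "j i \<in> {..<m} - U" if "i < n" for i using j that by (auto simp: bij_betw_def)
  have "C n = P"
  proof -
    have Vn: "V n = {..<m}" using j Um(1) by (auto simp: V_def bij_betw_def)
    have "f \<in> C n \<longleftrightarrow> f \<in> P" for f
    proof
      assume "f \<in> C n"
      then have "f \<in> polys {..<m}" "coef_of {..<m} f 0 \<in> P" by (auto simp: C_def Vn extended_ideal_def)
      then show "f \<in> P" using coef_of_self[of f "{..<m}" 0] by simp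
    next
      assume "f \<in> P"
      then show "f \<in> C n" unfolding C_def Vn using PD(1) by (intro polys_in_extended_ideal[OF Pid]) auto
    qed
    then show ?thesis by blast
  qed
  moreover have "primeideal (C i) (poly_ring m)" for i unfolding C_def by (rule extended_ideal_prime[OF P])
  moreover have "C i \<subset> C (Suc i)" if i: "i < n" for i
  proof
    have VS: "V (Suc i) = insert (j i) (V i)" by (auto simp: V_def lessThan_Suc)
    show "C i \<subseteq> C (Suc i)" unfolding C_def by (rule extended_ideal_mono[OF P]) (auto simp: VS)
    have "card (insert (j i) U) = Suc (card U)" using jm[OF i] finU by simp
    \<comment> \<open>Maximality of \<open>U\<close> gives strictness: \<open>P\<close> contains a
      nonzero \<open>f\<close> in the variables of \<open>U\<close> and \<open>j i\<close>. Since
      \<open>j i\<close> is not in \<open>V i\<close>, the coefficients of \<open>f\<close> with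
      respect to \<open>V i\<close> involve only \<open>U\<close>; a nonzero one is not in
      \<open>P\<close>, so \<open>f\<close> is missing from \<open>C i\<close>.\<close>
    then have "\<not> good (insert (j i) U)" using max[of "insert (j i) U"] by auto
    then obtain f where f: "f \<in> P" "f \<in> polys (insert (j i) U)" "f \<noteq> 0"
      using jm[OF i] Um(1) by (auto simp: good_def)
    have "f \<in> polys (V (Suc i))" using f(2) polys_mono[of "insert (j i) U" "V (Suc i)"] by (auto simp: VS V_def)
    then have fS: "f \<in> C (Suc i)" unfolding C_def using f(1) by (intro polys_in_extended_ideal[OF Pid])
    have "keys f \<noteq> {}" using f(3) by (metis (no_types) ex_in_conv in_keys_iff lookup_zero poly_mapping_eqI)
    then obtain u where u: "u \<in> keys f" by blast
    have "j i \<notin> V i"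
    proof
      assume "j i \<in> V i"
      then obtain k where "k < i" "j k = j i" using jm[OF i] by (auto simp: V_def)
      then show False using j i unfolding bij_betw_def inj_on_def by (metis less_irrefl lessThan_iff less_trans)
    qed
    then have "insert (j i) U \<inter> V i \<subseteq> U" by auto
    then have "coef_of (V i) f (except (V i) u) \<in> polys U"
      using coef_of_polys[OF f(2), of "V i"] polys_mono by blast
    then have "coef_of (V i) f (except (V i) u) \<notin> P" using coef_of_nonzero[OF u, of "V i"] Um(2) by blast
    then have "f \<notin> C i" by (auto simp: C_def extended_ideal_def)
    then show "C i \<noteq> C (Suc i)" using fS by blast
  qed
  ultimately have "enat n \<in> {enat n | n. \<exists>C :: nat \<Rightarrow> rpoly set. (\<forall>i\<le>n. primeideal (C i) (poly_ring m)) \<and> (\<forall>i<n. C i \<subset> C (Suc i)) \<and> C n = P}"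
    by blast
  then have "enat n \<le> prime_height (poly_ring m) P" unfolding prime_height_def by (rule Sup_upper)
  then show ?thesis using n by (meson enat_ord_simps(1) order_trans)
qed

text \<open>Sending a monomial to its degree is a linear map into the group ring that kills the
  ideal. Distinct monomials in the variables of \<open>U\<close> go to distinct basis
  elements.\<close>

lemma span_binomials_independent_polys:
  assumes U: "\<And>u v. keys u \<subseteq> U \<Longrightarrow> keys v \<subseteq> U \<Longrightarrow> xdeg {..<m} a u = xdeg {..<m} a v \<Longrightarrow> u = v"
  shows "qv.span (binomials m a) \<inter> polys U \<subseteq> {0}"
proof
  fix f assume f: "f \<in> qv.span (binomials m a) \<inter> polys U"
  define h :: "(nat \<Rightarrow>\<^sub>0 nat) \<Rightarrow> 'a \<Rightarrow>\<^sub>0 rat" where "h u = single (xdeg {..<m} a u) 1" for u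
  have "linext h g = 0" if "g \<in> qv.span (binomials m a)" for g
    using that
  proof (induction rule: qv.span_induct_alt)
    case base
    then show ?case by (simp add: linext_def)
  next
    case (step c x y)
    then have "linext h x = 0" by (auto simp: binomials_def linext_diff h_def)
    then show ?case using step by (simp add: linext_add linext_qscale)
  qed
  then have z: "linext h f = 0" using f by blast
  have "lookup f u = 0" for u
  proof (cases "u \<in> keys f")
    case True
    have k: "keys x \<subseteq> U" if "x \<in> keys f" for x using f that by (auto simp: polys_def)
    have "lookup (linext h f) (xdeg {..<m} a u) = (\<Sum>x\<in>keys f. if x = u then lookup f u else 0)"
      unfolding linext_def lookup_sum
    proof (rule sum.cong[OF HOL.refl])
      fix x assume x: "x \<in> keys f"
      show "lookup (qscale (lookup f x) (h x)) (xdeg {..<m} a u) = (if x = u then lookup f u else 0)"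
        using U[OF k[OF x] k[OF True]] by (auto simp: h_def lookup_single when_def)
    qed
    then show ?thesis using True z by simp
  qed (simp add: in_keys_iff)
  then have "f = 0" by (intro poly_mapping_eqI) simp
  then show "f \<in> {0}" by simp
qed

text \<open>A prime avoiding the variables of a complement \<open>U\<close> of the relations gives
  the upper bound. The lower bound uses binomials of the ideal only, and these lie in every prime
  above it.\<close>

theorem ideal_height_binomials:
  "ideal_height (poly_ring m) (qv.span (binomials m a)) = enat (relrank {..<m} a)"
proof (rule antisym)
  let ?I = "qv.span (binomials m a)"
  obtain U where U: "U \<subseteq> {..<m}" "card U + relrank {..<m} a = card {..<m}"
    "\<And>u v. keys u \<subseteq> U \<Longrightarrow> keys v \<subseteq> U \<Longrightarrow> xdeg {..<m} a u = xdeg {..<m} a v \<Longrightarrow> u = v"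
    using complement_of_relations[of "{..<m}" a] by (metis finite_lessThan)
  have "?I \<inter> polys U \<subseteq> {0}" by (rule span_binomials_independent_polys[OF U(3)])
  then obtain P where P: "primeideal P (poly_ring m)" "?I \<subseteq> P" "P \<inter> polys U \<subseteq> {0}"
    using exists_prime_avoiding[OF span_binomials_ideal U(1)] by metis
  have "ideal_height (poly_ring m) ?I \<le> prime_height (poly_ring m) P"
    unfolding ideal_height_def using P(1,2) by (intro Inf_lower) blast
  also have "\<dots> \<le> enat (m - card U)" by (rule prime_height_le[OF P(1) U(1) P(3)])
  also have "m - card U = relrank {..<m} a" using U(2) by simp
  finally show "ideal_height (poly_ring m) ?I \<le> enat (relrank {..<m} a)" .
  show "enat (relrank {..<m} a) \<le> ideal_height (poly_ring m) ?I"
    unfolding ideal_height_def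
  proof (rule Inf_greatest)
    fix x assume "x \<in> {prime_height (poly_ring m) P | P. primeideal P (poly_ring m) \<and> ?I \<subseteq> P}"
    then obtain P where P: "x = prime_height (poly_ring m) P" "primeideal P (poly_ring m)" "?I \<subseteq> P" by blast
    show "enat (relrank {..<m} a) \<le> x"
      unfolding P(1)
    proof (rule prime_height_ge[OF P(2)])
      fix U assume U: "U \<subseteq> {..<m}" "m < card U + relrank {..<m} a"
      obtain u v where uv: "keys u \<subseteq> U" "keys v \<subseteq> U" "u \<noteq> v" "xdeg {..<m} a u = xdeg {..<m} a v"
        using relation_in_large_subset[of "{..<m}" U a] U by (metis card_lessThan finite_lessThan)
      have "mon u - mon v \<in> binomials m a" unfolding binomials_def using uv U(1) by blast
      then have "mon u - mon v \<in> P" using P(3) qv.span_base by blast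
      moreover have "mon u - mon v \<in> polys U" using uv by (intro polys_diff polys_single)
      moreover have "mon u - mon v \<noteq> 0"
      proof
        assume "mon u - mon v = 0"
        then have "lookup (mon u) u = lookup (mon v) u" by simp
        then show False using uv(3) by (simp add: lookup_single when_def split: if_splits)
      qed
      ultimately show "\<not> P \<inter> polys U \<subseteq> {0}" by blast
    qed
  qed
qed

section \<open>Complete intersections\<close>

lemma min_generators_attained:
  assumes "min_generators R I = enat n"
  obtains B where "finite B" "B \<subseteq> carrier R" "genideal R B = I" "card B = n"
proof -
  let ?S = "{enat (card B) | B. finite B \<and> B \<subseteq> carrier R \<and> genideal R B = I}"
  have inf: "Inf ?S = enat n" using assms by (simp add: min_generators_def)
  have "?S \<noteq> {}"
  proof
    assume "?S = {}"
    then have "Inf ?S = \<infinity>" by (simp only: Inf_empty top_enat_def)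
    then show False using inf by simp
  qed
  then obtain k where "k \<in> ?S" unfolding ex_in_conv[symmetric] by (rule exE)
  then have "Inf ?S \<in> ?S" by (rule wellorder_InfI)
  then have "enat n \<in> ?S" using inf by simp
  then show thesis using that by blast
qed

text \<open>The rank equals the height and is a lower bound for the size of every finite generating
  set, so being a complete intersection reduces to an inequality.\<close>

lemma complete_intersection_iff:
  fixes a :: "nat \<Rightarrow> 'g::ab_group_add"
  shows "complete_intersection m a \<longleftrightarrow>
    (\<exists>B. finite B \<and> B \<subseteq> polys {..<m} \<and> genideal (poly_ring m) B = qv.span (binomials m a) \<and> card B \<le> relrank {..<m} a)"
proof -
  let ?I = "qv.span (binomials m a)"
  have ci: "complete_intersection m a \<longleftrightarrow> min_generators (poly_ring m) ?I = enat (relrank {..<m} a)"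
    by (simp add: complete_intersection_def lattice_ideal_span ideal_height_binomials)
  show ?thesis
    unfolding ci
  proof
    assume "min_generators (poly_ring m) ?I = enat (relrank {..<m} a)"
    then show "\<exists>B. finite B \<and> B \<subseteq> polys {..<m} \<and> genideal (poly_ring m) B = ?I \<and> card B \<le> relrank {..<m} a"
      by (rule min_generators_attained) auto
  next
    assume "\<exists>B. finite B \<and> B \<subseteq> polys {..<m} \<and> genideal (poly_ring m) B = ?I \<and> card B \<le> relrank {..<m} a"
    then obtain B where B: "finite B" "B \<subseteq> polys {..<m}" "genideal (poly_ring m) B = ?I" "card B \<le> relrank {..<m} a"
      by (elim exE conjE)
    show "min_generators (poly_ring m) ?I = enat (relrank {..<m} a)"
    proof (rule antisym)
      have "min_generators (poly_ring m) ?I \<le> enat (card B)"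
        unfolding min_generators_def by (intro Inf_lower CollectI exI[of _ B] conjI HOL.refl B) (simp add: B(2))
      then show "min_generators (poly_ring m) ?I \<le> enat (relrank {..<m} a)"
        using B(4) by (meson enat_ord_simps(1) order_trans)
      show "enat (relrank {..<m} a) \<le> min_generators (poly_ring m) ?I"
        unfolding min_generators_def
      proof (rule Inf_greatest)
        fix x assume "x \<in> {enat (card B) | B. finite B \<and> B \<subseteq> carrier (poly_ring m) \<and> genideal (poly_ring m) B = ?I}"
        then obtain B where B: "x = enat (card B)" "finite B" "B \<subseteq> carrier (poly_ring m)" "genideal (poly_ring m) B = ?I"
          by (elim CollectE exE conjE)
        have "relrank {..<m} a \<le> card B" using B(3) by (intro relrank_le_card_generators[OF B(2) _ B(4)]) simp
        then show "enat (relrank {..<m} a) \<le> x" unfolding B(1) by simp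
      qed
    qed
  qed
qed

theorem complete_intersection_completely_glued:
  fixes a :: "nat \<Rightarrow> 'g::ab_group_add"
  assumes inv: "no_invertibles (nspan (a ` {..<m}))"
  shows "complete_intersection m a \<longleftrightarrow> completely_glued (nspan (a ` {..<m}))"
proof -
  define J where "J = {i. i < m \<and> a i \<noteq> 0}"
  define Z where "Z = {i. i < m \<and> a i = 0}"
  have fin: "finite J" "finite Z" and JZ: "J \<union> Z = {..<m}" "{..<m} - J = Z" by (auto simp: J_def Z_def)
  have nz: "a j \<noteq> 0" if "j \<in> J" for j using that by (simp add: J_def)
  have zJ: "zdeg {..<m} a f = zdeg J a f" for f
    unfolding zdeg_def by (rule sum.mono_neutral_right) (auto simp: J_def)
  have eq: "nspan (a ` J) = nspan (a ` {..<m})"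
    using zJ fin by (auto simp: nspan_image_iff)
  have invJ: "no_invertibles (nspan (a ` J))" unfolding eq by (rule inv)
  show ?thesis
  proof
    assume "complete_intersection m a"
    then obtain B where B: "finite B" "B \<subseteq> polys {..<m}" "genideal (poly_ring m) B = qv.span (binomials m a)"
      "card B \<le> relrank {..<m} a" unfolding complete_intersection_iff by (elim exE conjE)
    obtain K :: "nat set" and p q where K: "presents J a K p q" "\<forall>k\<in>K. p k \<noteq> q k" "card K + card Z \<le> card B"
      by (rule generators_presentation[OF inv B(1-3), folded J_def Z_def])
    \<comment> \<open>The zero generators account for \<open>card Z\<close> ideal generators and for
      at most \<open>card Z\<close> of the rank, so they cancel in the comparison.\<close>
    have "relrank {..<m} a \<le> relrank J a + card ({..<m} - J)"
      by (rule relrank_nonzero_part) (auto simp: J_def)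
    then have "card K \<le> relrank J a" using K(3) B(4) JZ(2) by simp
    then have "completely_glued (nspan (a ` J))"
      by (intro presents_completely_glued[OF fin(1) invJ _ K(1)]) (use nz K(2) in auto)
    then show "completely_glued (nspan (a ` {..<m}))" unfolding eq .
  next
    assume "completely_glued (nspan (a ` {..<m}))"
    then have "ci_presentation J a"
      using completely_glued_ci_presentation[of "nspan (a ` {..<m})"] fin(1) nz eq by metis
    moreover have "a ` Z \<subseteq> nspan (a ` J)"
    proof
      fix x assume "x \<in> a ` Z"
      then have "x = zdeg J a (\<lambda>_. 0)" by (auto simp: Z_def)
      then show "x \<in> nspan (a ` J)" unfolding nspan_image_iff[OF fin(1)] by (intro exI[of _ "\<lambda>_. 0"]) simp
    qed
    ultimately have "ci_presentation {..<m} a"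
      using ci_presentation_insert_many[OF fin] JZ(1) by metis
    then obtain K :: "nat set" and p q where K: "presents {..<m} a K p q" "independent_relations K p q"
      by (auto simp: ci_presentation_def)
    let ?B = "(\<lambda>k. mon (p k) - mon (q k)) ` K"
    note PR = presentsD[OF K(1)]
    have "card ?B \<le> card K" using PR(1) by (rule card_image_le)
    also have "\<dots> \<le> relrank {..<m} a" by (rule independent_relations_card_le_relrank[OF finite_lessThan K])
    finally have "card ?B \<le> relrank {..<m} a" .
    moreover have "?B \<subseteq> polys {..<m}"
      using PR(2,3) by (auto intro!: polys_diff polys_single)
    moreover have "genideal (poly_ring m) ?B = qv.span (binomials m a)" by (rule presents_generates[OF K(1)])
    moreover have "finite ?B" using PR(1) by simp
    ultimately show "complete_intersection m a"
      unfolding complete_intersection_iff by (intro exI[of _ ?B] conjI)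
  qed
qed

theorem theorem3p16:
  fixes n m :: nat
    and a :: "nat \<Rightarrow> (nat \<Rightarrow>\<^sub>0 int) \<times> 't::{finite, ab_group_add}"
  assumes "\<And>i. i < m \<Longrightarrow> Poly_Mapping.keys (fst (a i)) \<subseteq> {..<n}"
    and "no_invertibles (nspan (a ` {..<m}))"
  shows "complete_intersection m a \<longleftrightarrow> completely_glued (nspan (a ` {..<m}))"
  using assms(2) by (rule complete_intersection_completely_glued)

end
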